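(* Let $U$ be a semi-algebraic connected open subset of $\mathbb{R}^n$ with coordinates $x=(x_1,\dots,x_n)$, and let $f$ be a real analytic function on $U$. Then the following conditions are equivalent: (1) $f$ is a Nash function on $U$. (2) There exists a Nash function $g\in\mathcal N(U)$, not identically zero on $U$, such that $$g\Big(\mathbf d f-\sum_{i=1}^n \frac{\partial f}{\partial x_i}\,\mathbf d x_i\Big)=0$$ in the module $\Omega_{\mathcal E(U)}$ of Kähler differentials of $\mathcal E(U)$. (3) $\mathbf d f=\sum_{i=1}^n \frac{\partial f}{\partial x_i}\,\mathbf d x_i$ in the module $\Omega_{\widetilde{\mathcal E}(U)}$ of Kähler differentials of $\widetilde{\mathcal E}(U)$. (4) There exist $f_1,\dots,f_n\in\widetilde{\mathcal E}(U)$ such that $\mathbf d f=\sum_{i=1}^n f_i\,\mathbf d x_i$ in $\Omega_{\widetilde{\mathcal E}(U)}$.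
   Context: A Nash function on an open set $U\subset\mathbb{R}^n$ is a real analytic function $f$ on $U$ for which there is a non-zero polynomial $P(x,y)\in\mathbb{R}[x_1,\dots,x_n,y]$ with $P(x,f(x))=0$ for all $x\in U$. $\mathcal E(U)$ denotes the $\mathbb{R}$-algebra of $C^\infty$ functions on $U$ and $\mathcal N(U)$ the subalgebra of Nash functions. For an $\mathbb{R}$-algebra $A$, $\Omega_A$ is the module of Kähler differentials: the quotient of the free $A$-module on symbols $\mathbf d h$ ($h\in A$) by the submodule generated by all $\mathbf d(h+k)-\mathbf d h-\mathbf d k$, $\mathbf d(\lambda \ell)-\lambda\mathbf d \ell$, $\mathbf d(pq)-p\,\mathbf d q-q\,\mathbf d p$ ($h,k,\ell,p,q\in A$, $\lambda\in\mathbb{R}$), with $\mathbf d:A\to\Omega_A$ sending $h$ to the class of $\mathbf d h$. Here $x_i$ denotes the coordinate function. Let $S\subset\mathcal N(U)$ be the multiplicative set of Nash functions not identically zero on $U$, and $\widetilde{\mathcal E}(U)=\mathcal E(U)_S$ the localization of $\mathcal E(U)$ at $S$. *)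

theory Defs
  imports "HOL-Analysis.Analysis"
begin

text \<open>Real polynomial functions in variables indexed by 'v (built from constants
and coordinates by sums and products). Over the infinite field R a polynomial is
the zero polynomial iff its polynomial function vanishes identically.\<close>
inductive poly_fun :: "(('v \<Rightarrow> real) \<Rightarrow> real) \<Rightarrow> bool" where
  pf_const: "poly_fun (\<lambda>x. c)"
| pf_var: "poly_fun (\<lambda>x. x v)"
| pf_add: "poly_fun p \<Longrightarrow> poly_fun q \<Longrightarrow> poly_fun (\<lambda>x. p x + q x)"
| pf_mult: "poly_fun p \<Longrightarrow> poly_fun q \<Longrightarrow> poly_fun (\<lambda>x. p x * q x)"

inductive semialg :: "(real^'n) set \<Rightarrow> bool" where
  sa_eq: "poly_fun P \<Longrightarrow> semialg {x. P (vec_nth x) = 0}"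
| sa_pos: "poly_fun P \<Longrightarrow> semialg {x. P (vec_nth x) > 0}"
| sa_un: "semialg A \<Longrightarrow> semialg B \<Longrightarrow> semialg (A \<union> B)"
| sa_int: "semialg A \<Longrightarrow> semialg B \<Longrightarrow> semialg (A \<inter> B)"
| sa_compl: "semialg A \<Longrightarrow> semialg (- A)"

definition real_analytic_on :: "(real^'n \<Rightarrow> real) \<Rightarrow> (real^'n) set \<Rightarrow> bool" where
  "real_analytic_on f U \<longleftrightarrow>
     (\<forall>a\<in>U. \<exists>r>0. ball a r \<subseteq> U \<and> (\<exists>c :: ('n \<Rightarrow> nat) \<Rightarrow> real.
        \<forall>x\<in>ball a r. ((\<lambda>\<alpha>. c \<alpha> * (\<Prod>i\<in>UNIV. (x$i - a$i) ^ \<alpha> i)) has_sum f x) UNIV))"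

definition partial :: "'n::finite \<Rightarrow> (real^'n \<Rightarrow> real) \<Rightarrow> real^'n \<Rightarrow> real" where
  "partial i f x = (SOME D. ((\<lambda>t. f (x + t *\<^sub>R axis i 1)) has_real_derivative D) (at 0))"

fun ipartial :: "'n::finite list \<Rightarrow> (real^'n \<Rightarrow> real) \<Rightarrow> real^'n \<Rightarrow> real" where
  "ipartial [] f = f"
| "ipartial (i # is) f = partial i (ipartial is f)"

definition smooth_on :: "(real^'n) set \<Rightarrow> (real^'n \<Rightarrow> real) \<Rightarrow> bool" where
  "smooth_on U f \<longleftrightarrow>
     (\<forall>is. continuous_on U (ipartial is f) \<and>
        (\<forall>i. \<forall>x\<in>U. (\<lambda>t. ipartial is f (x + t *\<^sub>R axis i 1)) differentiable (at 0)))"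

definition ext_pt :: "real^'n \<Rightarrow> real \<Rightarrow> ('n option \<Rightarrow> real)" where
  "ext_pt x y = (\<lambda>v. case v of None \<Rightarrow> y | Some i \<Rightarrow> x $ i)"

definition nash_on :: "(real^'n) set \<Rightarrow> (real^'n \<Rightarrow> real) \<Rightarrow> bool" where
  "nash_on U f \<longleftrightarrow> real_analytic_on f U \<and>
     (\<exists>P :: ('n option \<Rightarrow> real) \<Rightarrow> real. poly_fun P \<and> P \<noteq> (\<lambda>_. 0) \<and>
        (\<forall>x\<in>U. P (ext_pt x (f x)) = 0))"

text \<open>Functions on U are represented by functions on R^n vanishing outside U.\<close>
definition restr :: "(real^'n) set \<Rightarrow> (real^'n \<Rightarrow> real) \<Rightarrow> real^'n \<Rightarrow> real" where
  "restr U f = (\<lambda>x. if x \<in> U then f x else 0)"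

record 'a ralg =
  carr :: "'a set"
  add :: "'a \<Rightarrow> 'a \<Rightarrow> 'a"
  mul :: "'a \<Rightarrow> 'a \<Rightarrow> 'a"
  scl :: "real \<Rightarrow> 'a \<Rightarrow> 'a"
  zer :: "'a"
  one :: "'a"

text \<open>Elements of the free A-module on the symbols dh (h in A) are represented
by coefficient functions 'a => 'a (coefficient of dh at h).\<close>
definition fz :: "'a ralg \<Rightarrow> 'a \<Rightarrow> 'a" where
  "fz A = (\<lambda>h. zer A)"
definition fplus :: "'a ralg \<Rightarrow> ('a \<Rightarrow> 'a) \<Rightarrow> ('a \<Rightarrow> 'a) \<Rightarrow> 'a \<Rightarrow> 'a" where
  "fplus A F G = (\<lambda>h. add A (F h) (G h))"
definition fmul :: "'a ralg \<Rightarrow> 'a \<Rightarrow> ('a \<Rightarrow> 'a) \<Rightarrow> 'a \<Rightarrow> 'a" where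
  "fmul A a F = (\<lambda>h. mul A a (F h))"
definition fscl :: "'a ralg \<Rightarrow> real \<Rightarrow> ('a \<Rightarrow> 'a) \<Rightarrow> 'a \<Rightarrow> 'a" where
  "fscl A c F = (\<lambda>h. scl A c (F h))"
definition dsym :: "'a ralg \<Rightarrow> 'a \<Rightarrow> 'a \<Rightarrow> 'a" where
  "dsym A h = (\<lambda>k. if k = h then one A else zer A)"

definition kahler_gens :: "'a ralg \<Rightarrow> ('a \<Rightarrow> 'a) set" where
  "kahler_gens A =
     {fplus A (dsym A (add A h k)) (fscl A (-1) (fplus A (dsym A h) (dsym A k))) | h k.
        h \<in> carr A \<and> k \<in> carr A}
   \<union> {fplus A (dsym A (scl A c l)) (fscl A (-1) (fscl A c (dsym A l))) | c l. l \<in> carr A}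
   \<union> {fplus A (dsym A (mul A p q)) (fscl A (-1) (fplus A (fmul A p (dsym A q)) (fmul A q (dsym A p)))) | p q.
        p \<in> carr A \<and> q \<in> carr A}"

inductive_set kahler_rel :: "'a ralg \<Rightarrow> ('a \<Rightarrow> 'a) set" for A where
  kr_zero: "fz A \<in> kahler_rel A"
| kr_step: "r \<in> kahler_gens A \<Longrightarrow> a \<in> carr A \<Longrightarrow> k \<in> kahler_rel A \<Longrightarrow>
            fplus A (fmul A a r) k \<in> kahler_rel A"

definition kahler_eq :: "'a ralg \<Rightarrow> ('a \<Rightarrow> 'a) \<Rightarrow> ('a \<Rightarrow> 'a) \<Rightarrow> bool" where
  "kahler_eq A F G \<longleftrightarrow> fplus A F (fscl A (-1) G) \<in> kahler_rel A"

fun fsum_list :: "'a ralg \<Rightarrow> ('a \<Rightarrow> 'a) list \<Rightarrow> 'a \<Rightarrow> 'a" where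
  "fsum_list A [] = fz A"
| "fsum_list A (F # Fs) = fplus A F (fsum_list A Fs)"

definition idx_list :: "'n::finite list" where
  "idx_list = (SOME xs. distinct xs \<and> set xs = UNIV)"

definition lin_comb :: "'a ralg \<Rightarrow> ('n::finite \<Rightarrow> 'a) \<Rightarrow> ('n \<Rightarrow> 'a) \<Rightarrow> 'a \<Rightarrow> 'a" where
  "lin_comb A c xs = fsum_list A (map (\<lambda>i. fmul A (c i) (dsym A (xs i))) idx_list)"

type_synonym 'n fn = "real^'n \<Rightarrow> real"

definition E_alg :: "(real^'n) set \<Rightarrow> ('n fn) ralg" where
  "E_alg U = \<lparr>carr = {f. smooth_on U f \<and> (\<forall>x. x \<notin> U \<longrightarrow> f x = 0)},
              add = (\<lambda>f g x. f x + g x), mul = (\<lambda>f g x. f x * g x),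
              scl = (\<lambda>c f x. c * f x), zer = (\<lambda>x. 0), one = restr U (\<lambda>x. 1)\<rparr>"

definition coordE :: "(real^'n) set \<Rightarrow> 'n \<Rightarrow> 'n fn" where
  "coordE U i = restr U (\<lambda>x. x $ i)"

definition nash_S :: "(real^'n) set \<Rightarrow> ('n fn) set" where
  "nash_S U = {g. g \<in> carr (E_alg U) \<and> nash_on U g \<and> (\<exists>x\<in>U. g x \<noteq> 0)}"

definition loc_rel :: "(real^'n) set \<Rightarrow> ('n fn \<times> 'n fn) \<Rightarrow> ('n fn \<times> 'n fn) \<Rightarrow> bool" where
  "loc_rel U p q \<longleftrightarrow>
     (\<exists>u\<in>nash_S U. \<forall>x. u x * (fst p x * snd q x - fst q x * snd p x) = 0)"

definition loc_cls :: "(real^'n) set \<Rightarrow> ('n fn \<times> 'n fn) \<Rightarrow> ('n fn \<times> 'n fn) set" where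
  "loc_cls U p = {q. fst q \<in> carr (E_alg U) \<and> snd q \<in> nash_S U \<and> loc_rel U p q}"

definition loc_alg :: "(real^'n) set \<Rightarrow> (('n fn \<times> 'n fn) set) ralg" where
  "loc_alg U = \<lparr>carr = {loc_cls U (a, s) | a s. a \<in> carr (E_alg U) \<and> s \<in> nash_S U},
     add = (\<lambda>X Y. \<Union>{loc_cls U (\<lambda>x. a x * t x + b x * s x, \<lambda>x. s x * t x) | a s b t.
                       (a, s) \<in> X \<and> (b, t) \<in> Y}),
     mul = (\<lambda>X Y. \<Union>{loc_cls U (\<lambda>x. a x * b x, \<lambda>x. s x * t x) | a s b t.
                       (a, s) \<in> X \<and> (b, t) \<in> Y}),
     scl = (\<lambda>c X. \<Union>{loc_cls U (\<lambda>x. c * a x, s) | a s. (a, s) \<in> X}),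
     zer = loc_cls U (\<lambda>x. 0, one (E_alg U)),
     one = loc_cls U (one (E_alg U), one (E_alg U))\<rparr>"

definition loc_emb :: "(real^'n) set \<Rightarrow> 'n fn \<Rightarrow> ('n fn \<times> 'n fn) set" where
  "loc_emb U f = loc_cls U (f, one (E_alg U))"

end

theory Submission
  imports Defs "HOL-Computational_Algebra.Polynomial" "HOL-Complex_Analysis.Cauchy_Integral_Formula"
begin

text \<open>
  If \<open>f\<close> is Nash, choose a polynomial \<open>p\<close> in one variable over the polynomial functions with \<open>p(f) = 0\<close> and
  \<open>g = p'(f)\<close> not identically zero. Differentiating \<open>p(f)\<close> by the Leibniz rule in the module of differentials
  gives \<open>0 = d(p(f)) = g (df - \<Sum> (\<partial>f / \<partial>x\<^sub>i) dx\<^sub>i)\<close>, because the difference of \<open>dh\<close> and \<open>\<Sum> (\<partial>h / \<partial>x\<^sub>i) dx\<^sub>i\<close> is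
  itself a derivation that vanishes on polynomials. In the localized algebra \<open>g\<close> can be cancelled.

  Conversely, evaluation at a generic point of \<open>U\<close> is a ring homomorphism from the smooth functions to an
  ultrapower of the reals which does not kill any nonzero analytic function; it extends to the localization.
  Under it, \<open>f\<close> is Nash iff its value is algebraic over the values of the polynomial functions, and in
  characteristic zero that holds iff every derivation of the ultrapower that kills the values of the
  polynomial functions also kills the value of \<open>f\<close>. Such a derivation induces a linear functional on the
  module of differentials that sends \<open>dx\<^sub>i\<close> to \<open>0\<close>, so any relation \<open>g df = \<Sum> f\<^sub>i dx\<^sub>i\<close> with \<open>g \<noteq> 0\<close> forces it to
  kill the value of \<open>f\<close>.
\<close>


section \<open>Derivations and algebraicity in fields of characteristic zero\<close>

text \<open>The smooth functions on \<open>U\<close> have zero divisors, so no derivation that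
  detects a non-Nash \<open>f\<close> can be set up on a fraction field of \<open>E_alg U\<close>; a
  field receiving all smooth functions has to be found elsewhere. Evaluation at one point of
  \<open>U\<close> always kills some nonzero analytic function, but finitely many nonzero analytic
  functions have a common point of nonvanishing because \<open>U\<close> is connected. The
  ultrapower turns these points, one for each finite set of functions, into a single generic one.
  The functional on differentials needs the derivation at the image of every smooth function, so a
  derivation given on the values of polynomials and of \<open>f\<close> must be extended to the
  whole ultrapower; characteristic zero makes this possible. The description of algebraic elements
  by derivations has a second use: it gives closure of Nash functions under sums and products,
  through which \<open>g\<close> is seen to be Nash.\<close>

definition subring_set :: "'k::comm_ring_1 set \<Rightarrow> bool" where
  "subring_set L \<longleftrightarrow> 1 \<in> L \<and> (\<forall>a\<in>L. \<forall>b\<in>L. a - b \<in> L \<and> a * b \<in> L)"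

definition algebraic_over :: "'k::comm_ring_1 set \<Rightarrow> 'k \<Rightarrow> bool" where
  "algebraic_over L a \<longleftrightarrow> (\<exists>p. p \<noteq> 0 \<and> (\<forall>n. coeff p n \<in> L) \<and> poly p a = 0)"

definition derivation_over :: "'k::comm_ring_1 set \<Rightarrow> ('k \<Rightarrow> 'k) \<Rightarrow> bool" where
  "derivation_over L D \<longleftrightarrow> (\<forall>x y. D (x + y) = D x + D y) \<and> (\<forall>x y. D (x * y) = x * D y + D x * y)
     \<and> (\<forall>l\<in>L. D l = 0)"

lemma derivation_over_add: "derivation_over L D \<Longrightarrow> D (x + y) = D x + D y"
  and derivation_over_mult: "derivation_over L D \<Longrightarrow> D (x * y) = x * D y + D x * y"
  and derivation_over_zero: "derivation_over L D \<Longrightarrow> l \<in> L \<Longrightarrow> D l = 0"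
  by (simp_all add: derivation_over_def)

text \<open>A pair \<open>(a, a')\<close> stands for the dual number \<open>a + a' \<epsilon>\<close> with \<open>\<epsilon>\<^sup>2 = 0\<close>: the graph of a derivation
  on a subring is a subring of the dual numbers that meets the line \<open>0 + K \<epsilon>\<close> only in \<open>0\<close>.\<close>

definition deriv_graph :: "('k::comm_ring_1 \<times> 'k) set \<Rightarrow> bool" where
  "deriv_graph G \<longleftrightarrow> (1, 0) \<in> G
     \<and> (\<forall>a a' b b'. (a, a') \<in> G \<longrightarrow> (b, b') \<in> G \<longrightarrow> (a - b, a' - b') \<in> G \<and> (a * b, a * b' + a' * b) \<in> G)
     \<and> (\<forall>d. (0, d) \<in> G \<longrightarrow> d = 0)"

definition poly_graph :: "('k::comm_ring_1 \<times> 'k) set \<Rightarrow> ('k poly \<times> 'k poly) set" where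
  "poly_graph G = {(p, q). \<forall>n. (coeff p n, coeff q n) \<in> G}"

text \<open>With \<open>p + q \<epsilon>\<close> read as a polynomial over the dual numbers, each
  pair is its value at \<open>a + e \<epsilon>\<close>, because
  \<open>p(a + e \<epsilon>) = p(a) + p'(a) e \<epsilon>\<close>. The set is thus the subring
  generated by \<open>G\<close> and the new point \<open>(a, e)\<close>.\<close>

definition adjoin_graph :: "('k::idom \<times> 'k) set \<Rightarrow> 'k \<Rightarrow> 'k \<Rightarrow> ('k \<times> 'k) set" where
  "adjoin_graph G a e = {(poly p a, poly q a + poly (pderiv p) a * e) | p q. (p, q) \<in> poly_graph G}"

context
  fixes G :: "('k::idom \<times> 'k) set"
  assumes G: "deriv_graph G"
begin

lemma deriv_graph_diff: "(a, a') \<in> G \<Longrightarrow> (b, b') \<in> G \<Longrightarrow> (a - b, a' - b') \<in> G"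
  and deriv_graph_mult: "(a, a') \<in> G \<Longrightarrow> (b, b') \<in> G \<Longrightarrow> (a * b, a * b' + a' * b) \<in> G"
  and deriv_graph_one: "(1, 0) \<in> G"
  and deriv_graph_0D: "(0, d) \<in> G \<Longrightarrow> d = 0"
  using G unfolding deriv_graph_def by blast+

lemma deriv_graph_zero: "(0, 0) \<in> G"
  using deriv_graph_diff[OF deriv_graph_one deriv_graph_one] by simp

lemma deriv_graph_add: "(a, a') \<in> G \<Longrightarrow> (b, b') \<in> G \<Longrightarrow> (a + b, a' + b') \<in> G"
  using deriv_graph_diff[of a a' "- b" "- b'"] deriv_graph_diff[OF deriv_graph_zero, of b b'] by simp

lemma deriv_graph_sum:
  "finite I \<Longrightarrow> (\<And>i. i \<in> I \<Longrightarrow> (f i, g i) \<in> G) \<Longrightarrow> (sum f I, sum g I) \<in> G"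
  by (induction I rule: finite_induct) (auto simp: deriv_graph_zero deriv_graph_add)

lemma deriv_graph_of_nat: "(a, a') \<in> G \<Longrightarrow> (of_nat m * a, of_nat m * a') \<in> G"
  by (induction m) (auto simp: deriv_graph_zero deriv_graph_add distrib_right)

lemma poly_graph_diff:
  "(p, p') \<in> poly_graph G \<Longrightarrow> (q, q') \<in> poly_graph G \<Longrightarrow> (p - q, p' - q') \<in> poly_graph G"
  unfolding poly_graph_def by (auto simp: deriv_graph_diff)

lemma poly_graph_mult:
  assumes "(p, p') \<in> poly_graph G" "(q, q') \<in> poly_graph G"
  shows "(p * q, p * q' + p' * q) \<in> poly_graph G"
proof -
  have "(\<Sum>i\<le>n. coeff p i * coeff q (n - i),
      \<Sum>i\<le>n. coeff p i * coeff q' (n - i) + coeff p' i * coeff q (n - i)) \<in> G" for n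
    using assms by (intro deriv_graph_sum) (auto simp: poly_graph_def intro!: deriv_graph_mult)
  then show ?thesis
    by (auto simp: poly_graph_def coeff_mult sum.distrib)
qed

lemma poly_graph_const: "(c, c') \<in> G \<Longrightarrow> ([:c:], [:c':]) \<in> poly_graph G"
  by (auto simp: poly_graph_def coeff_pCons deriv_graph_zero split: nat.splits)

lemma poly_graph_monom: "(c, c') \<in> G \<Longrightarrow> (monom c k, monom c' k) \<in> poly_graph G"
  by (auto simp: poly_graph_def deriv_graph_zero)

lemma poly_graph_pderiv: "(p, q) \<in> poly_graph G \<Longrightarrow> (pderiv p, pderiv q) \<in> poly_graph G"
  by (auto simp: poly_graph_def coeff_pderiv simp del: of_nat_Suc intro!: deriv_graph_of_nat)

lemma poly_graph_zeroD: "(0, q) \<in> poly_graph G \<Longrightarrow> q = 0"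
  by (auto simp: poly_graph_def poly_eq_iff deriv_graph_0D)

text \<open>The values of a ring of polynomials at a fixed dual number form a ring in any case; what
  has to be assured is single-valuedness, and that is \<open>wd\<close>.\<close>

lemma adjoin_graph_deriv_graph:
  assumes wd: "\<And>p q. (p, q) \<in> poly_graph G \<Longrightarrow> poly p a = 0 \<Longrightarrow> poly q a + poly (pderiv p) a * e = 0"
  shows "deriv_graph (adjoin_graph G a e)"
  unfolding deriv_graph_def
proof (intro conjI allI impI)
  have "([:1:], [:0:]) \<in> poly_graph G"
    by (intro poly_graph_const deriv_graph_one)
  then show "(1, 0) \<in> adjoin_graph G a e"
    unfolding adjoin_graph_def by (intro CollectI exI[of _ "[:1:]"] exI[of _ "[:0:]"]) auto
next
  fix b b' c c' assume "(b, b') \<in> adjoin_graph G a e" "(c, c') \<in> adjoin_graph G a e"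
  then obtain p q r s where pq: "(p, q) \<in> poly_graph G" "(r, s) \<in> poly_graph G"
    and b: "b = poly p a" "b' = poly q a + poly (pderiv p) a * e"
    and c: "c = poly r a" "c' = poly s a + poly (pderiv r) a * e"
    unfolding adjoin_graph_def by blast
  show "(b - c, b' - c') \<in> adjoin_graph G a e"
    unfolding adjoin_graph_def using poly_graph_diff[OF pq]
    by (intro CollectI exI[of _ "p - r"] exI[of _ "q - s"]) (auto simp: b c pderiv_diff algebra_simps)
  show "(b * c, b * c' + b' * c) \<in> adjoin_graph G a e"
    unfolding adjoin_graph_def using poly_graph_mult[OF pq]
    by (intro CollectI exI[of _ "p * r"] exI[of _ "p * s + q * r"]) (auto simp: b c pderiv_mult algebra_simps)
next
  fix d assume "(0, d) \<in> adjoin_graph G a e"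
  then show "d = 0" unfolding adjoin_graph_def using wd by fastforce
qed

lemma adjoin_graph_superset: "G \<subseteq> adjoin_graph G a e"
proof
  fix x assume "x \<in> G"
  moreover obtain c c' where x: "x = (c, c')" by force
  ultimately show "x \<in> adjoin_graph G a e"
    unfolding adjoin_graph_def using poly_graph_const[of c c']
    by (intro CollectI exI[of _ "[:c:]"] exI[of _ "[:c':]"]) (auto simp: pderiv_pCons)
qed

lemma adjoin_graph_new: "(a, e) \<in> adjoin_graph G a e"
proof -
  have "([:0, 1:], 0) \<in> poly_graph G"
    by (auto simp: poly_graph_def coeff_pCons deriv_graph_zero deriv_graph_one split: nat.splits)
  then show ?thesis
    unfolding adjoin_graph_def
    by (intro CollectI exI[of _ "[:0, 1:]"] exI[of _ 0]) (auto simp: pderiv_pCons)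
qed

end

text \<open>Each polynomial annihilating \<open>a\<close> imposes one linear equation on the value
  \<open>e\<close> at \<open>a\<close>. One of least degree settles them all: its derivative at
  \<open>a\<close> is nonzero in characteristic zero, so it determines \<open>e\<close>, and
  pseudo-division by it carries the equation to every other annihilating polynomial.\<close>

lemma deriv_graph_extend:
  fixes G :: "('k::field_char_0 \<times> 'k) set"
  assumes G: "deriv_graph G"
  shows "\<exists>e. \<forall>p q. (p, q) \<in> poly_graph G \<longrightarrow> poly p a = 0 \<longrightarrow> poly q a + poly (pderiv p) a * e = 0"
proof (cases "\<exists>p q. (p, q) \<in> poly_graph G \<and> p \<noteq> 0 \<and> poly p a = 0")
  case False
  \<comment> \<open>Here \<open>poly p a = 0\<close> forces \<open>p = 0\<close> and then
    \<open>q = 0\<close>, so every \<open>e\<close> will do.\<close>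
  then show ?thesis using poly_graph_zeroD[OF G] by fastforce
next
  case True
  then obtain u where "u \<in> poly_graph G \<and> fst u \<noteq> 0 \<and> poly (fst u) a = 0" by (metis fst_conv)
  from ex_has_least_nat[of "\<lambda>u. u \<in> poly_graph G \<and> fst u \<noteq> 0 \<and> poly (fst u) a = 0",
      OF this, of "\<lambda>u. degree (fst u)"]
  obtain p0 q0 where p0: "(p0, q0) \<in> poly_graph G" "p0 \<noteq> 0" "poly p0 a = 0"
    and min: "\<And>p q. (p, q) \<in> poly_graph G \<Longrightarrow> p \<noteq> 0 \<Longrightarrow> poly p a = 0 \<Longrightarrow> degree p0 \<le> degree p"
    by fastforce
  have deg: "degree p0 > 0"
  proof (rule ccontr)
    assume "\<not> 0 < degree p0"
    then obtain c where "p0 = [:c:]" by (metis degree_eq_zeroE neq0_conv)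
    then show False using p0 by simp
  qed
  have nz: "poly (pderiv p0) a \<noteq> 0"
  proof
    assume "poly (pderiv p0) a = 0"
    moreover have "pderiv p0 \<noteq> 0" using deg by (simp add: pderiv_eq_0_iff)
    ultimately have "degree p0 \<le> degree (pderiv p0)"
      using min poly_graph_pderiv[OF G p0(1)] by blast
    then show False using deg by (simp add: degree_pderiv)
  qed
  define e where "e = - poly q0 a / poly (pderiv p0) a"
  have e: "poly q0 a + poly (pderiv p0) a * e = 0" using nz by (simp add: e_def)
  have "\<forall>q. (p, q) \<in> poly_graph G \<longrightarrow> poly p a = 0 \<longrightarrow> poly q a + poly (pderiv p) a * e = 0" for p
  proof (induction "length (coeffs p)" arbitrary: p rule: less_induct)
    case less
    show ?case
    proof (cases "p = 0")
      case True
      then show ?thesis using poly_graph_zeroD[OF G] by fastforce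
    next
      case False
      show ?thesis
      proof (intro allI impI)
        fix q assume pq: "(p, q) \<in> poly_graph G" and pa: "poly p a = 0"
        have dle: "degree p0 \<le> degree p" using min pq pa False by blast
        define k where "k = degree p - degree p0"
        define c where "c = lead_coeff p0"
        define c' where "c' = coeff q0 (degree p0)"
        define l where "l = lead_coeff p"
        define l' where "l' = coeff q (degree p)"
        have cG: "(c, c') \<in> G" and lG: "(l, l') \<in> G"
          using p0(1) pq by (auto simp: poly_graph_def c_def c'_def l_def l'_def)
        \<comment> \<open>One step of pseudo-division over the dual numbers:
          \<open>p + q \<epsilon>\<close> is multiplied by the top coefficient
          \<open>c + c' \<epsilon>\<close> of \<open>p0 + q0 \<epsilon>\<close>, and a monomial
          multiple of \<open>p0 + q0 \<epsilon>\<close> is subtracted. Multiplying by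
          \<open>c\<close> in place of dividing keeps the coefficients in \<open>G\<close>, which is
          only a ring.\<close>
        define p1 where "p1 = [:c:] * p - monom l k * p0"
        define q1 where "q1 = ([:c:] * q + [:c':] * p) - (monom l k * q0 + monom l' k * p0)"
        have g1: "(p1, q1) \<in> poly_graph G"
          unfolding p1_def q1_def
          by (intro poly_graph_diff[OF G] poly_graph_mult[OF G] poly_graph_const[OF G]
              poly_graph_monom[OF G] cG lG pq p0(1))
        have p1a: "poly p1 a = 0" by (simp add: p1_def pa p0)
        have dm: "degree (monom l k * p0) \<le> degree p"
          using degree_mult_le[of "monom l k" p0] degree_monom_le[of l k] dle by (simp add: k_def)
        have "coeff p1 (degree p) = 0"
          using dle by (simp add: p1_def coeff_monom_mult k_def c_def l_def)
        moreover have "degree p1 \<le> degree p"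
          unfolding p1_def using dm degree_smult_le[of c p] by (intro degree_diff_le) auto
        ultimately have "p1 = 0 \<or> degree p1 < degree p"
          by (metis False degree_0 le_neq_implies_less leading_coeff_0_iff)
        then have "length (coeffs p1) < length (coeffs p)"
          using False by (cases "p1 = 0") (auto simp: length_coeffs_degree)
        from less[OF this] g1 p1a have "poly q1 a + poly (pderiv p1) a * e = 0" by blast
        \<comment> \<open>The terms with \<open>c'\<close> or \<open>l'\<close>, and the one from
          differentiating the monomial, carry a factor \<open>poly p a\<close> or
          \<open>poly p0 a\<close> and vanish.\<close>
        moreover have "poly q1 a + poly (pderiv p1) a * e
            = c * (poly q a + poly (pderiv p) a * e) - l * a ^ k * (poly q0 a + poly (pderiv p0) a * e)"
          by (simp add: q1_def p1_def pa p0 pderiv_diff pderiv_mult pderiv_smult poly_monom algebra_simps)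
        ultimately show "poly q a + poly (pderiv p) a * e = 0"
          using e p0(2) by (simp add: c_def)
      qed
    qed
  qed
  then show ?thesis by blast
qed

text \<open>A graph that is maximal among those containing \<open>G\<close> is defined everywhere,
  since otherwise one more element could be adjoined. It is single-valued because
  \<open>(0, d)\<close> belongs to it only for \<open>d = 0\<close>.\<close>

lemma derivation_graph_total:
  fixes G :: "('k::field_char_0 \<times> 'k) set"
  assumes G: "deriv_graph G"
  obtains D where "\<And>x y. D (x + y) = D x + D y" "\<And>x y. D (x * y) = x * D y + D x * y"
    "\<And>a e. (a, e) \<in> G \<Longrightarrow> D a = e"
proof -
  define A where "A = {H. deriv_graph H \<and> G \<subseteq> H}"
  have "\<exists>M\<in>A. \<forall>X\<in>A. M \<subseteq> X \<longrightarrow> X = M"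
  proof (rule subset_Zorn_nonempty)
    show "A \<noteq> {}" using G by (auto simp: A_def)
    fix C assume ne: "C \<noteq> {}" and ch: "subset.chain A C"
    have C: "H \<in> C \<Longrightarrow> deriv_graph H \<and> G \<subseteq> H" for H
      using ch by (auto simp: subset_chain_def A_def)
    have "deriv_graph (\<Union>C)"
      unfolding deriv_graph_def
    proof (intro conjI allI impI)
      show "(1, 0) \<in> \<Union>C" using ne C deriv_graph_one by blast
    next
      fix a a' b b' assume "(a, a') \<in> \<Union>C" "(b, b') \<in> \<Union>C"
      then obtain H where H: "H \<in> C" "(a, a') \<in> H" "(b, b') \<in> H"
        using ch unfolding subset_chain_def by blast
      then show "(a - b, a' - b') \<in> \<Union>C" "(a * b, a * b' + a' * b) \<in> \<Union>C"
        using C deriv_graph_diff deriv_graph_mult by blast+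
    next
      fix d assume "(0, d) \<in> \<Union>C"
      then show "d = 0" using C deriv_graph_0D by blast
    qed
    then show "\<Union>C \<in> A" using ne C by (auto simp: A_def)
  qed
  then obtain M where M: "deriv_graph M" "G \<subseteq> M" "\<And>X. deriv_graph X \<Longrightarrow> M \<subseteq> X \<Longrightarrow> X = M"
    by (auto simp: A_def)
  have ex: "\<exists>e. (a, e) \<in> M" for a
  proof -
    obtain e where e: "\<And>p q. (p, q) \<in> poly_graph M \<Longrightarrow> poly p a = 0 \<Longrightarrow> poly q a + poly (pderiv p) a * e = 0"
      using deriv_graph_extend[OF M(1)] by blast
    then have "adjoin_graph M a e = M"
      using M adjoin_graph_deriv_graph adjoin_graph_superset by blast
    then show ?thesis using adjoin_graph_new[OF M(1)] by blast
  qed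
  define D where "D a = (SOME e. (a, e) \<in> M)" for a
  have DM: "(a, D a) \<in> M" for a unfolding D_def using ex by (rule someI_ex)
  have un: "D a = e" if "(a, e) \<in> M" for a e
  proof -
    have "(0, D a - e) \<in> M" using deriv_graph_diff[OF M(1) DM[of a] that] by simp
    then show ?thesis using deriv_graph_0D[OF M(1)] by fastforce
  qed
  show ?thesis
  proof
    show "D (x + y) = D x + D y" for x y by (intro un deriv_graph_add M DM)
    show "D (x * y) = x * D y + D x * y" for x y by (intro un deriv_graph_mult M DM)
    show "D a = e" if "(a, e) \<in> G" for a e using that M un by blast
  qed
qed

text \<open>The zero derivation on \<open>L\<close> extends with any prescribed value at
  \<open>\<phi>\<close>, because no nonzero polynomial over \<open>L\<close> constrains that value;
  here it is \<open>1\<close>.\<close>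

lemma derivation_at_transcendental:
  fixes \<phi> :: "'k::field_char_0"
  assumes L: "subring_set L" and tr: "\<not> algebraic_over L \<phi>"
  obtains D where "derivation_over L D" "D \<phi> = 1"
proof -
  define G where "G = L \<times> {0::'k}"
  have G: "deriv_graph G"
    using L unfolding deriv_graph_def G_def subring_set_def by auto
  have "deriv_graph (adjoin_graph G \<phi> 1)"
  proof (rule adjoin_graph_deriv_graph[OF G])
    fix p q assume pq: "(p, q) \<in> poly_graph G" and "poly p \<phi> = 0"
    then have "p = 0" using tr by (auto simp: algebraic_over_def poly_graph_def G_def)
    moreover have "q = 0" using pq by (auto simp: poly_graph_def G_def poly_eq_iff)
    ultimately show "poly q \<phi> + poly (pderiv p) \<phi> * 1 = 0" by simp
  qed
  from derivation_graph_total[OF this] obtain D where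
    D: "\<And>x y. D (x + y) = D x + D y" "\<And>x y. D (x * y) = x * D y + D x * y"
    "\<And>a e. (a, e) \<in> adjoin_graph G \<phi> 1 \<Longrightarrow> D a = e" by blast
  have "D \<phi> = 1" using D(3) adjoin_graph_new[OF G] by blast
  moreover have "D l = 0" if "l \<in> L" for l
  proof -
    have "(l, 0) \<in> G" using that by (simp add: G_def)
    then show ?thesis using D(3) adjoin_graph_superset[OF G] by blast
  qed
  ultimately show ?thesis
    using that[of D] D(1,2) unfolding derivation_over_def by blast
qed

section \<open>Algebraic elements and the derivations that vanish at them\<close>

lemma derivation_poly:
  assumes D: "derivation_over L D" and p: "\<forall>n. coeff p n \<in> L"
  shows "D (poly p a) = poly (pderiv p) a * D a"
  using p
proof (induction p)
  case 0
  have "D (0 + 0) = D 0 + D 0" using D unfolding derivation_over_def by blast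
  then show ?case by simp
next
  case (pCons c p)
  have "c \<in> L" "\<forall>n. coeff p n \<in> L"
    using pCons.prems[rule_format, of 0] pCons.prems[rule_format, of "Suc _"] by simp_all
  then show ?case
    using D pCons.IH by (simp add: derivation_over_def pderiv_pCons algebra_simps)
qed

text \<open>A nonzero annihilating polynomial of least degree works: in characteristic zero its
  derivative is nonzero and of smaller degree, so it cannot annihilate \<open>a\<close>.
  Differentiation multiplies coefficients by natural numbers, which keeps them in
  \<open>L\<close>.\<close>

lemma algebraic_over_separable:
  fixes a :: "'k::field_char_0"
  assumes L: "subring_set L" and alg: "algebraic_over L a"
  obtains p where "\<forall>n. coeff p n \<in> L" "poly p a = 0" "poly (pderiv p) a \<noteq> 0"
proof -
  obtain p1 where "p1 \<noteq> 0 \<and> (\<forall>n. coeff p1 n \<in> L) \<and> poly p1 a = 0"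
    using alg unfolding algebraic_over_def by blast
  from ex_has_least_nat[of "\<lambda>p. p \<noteq> 0 \<and> (\<forall>n. coeff p n \<in> L) \<and> poly p a = 0", OF this, of degree]
  obtain p where p: "p \<noteq> 0" "\<forall>n. coeff p n \<in> L" "poly p a = 0"
    and min: "\<And>q. q \<noteq> 0 \<Longrightarrow> \<forall>n. coeff q n \<in> L \<Longrightarrow> poly q a = 0 \<Longrightarrow> degree p \<le> degree q"
    by blast
  have deg: "degree p > 0"
  proof (rule ccontr)
    assume "\<not> 0 < degree p"
    then obtain c where "p = [:c:]" by (metis degree_eq_zeroE neq0_conv)
    then show False using p by simp
  qed
  have zero: "0 \<in> L" and diff: "\<And>a b. a \<in> L \<Longrightarrow> b \<in> L \<Longrightarrow> a - b \<in> L"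
    using L unfolding subring_set_def by (metis diff_self) (use L in \<open>simp add: subring_set_def\<close>)
  have add: "x + y \<in> L" if "x \<in> L" "y \<in> L" for x y
    using diff[OF that(1) diff[OF zero that(2)]] by simp
  have nat: "of_nat m * x \<in> L" if "x \<in> L" for m and x :: 'k
    using that by (induction m) (auto simp: zero add distrib_right)
  have "\<forall>n. coeff (pderiv p) n \<in> L"
    using p(2) nat by (simp add: coeff_pderiv del: of_nat_Suc)
  moreover have "pderiv p \<noteq> 0" using deg by (simp add: pderiv_eq_0_iff)
  moreover have "degree (pderiv p) < degree p" using deg by (simp add: degree_pderiv)
  ultimately have nz: "poly (pderiv p) a \<noteq> 0" using min[of "pderiv p"] by (meson leD)
  show ?thesis by (rule that[OF p(2,3) nz])
qed

lemma algebraic_over_iff_derivation: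
  fixes a :: "'k::field_char_0"
  assumes L: "subring_set L"
  shows "algebraic_over L a \<longleftrightarrow> (\<forall>D. derivation_over L D \<longrightarrow> D a = 0)"
proof (intro iffI allI impI)
  fix D assume alg: "algebraic_over L a" and D: "derivation_over L D"
  obtain p where p: "\<forall>n. coeff p n \<in> L" "poly p a = 0" and nz: "poly (pderiv p) a \<noteq> 0"
    using algebraic_over_separable[OF L alg] by blast
  have "1 - 1 \<in> L" using L unfolding subring_set_def by blast
  then have "D 0 = 0" using D by (simp add: derivation_over_def)
  then have "poly (pderiv p) a * D a = 0"
    using derivation_poly[OF D p(1), of a] p(2) by simp
  then show "D a = 0" using nz by simp
next
  assume "\<forall>D. derivation_over L D \<longrightarrow> D a = 0"
  show "algebraic_over L a"
  proof (rule ccontr)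
    assume "\<not> algebraic_over L a"
    then obtain D where "derivation_over L D" "D a = 1"
      by (rule derivation_at_transcendental[OF L])
    then show False using \<open>\<forall>D. derivation_over L D \<longrightarrow> D a = 0\<close> by fastforce
  qed
qed

section \<open>An ultrapower of the real numbers\<close>

text \<open>Finer filters are smaller in the order on filters, so Zorn's lemma is applied to the
  reversed order; it yields a minimal proper filter below \<open>F\<close>.\<close>

lemma ex_ultrafilter:
  assumes "F \<noteq> bot"
  shows "\<exists>G\<le>F. G \<noteq> bot \<and> (\<forall>P. eventually P G \<or> eventually (\<lambda>x. \<not> P x) G)"
proof -
  define A where "A = {G. G \<noteq> bot \<and> G \<le> F}"
  have "\<exists>M\<in>A. \<forall>G\<in>A. G \<le> M \<longrightarrow> G = M"
  proof (rule predicate_Zorn)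
    show "partial_order_on A (relation_of (\<lambda>x y. y \<le> x) A)"
      by (rule partial_order_on_relation_ofI) auto
    fix C assume C: "C \<in> Chains (relation_of (\<lambda>x y. y \<le> x) A)"
    then have CA: "C \<subseteq> A" and tot: "\<And>x y. x \<in> C \<Longrightarrow> y \<in> C \<Longrightarrow> x \<le> y \<or> y \<le> x"
      by (auto simp: Chains_def relation_of_def)
    show "\<exists>u\<in>A. \<forall>a\<in>C. u \<le> a"
    proof (cases "C = {}")
      case True
      then show ?thesis using assms by (auto simp: A_def)
    next
      case False
      \<comment> \<open>What holds eventually for the infimum of a chain holds eventually for some
        member, so proper filters in a chain have a proper infimum.\<close>
      have "Inf C \<noteq> bot"
      proof
        assume "Inf C = bot"
        then have "eventually (\<lambda>_. False) (Inf C)" by simp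
        moreover have "\<exists>x\<in>C. x \<le> inf G H" if "G \<in> C" "H \<in> C" for G H
          using tot[OF that] that by (auto simp: inf_absorb1 inf_absorb2)
        ultimately obtain G where "G \<in> C" "eventually (\<lambda>_. False) G"
          using eventually_Inf_base[OF False] by blast
        then show False using CA by (auto simp: A_def trivial_limit_def)
      qed
      moreover have "Inf C \<le> F"
        using False CA by (auto simp: A_def intro: Inf_lower2)
      ultimately show ?thesis by (auto simp: A_def intro: Inf_lower)
    qed
  qed
  then obtain M where M: "M \<noteq> bot" "M \<le> F" and max: "\<And>G. G \<noteq> bot \<Longrightarrow> G \<le> M \<Longrightarrow> G = M"
    by (force simp: A_def)
  have "eventually P M \<or> eventually (\<lambda>x. \<not> P x) M" for P
  \<comment> \<open>Either forcing \<open>P\<close> makes the filter improper, and then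
    \<open>P\<close> eventually fails, or the refined filter is \<open>M\<close> itself by
    minimality.\<close>
  proof (cases "inf M (principal {x. P x}) = bot")
    case True
    then have "eventually (\<lambda>x. \<not> P x) M"
      by (simp add: trivial_limit_def eventually_inf_principal)
    then show ?thesis ..
  next
    case False
    then have "inf M (principal {x. P x}) = M" using max by simp
    moreover have "eventually P (inf M (principal {x. P x}))"
      by (simp add: eventually_inf_principal)
    ultimately show ?thesis by simp
  qed
  then show ?thesis using M by blast
qed

text \<open>The indices are sets, and the ultrafilter refines the filter of finite sets under
  inclusion. For each fixed \<open>h\<close> the conditions \<open>finite T\<close> and
  \<open>h \<in> T\<close> therefore hold eventually.\<close>

definition ultra :: "'a set filter" where
  "ultra = (SOME G. G \<le> finite_subsets_at_top UNIV \<and> G \<noteq> bot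
     \<and> (\<forall>P. eventually P G \<or> eventually (\<lambda>x. \<not> P x) G))"

lemma ultra_le: "ultra \<le> finite_subsets_at_top UNIV"
  and ultra_proper: "ultra \<noteq> bot"
  and ultra_dichotomy: "eventually P ultra \<or> eventually (\<lambda>x. \<not> P x) ultra"
proof -
  have "\<exists>G. G \<le> finite_subsets_at_top UNIV \<and> G \<noteq> bot
     \<and> (\<forall>P. eventually P G \<or> eventually (\<lambda>x. \<not> P x) G)"
    using ex_ultrafilter[OF finite_subsets_at_top_neq_bot] by blast
  from someI_ex[OF this] show "ultra \<le> finite_subsets_at_top UNIV" "ultra \<noteq> bot"
    "eventually P ultra \<or> eventually (\<lambda>x. \<not> P x) ultra"
    unfolding ultra_def by blast+
qed

quotient_type 'a ultrapower = "'a set \<Rightarrow> real" / "\<lambda>f g. eventually (\<lambda>T. f T = g T) ultra"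
proof (rule equivpI)
  show "reflp (\<lambda>f g. eventually (\<lambda>T. f T = (g T :: real)) (ultra :: 'a set filter))"
    by (simp add: reflp_def)
  show "symp (\<lambda>f g. eventually (\<lambda>T. f T = (g T :: real)) (ultra :: 'a set filter))"
    by (simp add: symp_def eq_commute)
  show "transp (\<lambda>f g. eventually (\<lambda>T. f T = (g T :: real)) (ultra :: 'a set filter))"
    by (rule transpI) (erule (1) eventually_elim2, simp)
qed

instantiation ultrapower :: (type) comm_ring_1
begin

lift_definition zero_ultrapower :: "'a ultrapower" is "\<lambda>_. 0" .
lift_definition one_ultrapower :: "'a ultrapower" is "\<lambda>_. 1" .
lift_definition plus_ultrapower :: "'a ultrapower \<Rightarrow> 'a ultrapower \<Rightarrow> 'a ultrapower" is "\<lambda>f g T. f T + g T"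
  by (erule (1) eventually_elim2) simp
lift_definition minus_ultrapower :: "'a ultrapower \<Rightarrow> 'a ultrapower \<Rightarrow> 'a ultrapower" is "\<lambda>f g T. f T - g T"
  by (erule (1) eventually_elim2) simp
lift_definition times_ultrapower :: "'a ultrapower \<Rightarrow> 'a ultrapower \<Rightarrow> 'a ultrapower" is "\<lambda>f g T. f T * g T"
  by (erule (1) eventually_elim2) simp
lift_definition uminus_ultrapower :: "'a ultrapower \<Rightarrow> 'a ultrapower" is "\<lambda>f T. - f T"
  by (erule eventually_mono) simp

instance
proof
  fix a b c :: "'a ultrapower"
  show "a * b * c = a * (b * c)" by transfer (simp add: algebra_simps)
  show "a * b = b * a" by transfer (simp add: algebra_simps)
  show "1 * a = a" by transfer simp
  show "a + b + c = a + (b + c)" by transfer (simp add: algebra_simps)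
  show "a + b = b + a" by transfer (simp add: algebra_simps)
  show "0 + a = a" by transfer simp
  show "- a + a = 0" by transfer simp
  show "a - b = a + - b" by transfer simp
  show "(a + b) * c = a * c + b * c" by transfer (simp add: algebra_simps)
  show "(0::'a ultrapower) \<noteq> 1" by transfer (simp add: ultra_proper trivial_limit_def[symmetric])
qed

end

instantiation ultrapower :: (type) field
begin

lift_definition divide_ultrapower :: "'a ultrapower \<Rightarrow> 'a ultrapower \<Rightarrow> 'a ultrapower" is "\<lambda>f g T. f T / g T"
  by (erule (1) eventually_elim2) simp
lift_definition inverse_ultrapower :: "'a ultrapower \<Rightarrow> 'a ultrapower" is "\<lambda>f T. inverse (f T)"
  by (erule eventually_mono) simp

instance
proof
  fix a b :: "'a ultrapower"
  show "a div b = a * inverse b" by transfer (simp add: divide_inverse)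
  show "inverse (0::'a ultrapower) = 0" by transfer simp
  show "a \<noteq> 0 \<Longrightarrow> inverse a * a = 1"
  proof transfer
    fix a :: "'a set \<Rightarrow> real" assume "\<not> eventually (\<lambda>T. a T = 0) ultra"
    \<comment> \<open>The dichotomy turns "not eventually zero" into "eventually nonzero", and there
      the pointwise inverse is a true inverse.\<close>
    then have "eventually (\<lambda>T. a T \<noteq> 0) ultra" using ultra_dichotomy by blast
    then show "eventually (\<lambda>T. inverse (a T) * a T = 1) ultra" by (rule eventually_mono) simp
  qed
qed

end

instance ultrapower :: (type) field_char_0
proof
  have *: "(of_nat n :: 'a ultrapower) = abs_ultrapower (\<lambda>_. of_nat n)" for n
    by (induction n) (auto simp: zero_ultrapower_def one_ultrapower_def plus_ultrapower.abs_eq add.commute)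
  show "inj (of_nat :: nat \<Rightarrow> 'a ultrapower)"
    by (auto simp: inj_on_def * ultrapower.abs_eq_iff eventually_const_iff ultra_proper)
qed

lift_definition of_fun :: "('a set \<Rightarrow> real) \<Rightarrow> 'a ultrapower" is "\<lambda>f. f" .

lemma of_fun_add: "of_fun f + of_fun g = of_fun (\<lambda>T. f T + g T)"
  and of_fun_diff: "of_fun f - of_fun g = of_fun (\<lambda>T. f T - g T)"
  and of_fun_mult: "of_fun f * of_fun g = of_fun (\<lambda>T. f T * g T)"
  and of_fun_zero: "of_fun (\<lambda>_. 0) = 0"
  and of_fun_one: "of_fun (\<lambda>_. 1) = 1"
  by (transfer; simp)+

lemma of_fun_neq_0: "(\<And>T. finite T \<Longrightarrow> h \<in> T \<Longrightarrow> f T \<noteq> 0) \<Longrightarrow> of_fun f \<noteq> 0"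
proof transfer
  fix f :: "'a set \<Rightarrow> real" and h assume "\<And>T. finite T \<Longrightarrow> h \<in> T \<Longrightarrow> f T \<noteq> 0"
  then have "eventually (\<lambda>T. f T \<noteq> 0) (finite_subsets_at_top UNIV)"
    by (auto simp: eventually_finite_subsets_at_top intro!: exI[of _ "{h}"])
  then have ev: "eventually (\<lambda>T. f T \<noteq> 0) ultra" using ultra_le filter_leD by blast
  show "\<not> eventually (\<lambda>T. f T = 0) ultra"
  proof
    assume "eventually (\<lambda>T. f T = 0) ultra"
    then have "eventually (\<lambda>_. False) (ultra :: 'a set filter)"
      by (rule eventually_elim2[OF _ ev]) simp
    then show False using ultra_proper trivial_limit_def by blast
  qed
qed

section \<open>Real analytic functions of several variables\<close>

definition mon :: "real^'n \<Rightarrow> ('n \<Rightarrow> nat) \<Rightarrow> real" where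
  "mon v \<alpha> = (\<Prod>i\<in>UNIV. (v $ i) ^ \<alpha> i)"

text \<open>The sum over multi-indices is unordered, so convergence is absolute. The radius is part
  of the predicate because sums, products and partial derivatives have expansions on the same
  ball.\<close>

definition expansion :: "(real^'n \<Rightarrow> real) \<Rightarrow> real^'n \<Rightarrow> real \<Rightarrow> (('n \<Rightarrow> nat) \<Rightarrow> real) \<Rightarrow> bool" where
  "expansion f a r c \<longleftrightarrow> (\<forall>x\<in>ball a r. ((\<lambda>\<alpha>. c \<alpha> * mon (x - a) \<alpha>) has_sum f x) UNIV)"

lemma real_analytic_on_iff:
  "real_analytic_on f U \<longleftrightarrow> (\<forall>a\<in>U. \<exists>r>0. ball a r \<subseteq> U \<and> (\<exists>c. expansion f a r c))"
  unfolding real_analytic_on_def expansion_def mon_def by simp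

lemma expansion_subset: "expansion f a r c \<Longrightarrow> s \<le> r \<Longrightarrow> expansion f a s c"
  unfolding expansion_def by auto

lemma real_analytic_on_binary:
  assumes "real_analytic_on f U" "real_analytic_on g U"
    and "\<And>a r c d. expansion f a r c \<Longrightarrow> expansion g a r d \<Longrightarrow> \<exists>e. expansion h a r e"
  shows "real_analytic_on h U"
  unfolding real_analytic_on_iff
proof
  fix a assume "a \<in> U"
  then obtain r c s d where r: "r > 0" "ball a r \<subseteq> U" "expansion f a r c"
    and s: "s > 0" "ball a s \<subseteq> U" "expansion g a s d"
    using assms(1,2) unfolding real_analytic_on_iff by meson
  have "expansion f a (min r s) c" "expansion g a (min r s) d"
    using r s by (auto intro: expansion_subset)
  then have "\<exists>e. expansion h a (min r s) e" by (rule assms(3))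
  then show "\<exists>r>0. ball a r \<subseteq> U \<and> (\<exists>c. expansion h a r c)"
    using r s by (intro exI[of _ "min r s"]) auto
qed

lemma real_analytic_on_cong:
  assumes "\<And>x. x \<in> U \<Longrightarrow> f x = g x"
  shows "real_analytic_on f U = real_analytic_on g U"
proof -
  have "expansion f a r c = expansion g a r c" if "ball a r \<subseteq> U" for a r c
    unfolding expansion_def using assms that by (metis subsetD)
  then show ?thesis unfolding real_analytic_on_iff by (metis (no_types))
qed

section \<open>Sums and products of power series in several variables\<close>

lemma expansion_add:
  assumes "expansion f a r c" "expansion g a r d"
  shows "expansion (\<lambda>x. f x + g x) a r (\<lambda>\<alpha>. c \<alpha> + d \<alpha>)"
  using assms unfolding expansion_def by (auto simp: distrib_right intro!: has_sum_add)

lemma has_sum_imp_abs_summable_real: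
  fixes f :: "'a \<Rightarrow> real"
  shows "(f has_sum s) A \<Longrightarrow> (\<lambda>x. norm (f x)) summable_on A"
  using has_sum_imp_summable[of f A s] summable_on_iff_abs_summable_on_real[of f A] by simp

lemma mon_add: "mon v (\<lambda>i. \<alpha> i + \<beta> i) = mon v \<alpha> * mon v \<beta>"
  by (simp add: mon_def power_add prod.distrib)

text \<open>Cauchy product: both series converge absolutely, so the products of their terms are
  summable over pairs and can be regrouped by \<open>\<alpha> + \<beta> = \<gamma>\<close>, where
  the monomial is constant.\<close>

lemma expansion_mult:
  assumes f: "expansion f a r c" and g: "expansion g a r d"
  shows "expansion (\<lambda>x. f x * g x) a r
    (\<lambda>\<gamma>. \<Sum>\<^sub>\<infinity>(\<alpha>, \<beta>)\<in>{(\<alpha>, \<beta>). (\<lambda>i. \<alpha> i + \<beta> i) = \<gamma>}. c \<alpha> * d \<beta>)"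
  unfolding expansion_def
proof
  fix x assume x: "x \<in> ball a r"
  define v where "v = x - a"
  define F where "F = (\<lambda>(\<alpha>, \<beta>). (c \<alpha> * mon v \<alpha>) * (d \<beta> * mon v \<beta>))"
  define B where "B = (\<lambda>\<gamma> :: 'a \<Rightarrow> nat. {(\<alpha>, \<beta>). (\<lambda>i. \<alpha> i + \<beta> i) = \<gamma>})"
  have hf: "((\<lambda>\<alpha>. c \<alpha> * mon v \<alpha>) has_sum f x) UNIV" and hg: "((\<lambda>\<alpha>. d \<alpha> * mon v \<alpha>) has_sum g x) UNIV"
    using f g x by (auto simp: expansion_def v_def)
  have sF: "F summable_on (UNIV \<times> UNIV)"
  proof -
    have f': "(\<lambda>\<alpha>. norm (c \<alpha> * mon v \<alpha>)) summable_on UNIV" and g': "(\<lambda>\<alpha>. norm (d \<alpha> * mon v \<alpha>)) summable_on UNIV"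
      by (rule has_sum_imp_abs_summable_real[OF hf], rule has_sum_imp_abs_summable_real[OF hg])
    have F: "norm (F (\<alpha>, \<beta>)) = norm (c \<alpha> * mon v \<alpha>) * norm (d \<beta> * mon v \<beta>)" for \<alpha> \<beta>
      by (simp add: F_def abs_mult)
    have 1: "(\<lambda>y. norm (F (\<alpha>, y))) summable_on UNIV" for \<alpha>
      unfolding F by (rule summable_on_cmult_right[OF g'])
    have "(\<lambda>\<alpha>. norm (c \<alpha> * mon v \<alpha>) * (\<Sum>\<^sub>\<infinity>\<beta>. norm (d \<beta> * mon v \<beta>))) summable_on UNIV"
      by (rule summable_on_cmult_left[OF f'])
    then have "(\<lambda>\<alpha>. norm (\<Sum>\<^sub>\<infinity>\<beta>. norm (F (\<alpha>, \<beta>)))) summable_on UNIV"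
      unfolding F infsum_cmult_right' by (simp add: infsum_nonneg abs_mult)
    with 1 have "(\<lambda>p. norm (F p)) summable_on (UNIV \<times> UNIV)"
      by (intro Infinite_Sum.abs_summable_on_Sigma_iff[THEN iffD2] conjI ballI)
    then show ?thesis by (rule abs_summable_summable)
  qed
  have "(F has_sum f x * g x) (UNIV \<times> UNIV)"
  proof (rule has_sum_SigmaI[OF _ _ sF])
    show "((\<lambda>y. F (\<alpha>, y)) has_sum (c \<alpha> * mon v \<alpha>) * g x) UNIV" for \<alpha>
      unfolding F_def using hg by (auto intro!: has_sum_cmult_right)
    show "((\<lambda>\<alpha>. (c \<alpha> * mon v \<alpha>) * g x) has_sum f x * g x) UNIV"
      using hf by (intro has_sum_cmult_left)
  qed
  \<comment> \<open>Tagging each pair of multi-indices with its sum turns the double sum into a sum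
    over \<open>\<gamma>\<close> of the sums over the fibres.\<close>
  moreover have "bij_betw snd (Sigma UNIV B) (UNIV \<times> UNIV)"
    by (rule bij_betwI[where g = "\<lambda>p. ((\<lambda>i. fst p i + snd p i), p)"]) (auto simp: B_def)
  ultimately have "((\<lambda>u. F (snd u)) has_sum f x * g x) (Sigma UNIV B)"
    using has_sum_reindex_bij_betw by blast
  then have "((\<lambda>\<gamma>. (\<Sum>\<^sub>\<infinity>(\<alpha>, \<beta>)\<in>B \<gamma>. c \<alpha> * d \<beta>) * mon v \<gamma>) has_sum f x * g x) UNIV"
  proof (rule has_sum_SigmaD)
    fix \<gamma>
    have eq: "F p = (case p of (\<alpha>, \<beta>) \<Rightarrow> c \<alpha> * d \<beta>) * mon v \<gamma>" if "p \<in> B \<gamma>" for p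
      using that mon_add[of v "fst p" "snd p"] by (auto simp: F_def B_def)
    have "F summable_on B \<gamma>"
      using sF by (rule summable_on_subset_banach) auto
    then have "(F has_sum infsum F (B \<gamma>)) (B \<gamma>)" by simp
    also have "infsum F (B \<gamma>) = (\<Sum>\<^sub>\<infinity>p\<in>B \<gamma>. (case p of (\<alpha>, \<beta>) \<Rightarrow> c \<alpha> * d \<beta>) * mon v \<gamma>)"
      by (rule infsum_cong) (rule eq)
    also have "\<dots> = (\<Sum>\<^sub>\<infinity>(\<alpha>, \<beta>)\<in>B \<gamma>. c \<alpha> * d \<beta>) * mon v \<gamma>"
      by (rule infsum_cmult_left')
    finally show "((\<lambda>y. F (snd (\<gamma>, y))) has_sum (\<Sum>\<^sub>\<infinity>(\<alpha>, \<beta>)\<in>B \<gamma>. c \<alpha> * d \<beta>) * mon v \<gamma>) (B \<gamma>)"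
      by simp
  qed
  then show "((\<lambda>\<gamma>. (\<Sum>\<^sub>\<infinity>(\<alpha>, \<beta>)\<in>{(\<alpha>, \<beta>). (\<lambda>i. \<alpha> i + \<beta> i) = \<gamma>}. c \<alpha> * d \<beta>) * mon (x - a) \<gamma>)
     has_sum f x * g x) UNIV"
    by (simp add: B_def v_def)
qed

lemma real_analytic_on_add:
  "real_analytic_on f U \<Longrightarrow> real_analytic_on g U \<Longrightarrow> real_analytic_on (\<lambda>x. f x + g x) U"
  by (rule real_analytic_on_binary[of f U g]) (auto intro: expansion_add)

lemma real_analytic_on_mult:
  "real_analytic_on f U \<Longrightarrow> real_analytic_on g U \<Longrightarrow> real_analytic_on (\<lambda>x. f x * g x) U"
  by (rule real_analytic_on_binary[of f U g]) (auto intro: expansion_mult)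

lemma has_sum_single: "((\<lambda>x. if x = a then k else 0) has_sum k) UNIV"
  using has_sum_finite_neutralI[of "{a}" UNIV "\<lambda>x. if x = a then k else 0" k] by simp

lemma expansion_const: "expansion (\<lambda>_. k) a r (\<lambda>\<alpha>. if \<alpha> = (\<lambda>_. 0) then k else 0)"
proof -
  have "(\<lambda>\<alpha>. (if \<alpha> = (\<lambda>_. 0) then k else 0) * mon v \<alpha>) = (\<lambda>\<alpha>. if \<alpha> = (\<lambda>_. 0) then k else 0)" for v :: "real^'a"
    by (auto simp: mon_def)
  note eq = this
  show ?thesis unfolding expansion_def eq by (intro ballI has_sum_single)
qed

lemma expansion_coord_diff: "expansion (\<lambda>x. x $ i - a $ i) a r (\<lambda>\<alpha>. if \<alpha> = (\<lambda>j. if j = i then 1 else 0) then 1 else 0)"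
proof -
  have "(\<lambda>\<alpha>. (if \<alpha> = (\<lambda>j. if j = i then 1 else 0) then 1 else 0) * mon v \<alpha>)
      = (\<lambda>\<alpha>. if \<alpha> = (\<lambda>j. if j = i then 1 else 0) then v $ i else 0)" for v
  proof -
    have "mon v (\<lambda>j. if j = i then 1 else 0) = (\<Prod>j\<in>UNIV. if j = i then v $ j else 1)"
      unfolding mon_def by (intro prod.cong) auto
    also have "\<dots> = v $ i" by simp
    finally show ?thesis by (intro ext) simp
  qed
  note eq = this
  show ?thesis
    unfolding expansion_def eq vector_minus_component[symmetric] by (intro ballI has_sum_single)
qed

lemma real_analytic_on_const: "open U \<Longrightarrow> real_analytic_on (\<lambda>_. k) U"
  unfolding real_analytic_on_iff using expansion_const open_contains_ball[of U] by blast

lemma real_analytic_on_coord: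
  assumes "open U" shows "real_analytic_on (\<lambda>x. x $ i) U"
  unfolding real_analytic_on_iff
proof
  fix a assume "a \<in> U"
  then obtain r where r: "r > 0" "ball a r \<subseteq> U" using assms open_contains_ball by blast
  have "expansion (\<lambda>x. a $ i + (x $ i - a $ i)) a r
     (\<lambda>\<alpha>. (if \<alpha> = (\<lambda>_. 0) then a $ i else 0) + (if \<alpha> = (\<lambda>j. if j = i then 1 else 0) then 1 else 0))"
    by (rule expansion_add[OF expansion_const expansion_coord_diff])
  then show "\<exists>r>0. ball a r \<subseteq> U \<and> (\<exists>c. expansion (\<lambda>x. x $ i) a r c)" using r by auto
qed

text \<open>By the binomial theorem the remainder consists of the terms of order
  \<open>k \<ge> 2\<close> in \<open>t\<close>, and for these \<open>\<bar>t\<bar> ^ k\<close> is at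
  most \<open>(t / \<delta>)\<close> squared times \<open>\<delta> ^ k\<close>. The right side is
  the same remainder at \<open>\<bar>s\<bar>\<close> and \<open>\<delta>\<close>, so
  \<open>t\<close> enters only through a quadratic factor.\<close>

lemma power_remainder_bound:
  fixes s t \<delta> :: real
  assumes "\<delta> > 0" "\<bar>t\<bar> \<le> \<delta>"
  shows "\<bar>(s + t) ^ n - s ^ n - n * t * s ^ (n - 1)\<bar>
    \<le> (t / \<delta>)\<^sup>2 * ((\<bar>s\<bar> + \<delta>) ^ n - \<bar>s\<bar> ^ n - n * \<delta> * \<bar>s\<bar> ^ (n - 1))"
proof (induction n)
  case (Suc n)
  define R where "R s t = (s + t) ^ n - s ^ n - n * t * s ^ (n - 1)" for s t :: real
  \<comment> \<open>Recursion of the remainder in the exponent; for \<open>\<bar>s\<bar>\<close> and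
    \<open>\<delta>\<close> all its ingredients are nonnegative, which lets the bound
    propagate.\<close>
  have step: "(s + t) ^ Suc n - s ^ Suc n - Suc n * t * s ^ (Suc n - 1)
      = (s + t) * R s t + n * t\<^sup>2 * s ^ (n - 1)" for s t :: real
  proof (cases n)
    case (Suc m)
    then show ?thesis by (simp add: R_def algebra_simps power2_eq_square)
  qed (simp add: R_def)
  have IH: "\<bar>R s t\<bar> \<le> (t / \<delta>)\<^sup>2 * R \<bar>s\<bar> \<delta>" using Suc by (simp add: R_def)
  have "\<bar>(s + t) * R s t + n * t\<^sup>2 * s ^ (n - 1)\<bar> \<le> \<bar>s + t\<bar> * \<bar>R s t\<bar> + n * t\<^sup>2 * \<bar>s\<bar> ^ (n - 1)"
    by (rule order.trans[OF abs_triangle_ineq]) (simp add: abs_mult power_abs)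
  also have "\<dots> \<le> (\<bar>s\<bar> + \<delta>) * ((t / \<delta>)\<^sup>2 * R \<bar>s\<bar> \<delta>) + n * t\<^sup>2 * \<bar>s\<bar> ^ (n - 1)"
    using assms IH by (intro add_right_mono mult_mono) auto
  also have "\<dots> = (t / \<delta>)\<^sup>2 * ((\<bar>s\<bar> + \<delta>) * R \<bar>s\<bar> \<delta> + n * \<delta>\<^sup>2 * \<bar>s\<bar> ^ (n - 1))"
    using assms by (simp add: field_simps)
  finally show ?case unfolding step .
qed simp

lemma mon_remove: "mon v \<alpha> = (v $ i) ^ \<alpha> i * (\<Prod>j\<in>UNIV - {i}. (v $ j) ^ \<alpha> j)"
  unfolding mon_def by (rule prod.remove) auto

text \<open>Termwise differentiation. Absolute convergence at a point slightly enlarged in the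
  coordinate \<open>i\<close> gives a majorant for the differentiated terms and for the second-order
  remainders. The truncated \<open>\<alpha> i - 1\<close> is harmless, since for
  \<open>\<alpha> i = 0\<close> the factor \<open>\<alpha> i\<close> is zero.\<close>

lemma expansion_partial:
  fixes a x :: "real^'n"
  assumes f: "expansion f a r c" and x: "x \<in> ball a r"
  obtains g where "((\<lambda>t. f (x + t *\<^sub>R axis i 1)) has_real_derivative g) (at 0)"
    "((\<lambda>\<alpha>. c \<alpha> * (\<alpha> i * mon (x - a) (\<alpha>(i := \<alpha> i - 1)))) has_sum g) UNIV"
proof -
  define v where "v = x - a"
  define s where "s = v $ i"
  have nv: "norm v < r" using x by (simp add: v_def dist_norm norm_minus_commute)
  \<comment> \<open>Half the room left between \<open>norm v\<close> and \<open>r\<close>, so that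
    \<open>norm v + \<delta>\<close> stays below \<open>r\<close>.\<close>
  define \<delta> where "\<delta> = (r - norm v) / 2"
  have \<delta>: "\<delta> > 0" using nv by (simp add: \<delta>_def)
  \<comment> \<open>Coordinates are made nonnegative and the \<open>i\<close>-th one is enlarged by
    \<open>\<delta>\<close>; the absolute values of the terms at \<open>a + y\<close> are the
    majorant \<open>W\<close> below.\<close>
  define y :: "real^'n" where "y = (\<chi> j. \<bar>v $ j\<bar>) + \<delta> *\<^sub>R axis i 1"
  have "norm (\<chi> j. \<bar>v $ j\<bar>) = norm v" by (simp add: norm_vec_def)
  then have "norm y \<le> norm v + \<delta>"
    unfolding y_def using norm_triangle_ineq[of "\<chi> j. \<bar>v $ j\<bar>" "\<delta> *\<^sub>R axis i 1"] \<delta>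
    by simp
  then have "norm y < r" using nv by (simp add: \<delta>_def field_simps)
  then have "((\<lambda>\<alpha>. c \<alpha> * mon y \<alpha>) has_sum f (a + y)) UNIV"
    using bspec[OF f[unfolded expansion_def], of "a + y"] by (simp add: dist_norm)
  then have "(\<lambda>\<alpha>. norm (c \<alpha> * mon y \<alpha>)) summable_on UNIV"
    by (rule has_sum_imp_abs_summable_real)
  define Q where "Q \<alpha> = (\<Prod>j\<in>UNIV - {i}. (v $ j) ^ \<alpha> j)" for \<alpha> :: "'n \<Rightarrow> nat"
  define W where "W \<alpha> = \<bar>c \<alpha>\<bar> * ((\<bar>s\<bar> + \<delta>) ^ \<alpha> i * \<bar>Q \<alpha>\<bar>)" for \<alpha> :: "'n \<Rightarrow> nat"
  have "mon y \<alpha> = (\<bar>s\<bar> + \<delta>) ^ \<alpha> i * \<bar>Q \<alpha>\<bar>" for \<alpha>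
    unfolding mon_remove[of y \<alpha> i] Q_def abs_prod using \<delta>
    by (auto simp: y_def s_def axis_def power_abs intro!: prod.cong)
  then have "W = (\<lambda>\<alpha>. norm (c \<alpha> * mon y \<alpha>))"
    using \<delta> by (auto simp: W_def abs_mult)
  then have W: "W summable_on UNIV" using \<open>(\<lambda>\<alpha>. norm (c \<alpha> * mon y \<alpha>)) summable_on UNIV\<close> by simp
  define M where "M = infsum W UNIV"
  have WM: "(W has_sum M) UNIV" using W by (simp add: M_def)
  \<comment> \<open>The remainder bound at \<open>t = \<delta>\<close> shows that the remainder at
    \<open>\<bar>s\<bar>\<close> and \<open>\<delta>\<close> is nonnegative, which limits its linear
    term.\<close>
  have pow: "\<alpha> i * \<bar>s\<bar> ^ (\<alpha> i - 1) \<le> (\<bar>s\<bar> + \<delta>) ^ \<alpha> i / \<delta>" for \<alpha> :: "'n \<Rightarrow> nat"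
  proof -
    have "0 \<le> (\<delta> / \<delta>)\<^sup>2 * ((\<bar>\<bar>s\<bar>\<bar> + \<delta>) ^ \<alpha> i - \<bar>\<bar>s\<bar>\<bar> ^ \<alpha> i - \<alpha> i * \<delta> * \<bar>\<bar>s\<bar>\<bar> ^ (\<alpha> i - 1))"
      by (rule order.trans[OF _ power_remainder_bound]) (use \<delta> in auto)
    then have "\<alpha> i * \<delta> * \<bar>s\<bar> ^ (\<alpha> i - 1) \<le> (\<bar>s\<bar> + \<delta>) ^ \<alpha> i - \<bar>s\<bar> ^ \<alpha> i"
      using \<delta> by simp
    also have "\<dots> \<le> (\<bar>s\<bar> + \<delta>) ^ \<alpha> i" by simp
    finally show ?thesis using \<delta> by (simp add: field_simps)
  qed
  define G where "G \<alpha> = c \<alpha> * (\<alpha> i * s ^ (\<alpha> i - 1) * Q \<alpha>)" for \<alpha>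
  have "G summable_on UNIV"
  proof (rule abs_summable_summable, rule Infinite_Sum.abs_summable_on_comparison_test'[OF summable_on_cmult_right[OF W, of "1 / \<delta>"]])
    fix \<alpha> :: "'n \<Rightarrow> nat"
    have "norm (G \<alpha>) = \<bar>c \<alpha>\<bar> * (\<alpha> i * \<bar>s\<bar> ^ (\<alpha> i - 1) * \<bar>Q \<alpha>\<bar>)"
      by (simp add: G_def abs_mult power_abs)
    also have "\<dots> \<le> \<bar>c \<alpha>\<bar> * ((\<bar>s\<bar> + \<delta>) ^ \<alpha> i / \<delta> * \<bar>Q \<alpha>\<bar>)"
      by (intro mult_left_mono mult_right_mono pow) auto
    finally show "norm (G \<alpha>) \<le> 1 / \<delta> * W \<alpha>" by (simp add: W_def)
  qed
  then obtain g where g: "(G has_sum g) UNIV" using has_sum_infsum by blast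
  have fx: "((\<lambda>\<alpha>. c \<alpha> * ((s + t) ^ \<alpha> i * Q \<alpha>)) has_sum f (x + t *\<^sub>R axis i 1)) UNIV" if "\<bar>t\<bar> < \<delta>" for t
  proof -
    have "norm (v + t *\<^sub>R axis i 1) \<le> norm v + \<bar>t\<bar>"
      using norm_triangle_ineq[of v "t *\<^sub>R axis i 1"] by simp
    then have "norm (v + t *\<^sub>R axis i 1) < r" using that nv by (simp add: \<delta>_def)
    then have "x + t *\<^sub>R axis i 1 \<in> ball a r"
      by (simp add: dist_norm v_def norm_minus_commute[of a] algebra_simps)
    then have "((\<lambda>\<alpha>. c \<alpha> * mon (x + t *\<^sub>R axis i 1 - a) \<alpha>) has_sum f (x + t *\<^sub>R axis i 1)) UNIV"
      using f by (simp add: expansion_def)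
    moreover have "mon (x + t *\<^sub>R axis i 1 - a) \<alpha> = (s + t) ^ \<alpha> i * Q \<alpha>" for \<alpha>
      unfolding mon_remove[of _ \<alpha> i] Q_def
      by (auto simp: s_def v_def axis_def algebra_simps intro!: prod.cong)
    ultimately show ?thesis by simp
  qed
  \<comment> \<open>Summing the remainder bounds over all terms gives an error quadratic in
    \<open>t\<close>; after division by \<open>t\<close> it tends to zero.\<close>
  have bound: "\<bar>f (x + t *\<^sub>R axis i 1) - f x - t * g\<bar> \<le> (t / \<delta>)\<^sup>2 * M" if t: "\<bar>t\<bar> < \<delta>" for t
  proof -
    define D where "D \<alpha> = c \<alpha> * ((s + t) ^ \<alpha> i * Q \<alpha>) + (- 1) * (c \<alpha> * ((s + 0) ^ \<alpha> i * Q \<alpha>)) + (- t) * G \<alpha>"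
      for \<alpha>
    have D: "(D has_sum (f (x + t *\<^sub>R axis i 1) + (- 1) * f (x + 0 *\<^sub>R axis i 1) + (- t) * g)) UNIV"
      unfolding D_def
      by (intro has_sum_add has_sum_cmult_right fx t g) (use \<delta> in auto)
    have "D \<alpha> = c \<alpha> * (((s + t) ^ \<alpha> i - s ^ \<alpha> i - \<alpha> i * t * s ^ (\<alpha> i - 1)) * Q \<alpha>)" for \<alpha>
      by (simp add: D_def G_def algebra_simps)
    then have "norm (D \<alpha>) = \<bar>c \<alpha>\<bar> * (\<bar>(s + t) ^ \<alpha> i - s ^ \<alpha> i - \<alpha> i * t * s ^ (\<alpha> i - 1)\<bar> * \<bar>Q \<alpha>\<bar>)" for \<alpha>
      by (simp add: abs_mult)
    moreover have "\<bar>(s + t) ^ n - s ^ n - n * t * s ^ (n - 1)\<bar> \<le> (t / \<delta>)\<^sup>2 * (\<bar>s\<bar> + \<delta>) ^ n" for n :: nat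
    proof -
      have "(t / \<delta>)\<^sup>2 * ((\<bar>s\<bar> + \<delta>) ^ n - \<bar>s\<bar> ^ n - n * \<delta> * \<bar>s\<bar> ^ (n - 1)) \<le> (t / \<delta>)\<^sup>2 * (\<bar>s\<bar> + \<delta>) ^ n"
      proof (intro mult_left_mono)
        have "0 \<le> n * \<delta> * \<bar>s\<bar> ^ (n - 1)" using \<delta> by simp
        then show "(\<bar>s\<bar> + \<delta>) ^ n - \<bar>s\<bar> ^ n - n * \<delta> * \<bar>s\<bar> ^ (n - 1) \<le> (\<bar>s\<bar> + \<delta>) ^ n"
          using zero_le_power[of "\<bar>s\<bar>" n] by linarith
      qed simp
      then show ?thesis using power_remainder_bound[of \<delta> t s n] \<delta> t by linarith
    qed
    ultimately have "norm (D \<alpha>) \<le> \<bar>c \<alpha>\<bar> * ((t / \<delta>)\<^sup>2 * (\<bar>s\<bar> + \<delta>) ^ \<alpha> i * \<bar>Q \<alpha>\<bar>)" for \<alpha>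
      by (simp add: mult_left_mono mult_right_mono)
    then have "norm (D \<alpha>) \<le> (t / \<delta>)\<^sup>2 * W \<alpha>" for \<alpha>
      by (simp add: W_def mult_ac)
    then have "norm (f (x + t *\<^sub>R axis i 1) + (- 1) * f (x + 0 *\<^sub>R axis i 1) + (- t) * g) \<le> (t / \<delta>)\<^sup>2 * M"
      by (intro norm_infsum_le[OF D has_sum_cmult_right[OF WM]])
    then show ?thesis by simp
  qed
  have "((\<lambda>t. (f (x + t *\<^sub>R axis i 1) - f x) / t - g) \<longlongrightarrow> 0) (at 0)"
  proof (rule Lim_null_comparison)
    show "\<forall>\<^sub>F t in at 0. norm ((f (x + t *\<^sub>R axis i 1) - f x) / t - g) \<le> \<bar>t\<bar> * (M / \<delta>\<^sup>2)"
    proof -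
      have "norm ((f (x + t *\<^sub>R axis i 1) - f x) / t - g) \<le> \<bar>t\<bar> * (M / \<delta>\<^sup>2)" if "t \<noteq> 0" "dist t 0 < \<delta>" for t
      proof -
        have "(f (x + t *\<^sub>R axis i 1) - f x) / t - g = (f (x + t *\<^sub>R axis i 1) - f x - t * g) / t"
          using that by (simp add: field_simps)
        then have "norm ((f (x + t *\<^sub>R axis i 1) - f x) / t - g) = \<bar>f (x + t *\<^sub>R axis i 1) - f x - t * g\<bar> / \<bar>t\<bar>"
          by simp
        also have "\<dots> \<le> (t / \<delta>)\<^sup>2 * M / \<bar>t\<bar>"
          using bound[of t] that by (intro divide_right_mono) auto
        also have "\<dots> = \<bar>t\<bar> * (M / \<delta>\<^sup>2)"
        proof -
          have "(t / \<delta>)\<^sup>2 * M / \<bar>t\<bar> = t\<^sup>2 / \<bar>t\<bar> * (M / \<delta>\<^sup>2)" by (simp add: power_divide)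
          also have "t\<^sup>2 / \<bar>t\<bar> = \<bar>t\<bar>" by (cases "t \<ge> 0") (auto simp: power2_eq_square)
          finally show ?thesis .
        qed
        finally show ?thesis .
      qed
      then show ?thesis using \<delta> by (auto simp: eventually_at)
    qed
    show "((\<lambda>t. \<bar>t\<bar> * (M / \<delta>\<^sup>2)) \<longlongrightarrow> 0) (at 0)"
      by (rule tendsto_mult_left_zero) (rule tendsto_rabs_zero[OF tendsto_ident_at])
  qed
  then have "((\<lambda>t. f (x + t *\<^sub>R axis i 1)) has_real_derivative g) (at 0)"
    by (simp add: DERIV_def LIM_zero_iff)
  moreover have "G = (\<lambda>\<alpha>. c \<alpha> * (\<alpha> i * mon (x - a) (\<alpha>(i := \<alpha> i - 1))))"
    unfolding mon_remove[of _ _ i] Q_def G_def s_def v_def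
    by (intro ext) (auto simp: mult_ac intro!: prod.cong)
  ultimately show ?thesis using that g by blast
qed

lemma partial_eqI: "((\<lambda>t. f (x + t *\<^sub>R axis i 1)) has_real_derivative D) (at 0) \<Longrightarrow> partial i f x = D"
  unfolding partial_def by (rule some_equality) (auto intro: DERIV_unique)

text \<open>Terms with \<open>\<alpha> i = 0\<close> disappear under differentiation, and lowering
  the \<open>i\<close>-th index by one reindexes the others. The radius is unchanged.\<close>

lemma expansion_partial_expansion:
  assumes f: "expansion f a r c"
  shows "expansion (partial i f) a r (\<lambda>\<beta>. c (\<beta>(i := Suc (\<beta> i))) * Suc (\<beta> i))"
  unfolding expansion_def
proof
  fix x assume x: "x \<in> ball a r"
  obtain g where g: "((\<lambda>t. f (x + t *\<^sub>R axis i 1)) has_real_derivative g) (at 0)"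
    "((\<lambda>\<alpha>. c \<alpha> * (\<alpha> i * mon (x - a) (\<alpha>(i := \<alpha> i - 1)))) has_sum g) UNIV"
    using expansion_partial[OF f x] by blast
  have "((\<lambda>\<alpha>. c \<alpha> * (\<alpha> i * mon (x - a) (\<alpha>(i := \<alpha> i - 1)))) has_sum g) {\<alpha>. \<alpha> i > 0}"
    using g(2) by (rule has_sum_cong_neutral[THEN iffD1, rotated -1]) auto
  moreover have "bij_betw (\<lambda>\<beta>. \<beta>(i := Suc (\<beta> i))) UNIV {\<alpha>. \<alpha> i > 0}"
    by (rule bij_betwI[where g = "\<lambda>\<alpha>. \<alpha>(i := \<alpha> i - 1)"]) auto
  ultimately have "((\<lambda>\<beta>. c (\<beta>(i := Suc (\<beta> i))) * (Suc (\<beta> i) * mon (x - a) \<beta>)) has_sum g) UNIV"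
    using has_sum_reindex_bij_betw[of "\<lambda>\<beta>. \<beta>(i := Suc (\<beta> i))" UNIV "{\<alpha>. \<alpha> i > 0}"
        "\<lambda>\<alpha>. c \<alpha> * (\<alpha> i * mon (x - a) (\<alpha>(i := \<alpha> i - 1)))" g] by simp
  then show "((\<lambda>\<beta>. c (\<beta>(i := Suc (\<beta> i))) * Suc (\<beta> i) * mon (x - a) \<beta>) has_sum partial i f x) UNIV"
    by (simp add: partial_eqI[OF g(1)] mult.assoc)
qed

lemma real_analytic_on_partial: "real_analytic_on f U \<Longrightarrow> real_analytic_on (partial i f) U"
  unfolding real_analytic_on_iff using expansion_partial_expansion by meson

lemma real_analytic_on_differentiable:
  assumes "real_analytic_on f U" "x \<in> U"
  shows "(\<lambda>t. f (x + t *\<^sub>R axis i 1)) differentiable (at 0)"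
proof -
  obtain r c where "r > 0" "expansion f x r c" using assms unfolding real_analytic_on_iff by blast
  then show ?thesis
    using expansion_partial[of f x r c x i] centre_in_ball[of x r] unfolding real_differentiable_def by metis
qed

text \<open>Continuity at the centre is enough, as an analytic function has an expansion about every
  point of \<open>U\<close>. Close to \<open>a\<close>, a nonconstant monomial in
  \<open>x - a\<close> is bounded by \<open>norm (x - a) / \<rho>\<close> times its value at the
  point \<open>y\<close> with all coordinates \<open>\<rho>\<close>.\<close>

lemma expansion_isCont:
  fixes a :: "real^'n"
  assumes f: "expansion f a r c" and r: "r > 0"
  shows "isCont f a"
proof -
  \<comment> \<open>The sum of the coordinates of \<open>y\<close> is then \<open>r / 2\<close>,
    which puts \<open>a + y\<close> into the ball.\<close>
  define \<rho> where "\<rho> = r / (2 * CARD('n))"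
  have \<rho>: "\<rho> > 0" using r by (simp add: \<rho>_def)
  define y :: "real^'n" where "y = (\<chi> j. \<rho>)"
  have "norm y \<le> (\<Sum>j\<in>UNIV. \<bar>y $ j\<bar>)" by (rule norm_le_l1_cart)
  also have "\<dots> < r" using r by (simp add: y_def \<rho>_def)
  finally have "((\<lambda>\<alpha>. c \<alpha> * mon y \<alpha>) has_sum f (a + y)) UNIV"
    using bspec[OF f[unfolded expansion_def], of "a + y"] by (simp add: dist_norm)
  then have W: "(\<lambda>\<alpha>. norm (c \<alpha> * mon y \<alpha>)) summable_on UNIV"
    by (rule has_sum_imp_abs_summable_real)
  define M where "M = (\<Sum>\<^sub>\<infinity>\<alpha>. norm (c \<alpha> * mon y \<alpha>))"
  have WM: "((\<lambda>\<alpha>. norm (c \<alpha> * mon y \<alpha>)) has_sum M) UNIV" using W by (simp add: M_def)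
  have y0: "mon y \<alpha> \<ge> 0" for \<alpha> using \<rho> by (auto simp: mon_def y_def intro!: prod_nonneg)
  have bound: "\<bar>f x - f a\<bar> \<le> norm (x - a) / \<rho> * M" if x: "dist x a < min r \<rho>" for x
  proof -
    define h where "h = norm (x - a) / \<rho>"
    have h: "0 \<le> h" "h \<le> 1" using x \<rho> by (auto simp: h_def dist_norm)
    have le: "\<bar>mon (x - a) \<alpha> - mon (a - a) \<alpha>\<bar> \<le> h * mon y \<alpha>" for \<alpha>
    proof (cases "\<alpha> = (\<lambda>_. 0)")
      case True
      then show ?thesis using h y0 by (simp add: mon_def)
    next
      case False
      then obtain k where k: "\<alpha> k > 0" by auto
      have pw: "\<bar>(x - a) $ j\<bar> ^ \<alpha> j \<le> \<rho> ^ \<alpha> j" for j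
        using component_le_norm_cart[of "x - a" j] x by (intro power_mono) (auto simp: dist_norm)
      have "\<bar>(x - a) $ k\<bar> \<le> h * \<rho>"
        using component_le_norm_cart[of "x - a" k] \<rho> by (simp add: h_def)
      then have "\<bar>(x - a) $ k\<bar> ^ \<alpha> k \<le> (h * \<rho>) ^ \<alpha> k" by (intro power_mono) auto
      also have "\<dots> = h ^ \<alpha> k * \<rho> ^ \<alpha> k" by (rule power_mult_distrib)
      also have "\<dots> \<le> h * \<rho> ^ \<alpha> k"
        using h \<rho> k power_decreasing[of 1 "\<alpha> k" h] by (intro mult_right_mono) auto
      finally have "\<bar>(x - a) $ k\<bar> ^ \<alpha> k * (\<Prod>j\<in>UNIV - {k}. \<bar>(x - a) $ j\<bar> ^ \<alpha> j)
          \<le> (h * \<rho> ^ \<alpha> k) * (\<Prod>j\<in>UNIV - {k}. \<rho> ^ \<alpha> j)"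
        using h \<rho> by (intro mult_mono prod_mono conjI pw prod_nonneg) auto
      moreover have "\<bar>mon (x - a) \<alpha>\<bar> = \<bar>(x - a) $ k\<bar> ^ \<alpha> k * (\<Prod>j\<in>UNIV - {k}. \<bar>(x - a) $ j\<bar> ^ \<alpha> j)"
        unfolding mon_remove[of _ _ k] by (simp add: abs_mult abs_prod power_abs)
      moreover have "mon y \<alpha> = \<rho> ^ \<alpha> k * (\<Prod>j\<in>UNIV - {k}. \<rho> ^ \<alpha> j)"
        unfolding mon_remove[of _ _ k] by (simp add: y_def)
      moreover have "mon (a - a) \<alpha> = 0"
        unfolding mon_remove[of _ _ k] using k by simp
      ultimately show ?thesis by (simp add: mult.assoc)
    qed
    have "((\<lambda>\<alpha>. c \<alpha> * mon (x - a) \<alpha> + (- 1) * (c \<alpha> * mon (a - a) \<alpha>)) has_sum (f x + (- 1) * f a)) UNIV"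
      using bspec[OF f[unfolded expansion_def], of x] bspec[OF f[unfolded expansion_def], of a] x r
      by (intro has_sum_add has_sum_cmult_right) (simp_all add: dist_commute)
    then have "norm (f x + (- 1) * f a) \<le> h * M"
    proof (rule norm_infsum_le[OF _ has_sum_cmult_right[OF WM]])
      fix \<alpha> :: "'n \<Rightarrow> nat"
      have "norm (c \<alpha> * mon (x - a) \<alpha> + (- 1) * (c \<alpha> * mon (a - a) \<alpha>))
          = \<bar>c \<alpha>\<bar> * \<bar>mon (x - a) \<alpha> - mon (a - a) \<alpha>\<bar>"
        by (simp add: abs_mult[symmetric] algebra_simps)
      also have "\<dots> \<le> \<bar>c \<alpha>\<bar> * (h * mon y \<alpha>)" by (intro mult_left_mono le) auto
      finally show "norm (c \<alpha> * mon (x - a) \<alpha> + (- 1) * (c \<alpha> * mon (a - a) \<alpha>)) \<le> h * norm (c \<alpha> * mon y \<alpha>)"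
        using y0 by (simp add: abs_mult mult_ac)
    qed
    then show ?thesis by (simp add: h_def)
  qed
  have "((\<lambda>x. f x - f a) \<longlongrightarrow> 0) (at a)"
  proof (rule Lim_null_comparison)
    show "\<forall>\<^sub>F x in at a. norm (f x - f a) \<le> norm (x - a) / \<rho> * M"
      unfolding eventually_at using bound r \<rho> by (intro exI[of _ "min r \<rho>"]) auto
    have "((\<lambda>x. norm (x - a)) \<longlongrightarrow> norm (a - a)) (at a)" by (intro tendsto_intros)
    then have "((\<lambda>x. norm (x - a) * (M / \<rho>)) \<longlongrightarrow> 0) (at a)"
      by (intro tendsto_mult_left_zero) simp
    then show "((\<lambda>x. norm (x - a) / \<rho> * M) \<longlongrightarrow> 0) (at a)" by simp
  qed
  then show ?thesis by (simp add: isCont_def LIM_zero_iff)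
qed

lemma real_analytic_on_isCont: "real_analytic_on f U \<Longrightarrow> a \<in> U \<Longrightarrow> isCont f a"
  unfolding real_analytic_on_iff using expansion_isCont by blast

lemma real_analytic_on_continuous: "real_analytic_on f U \<Longrightarrow> continuous_on U f"
  using real_analytic_on_isCont continuous_at_imp_continuous_on by blast

subsection \<open>The identity theorem\<close>

text \<open>Being zero near a point is locally constant along the unit interval: a zero germ spreads
  to neighbouring points, and next to a point with a nonzero power series \<open>h\<close> has no
  further zeros, so no neighbouring germ is zero.\<close>

lemma powser_eventually_zero:
  fixes h :: "real \<Rightarrow> real"
  assumes ps: "\<And>t. t \<in> {0..1} \<Longrightarrow> \<exists>r>0. \<exists>d. \<forall>u. \<bar>u - t\<bar> < r \<longrightarrow> (\<lambda>n. d n * (u - t) ^ n) sums h u"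
    and h0: "eventually (\<lambda>u. h u = 0) (nhds 0)"
  shows "h 1 = 0"
proof -
  define Z where "Z t = eventually (\<lambda>u. h u = 0) (nhds t)" for t
  have "Z 0 = Z 1"
  proof (rule connected_local_const[where A = "{0..1::real}"])
    show "\<forall>t\<in>{0..1}. \<forall>\<^sub>F u in at t within {0..1}. Z t = Z u"
    proof
      fix t :: real assume t: "t \<in> {0..1}"
      show "\<forall>\<^sub>F u in at t within {0..1}. Z t = Z u"
      proof (cases "Z t")
        case True
        then have "eventually Z (nhds t)" unfolding Z_def by (simp add: eventually_eventually)
        then show ?thesis using True
          by (auto simp: eventually_at_filter elim: eventually_mono)
      next
        case False
        obtain r d where r: "r > 0" and d: "\<And>u. \<bar>u - t\<bar> < r \<Longrightarrow> (\<lambda>n. d n * (u - t) ^ n) sums h u"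
          using ps[OF t] by blast
        have "\<exists>m. d m \<noteq> 0"
        proof (rule ccontr)
          assume "\<nexists>m. d m \<noteq> 0"
          then have "h u = 0" if "dist u t < r" for u
            using d[of u] that sums_unique2[of "\<lambda>_. 0" 0 "h u"] by (simp add: dist_real_def)
          then show False using False r unfolding Z_def eventually_nhds_metric by blast
        qed
        then obtain m where m: "d m \<noteq> 0" by blast
        \<comment> \<open>Isolation of zeros is invoked for a series that vanishes at its centre and
          has a nonzero coefficient of positive index. The extra factor \<open>u - t\<close> ensures
          both, whatever \<open>h t\<close> is.\<close>
        define d' where "d' n = (case n of 0 \<Rightarrow> 0 | Suc k \<Rightarrow> d k)" for n
        have sums: "(\<lambda>n. d' n * (u - t) ^ n) sums ((u - t) * h u)" if "norm (u - t) < r" for u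
        proof -
          have "(\<lambda>n. (u - t) * (d n * (u - t) ^ n)) sums ((u - t) * h u)"
            using d[of u] that by (intro sums_mult) auto
          then have "(\<lambda>n. d' (Suc n) * (u - t) ^ Suc n) sums ((u - t) * h u)"
            by (simp add: d'_def mult_ac)
          then show ?thesis by (subst (asm) sums_Suc_iff) (simp add: d'_def)
        qed
        obtain s where s: "0 < s" and nz: "\<And>z. z \<in> cball t s - {t} \<Longrightarrow> (z - t) * h z \<noteq> 0"
          using powser_0_nonzero[of r t d' "\<lambda>u. (u - t) * h u" "Suc m"] r sums m
          by (auto simp: d'_def)
        have "\<not> Z u" if "u \<noteq> t" "dist u t < s" for u
          using nz[of u] that eventually_nhds_x_imp_x[of "\<lambda>u. h u = 0" u]
          by (auto simp: Z_def dist_commute)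
        then show ?thesis using False s by (auto simp: eventually_at)
      qed
    qed
  qed auto
  then have "Z 1" using h0 by (simp add: Z_def)
  then show ?thesis unfolding Z_def by (rule eventually_nhds_x_imp_x)
qed

text \<open>Grouped by total degree, the terms of degree \<open>n\<close> at
  \<open>t *\<^sub>R v\<close> are \<open>t ^ n\<close> times those at \<open>v\<close>, so the
  coefficients \<open>d\<close> do not depend on \<open>t\<close>.\<close>

lemma expansion_line:
  assumes f: "expansion f p r c"
  shows "\<exists>d. \<forall>t. norm (t *\<^sub>R v) < r \<longrightarrow> (\<lambda>n. d n * t ^ n) sums f (p + t *\<^sub>R v)"
proof -
  define B where "B = (\<lambda>n. {\<alpha> :: 'a \<Rightarrow> nat. sum \<alpha> UNIV = n})"
  define d where "d n = (\<Sum>\<^sub>\<infinity>\<alpha>\<in>B n. c \<alpha> * mon v \<alpha>)" for n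
  have "(\<lambda>n. d n * t ^ n) sums f (p + t *\<^sub>R v)" if t: "norm (t *\<^sub>R v) < r" for t
  proof -
    have mt: "mon (t *\<^sub>R v) \<alpha> = mon v \<alpha> * t ^ sum \<alpha> UNIV" for \<alpha>
      by (simp add: mon_def power_mult_distrib prod.distrib power_sum)
    define F where "F \<alpha> = c \<alpha> * mon (t *\<^sub>R v) \<alpha>" for \<alpha>
    have F: "(F has_sum f (p + t *\<^sub>R v)) UNIV"
      using bspec[OF f[unfolded expansion_def], of "p + t *\<^sub>R v"] t by (simp add: dist_norm F_def[abs_def])
    moreover have "bij_betw snd (Sigma UNIV B) UNIV"
      by (rule bij_betwI[where g = "\<lambda>\<alpha>. (sum \<alpha> UNIV, \<alpha>)"]) (auto simp: B_def)
    ultimately have "((\<lambda>u. F (snd u)) has_sum f (p + t *\<^sub>R v)) (Sigma UNIV B)"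
      using has_sum_reindex_bij_betw by blast
    then have "((\<lambda>n. d n * t ^ n) has_sum f (p + t *\<^sub>R v)) UNIV"
    proof (rule has_sum_SigmaD)
      fix n
      have "F summable_on B n"
        using has_sum_imp_summable[OF F] by (rule summable_on_subset_banach) auto
      then have "(F has_sum infsum F (B n)) (B n)" by simp
      also have "infsum F (B n) = (\<Sum>\<^sub>\<infinity>\<alpha>\<in>B n. (c \<alpha> * mon v \<alpha>) * t ^ n)"
        by (rule infsum_cong) (auto simp: F_def mt B_def)
      also have "\<dots> = d n * t ^ n" unfolding d_def by (rule infsum_cmult_left')
      finally show "((\<lambda>y. F (snd (n, y))) has_sum d n * t ^ n) (B n)" by simp
    qed
    then show ?thesis by (rule has_sum_imp_sums)
  qed
  then show ?thesis by blast
qed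

text \<open>The segment from \<open>b\<close> to \<open>x\<close> stays in the ball by convexity,
  and \<open>f\<close> along it is a function of one variable with local power series.\<close>

lemma real_analytic_on_ball_zero:
  assumes f: "real_analytic_on f (ball a r)" and b: "b \<in> ball a r" and x: "x \<in> ball a r"
    and f0: "eventually (\<lambda>z. f z = 0) (nhds b)"
  shows "f x = 0"
proof -
  define h where "h t = f (b + t *\<^sub>R (x - b))" for t
  have "h 1 = 0"
  proof (rule powser_eventually_zero)
    fix t :: real assume t: "t \<in> {0..1}"
    define p where "p = b + t *\<^sub>R (x - b)"
    have "p \<in> closed_segment b x"
      using t by (auto simp: in_segment p_def algebra_simps intro!: exI[of _ t])
    then have "p \<in> ball a r"
      using closed_segment_subset[OF b x convex_ball] by blast
    then obtain s c where s: "s > 0" and "expansion f p s c"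
      using f unfolding real_analytic_on_iff by blast
    then obtain d where d: "\<And>t. norm (t *\<^sub>R (x - b)) < s \<Longrightarrow> (\<lambda>n. d n * t ^ n) sums f (p + t *\<^sub>R (x - b))"
      using expansion_line by blast
    \<comment> \<open>Adding \<open>1\<close> keeps the denominator positive also for
      \<open>x = b\<close>.\<close>
    have "(\<lambda>n. d n * (u - t) ^ n) sums h u" if "\<bar>u - t\<bar> < s / (norm (x - b) + 1)" for u
    proof -
      have "\<bar>u - t\<bar> * (norm (x - b) + 1) < s"
        using that pos_less_divide_eq[of "norm (x - b) + 1" "\<bar>u - t\<bar>" s] by (simp add: add_nonneg_pos)
      then have "\<bar>u - t\<bar> * norm (x - b) < s" by (simp add: distrib_left)
      then have "norm ((u - t) *\<^sub>R (x - b)) < s" by simp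
      from d[OF this] show ?thesis by (simp add: h_def p_def algebra_simps)
    qed
    moreover have "s / (norm (x - b) + 1) > 0" using s by (simp add: add_nonneg_pos)
    ultimately show "\<exists>r>0. \<exists>d. \<forall>u. \<bar>u - t\<bar> < r \<longrightarrow> (\<lambda>n. d n * (u - t) ^ n) sums h u"
      by blast
  next
    have "((\<lambda>t. b + t *\<^sub>R (x - b)) \<longlongrightarrow> b + 0 *\<^sub>R (x - b)) (nhds 0)"
      by (intro tendsto_intros filterlim_ident)
    then have "filterlim (\<lambda>t. b + t *\<^sub>R (x - b)) (nhds b) (nhds 0)" by simp
    then show "eventually (\<lambda>u. h u = 0) (nhds 0)"
      unfolding h_def using f0 by (rule eventually_compose_filterlim[rotated])
  qed
  then show ?thesis by (simp add: h_def)
qed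

lemma real_analytic_on_subset:
  assumes "real_analytic_on f U" "V \<subseteq> U" "open V"
  shows "real_analytic_on f V"
  unfolding real_analytic_on_iff
proof
  fix a assume a: "a \<in> V"
  then obtain r c where r: "r > 0" "expansion f a r c"
    using assms unfolding real_analytic_on_iff by blast
  obtain s where s: "s > 0" "ball a s \<subseteq> V" using assms(3) a open_contains_ball by blast
  have "ball a (min r s) \<subseteq> V" using s by auto
  moreover have "expansion f a (min r s) c" using r by (auto intro: expansion_subset)
  ultimately show "\<exists>r>0. ball a r \<subseteq> V \<and> (\<exists>c. expansion f a r c)"
    using r s by (intro exI[of _ "min r s"]) auto
qed

text \<open>Inside a ball a zero germ passes from any point to any other, so having a zero germ is a
  locally constant property; connectedness makes it constant on \<open>U\<close>.\<close>

theorem real_analytic_on_identity: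
  assumes f: "real_analytic_on f U" and U: "connected U" and b: "b \<in> U"
    and f0: "eventually (\<lambda>z. f z = 0) (nhds b)" and x: "x \<in> U"
  shows "f x = 0"
proof -
  define Z where "Z a = eventually (\<lambda>z. f z = 0) (nhds a)" for a
  have "Z b = Z x"
  proof (rule connected_local_const[OF U b x], rule ballI)
    fix a assume "a \<in> U"
    then obtain r where r: "r > 0" "ball a r \<subseteq> U" using f unfolding real_analytic_on_iff by blast
    have fr: "real_analytic_on f (ball a r)"
      using real_analytic_on_subset[OF f] r by simp
    have "Z u = Z a" if u: "u \<in> ball a r" for u
    proof
      have ev: "Z w" if w: "w \<in> ball a r" "Z v" "v \<in> ball a r" for v w
      proof -
        have "eventually (\<lambda>z. z \<in> ball a r) (nhds w)" using w by (intro eventually_nhds_in_open) auto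
        then show ?thesis unfolding Z_def
          by (rule eventually_mono) (rule real_analytic_on_ball_zero[OF fr w(3) _ w(2)[unfolded Z_def]])
      qed
      have a: "a \<in> ball a r" using r by simp
      show "Z u \<Longrightarrow> Z a" by (rule ev[OF a _ u])
      show "Z a \<Longrightarrow> Z u" by (rule ev[OF u _ a])
    qed
    then have "\<forall>u\<in>U. u \<noteq> a \<and> dist u a < r \<longrightarrow> Z a = Z u" by (metis dist_commute mem_ball)
    then show "\<forall>\<^sub>F u in at a within U. Z a = Z u"
      unfolding eventually_at using r by blast
  qed
  then have "Z x" using f0 by (simp add: Z_def)
  then show ?thesis unfolding Z_def by (rule eventually_nhds_x_imp_x)
qed

text \<open>Analytic functions on a connected open set form an integral domain: \<open>f\<close> is
  nonzero near \<open>a\<close>, hence \<open>g\<close> is zero near \<open>a\<close> and then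
  everywhere.\<close>

lemma real_analytic_on_mult_eq_0:
  assumes f: "real_analytic_on f U" and g: "real_analytic_on g U" and U: "open U" "connected U"
    and fg: "\<And>x. x \<in> U \<Longrightarrow> f x * g x = 0" and a: "a \<in> U" "f a \<noteq> 0" and x: "x \<in> U"
  shows "g x = 0"
proof (rule real_analytic_on_identity[OF g U(2) a(1) _ x])
  have "eventually (\<lambda>z. f z \<noteq> 0) (nhds a)"
    using real_analytic_on_isCont[OF f a(1)] a(2)
    by (intro tendsto_imp_eventually_ne[of f "f a"]) (simp_all add: isCont_def tendsto_at_iff_tendsto_nhds)
  moreover have "eventually (\<lambda>z. z \<in> U) (nhds a)"
    using U a by (intro eventually_nhds_in_open) auto
  ultimately show "eventually (\<lambda>z. g z = 0) (nhds a)"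
    by eventually_elim (use fg in force)
qed

section \<open>Partial derivatives and smooth functions\<close>

lemma has_partial_derivative:
  "(\<lambda>t. f (x + t *\<^sub>R axis i 1)) differentiable (at 0) \<Longrightarrow>
    ((\<lambda>t. f (x + t *\<^sub>R axis i 1)) has_real_derivative partial i f x) (at 0)"
  using partial_eqI unfolding real_differentiable_def by metis

lemma has_partial_derivative_cong:
  fixes f g :: "real^'n \<Rightarrow> real"
  assumes "open U" "x \<in> U" "\<And>z. z \<in> U \<Longrightarrow> f z = g z"
  shows "((\<lambda>t. f (x + t *\<^sub>R axis i 1)) has_real_derivative D) (at 0)
    \<longleftrightarrow> ((\<lambda>t. g (x + t *\<^sub>R axis i 1)) has_real_derivative D) (at 0)"
proof (rule DERIV_cong_ev[OF refl _ refl])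
  have "((\<lambda>t. x + t *\<^sub>R axis i 1) \<longlongrightarrow> x + 0 *\<^sub>R axis i 1) (nhds 0)"
    by (intro tendsto_intros filterlim_ident)
  then have "filterlim (\<lambda>t. x + t *\<^sub>R axis i 1) (nhds x) (nhds 0)" by simp
  moreover have "eventually (\<lambda>z. z \<in> U) (nhds x)" by (rule eventually_nhds_in_open) fact+
  ultimately have "eventually (\<lambda>t. x + t *\<^sub>R axis i 1 \<in> U) (nhds 0)"
    by (rule eventually_compose_filterlim[rotated])
  then show "eventually (\<lambda>t. f (x + t *\<^sub>R axis i 1) = g (x + t *\<^sub>R axis i 1)) (nhds 0)"
    by (rule eventually_mono) (rule assms(3))
qed

lemma partial_cong:
  assumes "open U" "x \<in> U" "\<And>z. z \<in> U \<Longrightarrow> f z = g z"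
  shows "partial i f x = partial i g x"
  unfolding partial_def using has_partial_derivative_cong[OF assms, of "\<lambda>z. z" i] by simp

text \<open>Where \<open>ipartial\<close> exposes the outermost derivative, this recursion peels off
  the innermost one and bounds the order. The Leibniz rule then reduces a product of order
  \<open>Suc k\<close> to products of order \<open>k\<close>.\<close>

fun ck :: "nat \<Rightarrow> (real^'n) set \<Rightarrow> (real^'n \<Rightarrow> real) \<Rightarrow> bool" where
  "ck 0 U f \<longleftrightarrow> continuous_on U f"
| "ck (Suc k) U f \<longleftrightarrow> continuous_on U f
     \<and> (\<forall>i. \<forall>x\<in>U. (\<lambda>t. f (x + t *\<^sub>R axis i 1)) differentiable (at 0))
     \<and> (\<forall>i. ck k U (partial i f))"

lemma ipartial_append: "ipartial (is @ js) f = ipartial is (ipartial js f)"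
  by (induction "is") auto

lemma smooth_on_partial: "smooth_on U f \<Longrightarrow> smooth_on U (partial i f)"
  unfolding smooth_on_def using ipartial_append[of _ "[i]" f] by (metis ipartial.simps)

lemma smooth_on_imp_ck: "smooth_on U f \<Longrightarrow> ck k U f"
proof (induction k arbitrary: f)
  case 0
  then show ?case unfolding smooth_on_def by (metis ck.simps(1) ipartial.simps(1))
next
  case (Suc k)
  have "continuous_on U f \<and> (\<forall>i. \<forall>x\<in>U. (\<lambda>t. f (x + t *\<^sub>R axis i 1)) differentiable (at 0))"
    using Suc.prems unfolding smooth_on_def by (metis ipartial.simps(1))
  then show ?case using Suc smooth_on_partial by auto
qed

lemma ck_ipartial:
  "ck (Suc (length is)) U f \<Longrightarrow> ck (Suc 0) U (ipartial is f)"
proof (induction "is" arbitrary: f rule: rev_induct)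
  case (snoc i "is")
  then show ?case by (simp add: ipartial_append)
qed simp

lemma smooth_on_iff_ck: "smooth_on U f \<longleftrightarrow> (\<forall>k. ck k U f)"
proof
  assume "\<forall>k. ck k U f"
  then have "ck (Suc 0) U (ipartial is f)" for "is" using ck_ipartial by blast
  then show "smooth_on U f" unfolding smooth_on_def by simp
qed (simp add: smooth_on_imp_ck)

lemma ck_cong:
  assumes "open U" "\<And>x. x \<in> U \<Longrightarrow> f x = g x"
  shows "ck k U f = ck k U g"
  using assms(2)
proof (induction k arbitrary: f g)
  case 0
  then show ?case by (simp cong: continuous_on_cong)
next
  case (Suc k)
  have "continuous_on U f = continuous_on U g" using Suc.prems by (rule continuous_on_cong[OF refl])
  moreover have "(\<lambda>t. f (x + t *\<^sub>R axis i 1)) differentiable (at 0)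
      \<longleftrightarrow> (\<lambda>t. g (x + t *\<^sub>R axis i 1)) differentiable (at 0)" if "x \<in> U" for i x
    using has_partial_derivative_cong[OF assms(1) that Suc.prems, of "\<lambda>z. z" i] by (simp add: real_differentiable_def)
  moreover have "ck k U (partial i f) = ck k U (partial i g)" for i
    by (rule Suc.IH) (rule partial_cong[OF assms(1) _ Suc.prems])
  ultimately show ?case by simp
qed

lemma smooth_on_cong:
  "open U \<Longrightarrow> (\<And>x. x \<in> U \<Longrightarrow> f x = g x) \<Longrightarrow> smooth_on U f = smooth_on U g"
  unfolding smooth_on_iff_ck using ck_cong by blast

lemma ck_Suc: "ck (Suc k) U f \<Longrightarrow> ck k U f"
  by (induction k arbitrary: f) auto

section \<open>Sums and products of smooth functions\<close>

lemma partial_add: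
  assumes "(\<lambda>t. f (x + t *\<^sub>R axis i 1)) differentiable (at 0)" "(\<lambda>t. g (x + t *\<^sub>R axis i 1)) differentiable (at 0)"
  shows "partial i (\<lambda>x. f x + g x) x = partial i f x + partial i g x"
  by (rule partial_eqI) (rule DERIV_add[OF has_partial_derivative[OF assms(1)] has_partial_derivative[OF assms(2)]])

lemma partial_mult:
  assumes "(\<lambda>t. f (x + t *\<^sub>R axis i 1)) differentiable (at 0)" "(\<lambda>t. g (x + t *\<^sub>R axis i 1)) differentiable (at 0)"
  shows "partial i (\<lambda>x. f x * g x) x = f x * partial i g x + g x * partial i f x"
  using partial_eqI[OF DERIV_mult'[OF has_partial_derivative[OF assms(1)] has_partial_derivative[OF assms(2)]]]
  by (simp add: mult.commute)

lemma partial_const: "partial i (\<lambda>_. c) x = 0"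
  by (rule partial_eqI) simp

lemma partial_coord: "partial i (\<lambda>x. x $ j) x = (if i = j then 1 else 0)"
proof (rule partial_eqI)
  have "(\<lambda>t. (x + t *\<^sub>R axis i 1) $ j) = (\<lambda>t. x $ j + t * (if i = j then 1 else 0))"
    by (auto simp: axis_def)
  then show "((\<lambda>t. (x + t *\<^sub>R axis i 1) $ j) has_real_derivative (if i = j then 1 else 0)) (at 0)"
    by (auto intro!: derivative_eq_intros)
qed

lemma ck_add:
  assumes U: "open U"
  shows "ck k U f \<Longrightarrow> ck k U g \<Longrightarrow> ck k U (\<lambda>x. f x + g x)"
proof (induction k arbitrary: f g)
  case 0
  then show ?case by (simp add: continuous_on_add)
next
  case (Suc k)
  have "ck k U (partial i (\<lambda>x. f x + g x))" for i
  proof -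
    have "ck k U (\<lambda>x. partial i f x + partial i g x)" using Suc by simp
    then show ?thesis
      by (rule ck_cong[OF U, THEN iffD1, rotated]) (use Suc.prems in \<open>simp add: partial_add\<close>)
  qed
  then show ?case using Suc.prems
    by (simp add: continuous_on_add differentiable_add)
qed

lemma ck_mult:
  assumes U: "open U"
  shows "ck k U f \<Longrightarrow> ck k U g \<Longrightarrow> ck k U (\<lambda>x. f x * g x)"
proof (induction k arbitrary: f g)
  case 0
  then show ?case by (simp add: continuous_on_mult)
next
  case (Suc k)
  have "ck k U (partial i (\<lambda>x. f x * g x))" for i
  proof -
    have "ck k U f" "ck k U g" using Suc.prems ck_Suc by blast+
    then have "ck k U (\<lambda>x. f x * partial i g x + g x * partial i f x)"
      using Suc by (intro ck_add[OF U] Suc.IH) auto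
    then show ?thesis
      by (rule ck_cong[OF U, THEN iffD1, rotated]) (use Suc.prems in \<open>simp add: partial_mult\<close>)
  qed
  then show ?case using Suc.prems
    by (simp add: continuous_on_mult differentiable_mult)
qed

lemma real_analytic_on_imp_ck: "real_analytic_on f U \<Longrightarrow> ck k U f"
  by (induction k arbitrary: f)
    (auto simp: real_analytic_on_continuous real_analytic_on_differentiable real_analytic_on_partial)

lemma smooth_on_add: "open U \<Longrightarrow> smooth_on U f \<Longrightarrow> smooth_on U g \<Longrightarrow> smooth_on U (\<lambda>x. f x + g x)"
  and smooth_on_mult: "open U \<Longrightarrow> smooth_on U f \<Longrightarrow> smooth_on U g \<Longrightarrow> smooth_on U (\<lambda>x. f x * g x)"
  and real_analytic_on_imp_smooth_on: "real_analytic_on f U \<Longrightarrow> smooth_on U f"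
  by (simp_all add: smooth_on_iff_ck ck_add ck_mult real_analytic_on_imp_ck)

lemma smooth_on_differentiable:
  assumes "smooth_on U f" "x \<in> U"
  shows "(\<lambda>t. f (x + t *\<^sub>R axis i 1)) differentiable (at 0)"
  using smooth_on_imp_ck[OF assms(1), of "Suc 0"] assms(2) by simp

lemma poly_fun_real_analytic: "open U \<Longrightarrow> poly_fun p \<Longrightarrow> real_analytic_on (\<lambda>x. p (vec_nth x)) U"
  by (rotate_tac, induction rule: poly_fun.induct)
    (auto intro: real_analytic_on_const real_analytic_on_coord real_analytic_on_add real_analytic_on_mult)

subsection \<open>The algebra of smooth functions\<close>

lemma E_alg_carr_iff: "f \<in> carr (E_alg U) \<longleftrightarrow> smooth_on U f \<and> (\<forall>x. x \<notin> U \<longrightarrow> f x = 0)"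
  by (simp add: E_alg_def)

lemma E_alg_simps [simp]:
  "add (E_alg U) f g = (\<lambda>x. f x + g x)" "mul (E_alg U) f g = (\<lambda>x. f x * g x)"
  "scl (E_alg U) c f = (\<lambda>x. c * f x)" "zer (E_alg U) = (\<lambda>x. 0)" "one (E_alg U) = restr U (\<lambda>x. 1)"
  by (simp_all add: E_alg_def)

lemma restr_in: "x \<in> U \<Longrightarrow> restr U f x = f x"
  by (simp add: restr_def)

lemma restr_carr: "open U \<Longrightarrow> smooth_on U f \<Longrightarrow> restr U f \<in> carr (E_alg U)"
  by (simp add: E_alg_carr_iff restr_def smooth_on_cong[of U "\<lambda>x. if x \<in> U then f x else 0" f])

lemma restr_analytic_carr: "open U \<Longrightarrow> real_analytic_on f U \<Longrightarrow> restr U f \<in> carr (E_alg U)"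
  by (intro restr_carr real_analytic_on_imp_smooth_on)

lemma nash_on_cong: "(\<And>x. x \<in> U \<Longrightarrow> f x = g x) \<Longrightarrow> nash_on U f = nash_on U g"
  unfolding nash_on_def using real_analytic_on_cong[of U f g] by simp

lemma nash_S_iff:
  "open U \<Longrightarrow> g \<in> nash_S U \<longleftrightarrow> nash_on U g \<and> (\<forall>x. x \<notin> U \<longrightarrow> g x = 0) \<and> (\<exists>x\<in>U. g x \<noteq> 0)"
  unfolding nash_S_def by (auto simp: E_alg_carr_iff nash_on_def real_analytic_on_imp_smooth_on)

section \<open>Evaluation at a generic point\<close>

text \<open>The point \<open>gen_pt U T\<close> avoids the zeros of the finitely many analytic functions in \<open>T\<close>; along the
  ultrafilter it becomes a point at which no nonzero analytic function on \<open>U\<close> vanishes.\<close>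

definition gen_pt :: "(real^'n) set \<Rightarrow> (real^'n \<Rightarrow> real) set \<Rightarrow> real^'n" where
  "gen_pt U T = (SOME x. x \<in> U \<and>
     (finite T \<longrightarrow> (\<forall>h\<in>T. real_analytic_on h U \<longrightarrow> (\<exists>y\<in>U. h y \<noteq> 0) \<longrightarrow> h x \<noteq> 0)))"

definition ev :: "(real^'n) set \<Rightarrow> (real^'n \<Rightarrow> real) \<Rightarrow> (real^'n \<Rightarrow> real) ultrapower" where
  "ev U h = of_fun (\<lambda>T. h (gen_pt U T))"

definition poly_evs :: "(real^'n) set \<Rightarrow> (real^'n \<Rightarrow> real) ultrapower set" where
  "poly_evs U = {ev U (\<lambda>x. p (vec_nth x)) | p. poly_fun p}"

lemma ev_add: "ev U (\<lambda>x. f x + g x) = ev U f + ev U g"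
  and ev_diff: "ev U (\<lambda>x. f x - g x) = ev U f - ev U g"
  and ev_mult: "ev U (\<lambda>x. f x * g x) = ev U f * ev U g"
  and ev_zero: "ev U (\<lambda>_. 0) = 0"
  and ev_one: "ev U (\<lambda>_. 1) = 1"
  by (simp_all add: ev_def of_fun_add of_fun_diff of_fun_mult of_fun_zero of_fun_one)

lemma ev_sum: "finite I \<Longrightarrow> ev U (\<lambda>x. \<Sum>i\<in>I. f i x) = (\<Sum>i\<in>I. ev U (f i))"
  by (induction I rule: finite_induct) (simp_all add: ev_zero ev_add)

lemma ev_power: "ev U (\<lambda>x. f x ^ n) = ev U f ^ n"
  by (induction n) (simp_all add: ev_one ev_mult)

lemma poly_evsI: "poly_fun p \<Longrightarrow> ev U (\<lambda>x. p (vec_nth x)) \<in> poly_evs U"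
  by (auto simp: poly_evs_def)

lemma poly_evs_subring: "subring_set (poly_evs U)"
  unfolding subring_set_def
proof (intro conjI ballI)
  have "ev U (\<lambda>x. (\<lambda>_. 1) (vec_nth x)) \<in> poly_evs U" by (intro poly_evsI pf_const)
  then show "1 \<in> poly_evs U" by (simp add: ev_one)
  fix a b assume "a \<in> poly_evs U" "b \<in> poly_evs U"
  then obtain p q where p: "poly_fun p" "a = ev U (\<lambda>x. p (vec_nth x))"
    and q: "poly_fun q" "b = ev U (\<lambda>x. q (vec_nth x))" by (auto simp: poly_evs_def)
  have "ev U (\<lambda>x. (\<lambda>v. p v * q v) (vec_nth x)) \<in> poly_evs U" by (intro poly_evsI pf_mult p q)
  then show "a * b \<in> poly_evs U" by (simp add: ev_mult p q)
  have "ev U (\<lambda>x. (\<lambda>v. p v + (- 1) * q v) (vec_nth x)) \<in> poly_evs U"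
    by (intro poly_evsI pf_add pf_mult pf_const p q)
  then show "a - b \<in> poly_evs U" by (simp add: ev_diff p q)
qed

lemma ev_const_in_poly_evs: "ev U (\<lambda>_. c) \<in> poly_evs U"
  by (rule poly_evsI[OF pf_const])

lemma ev_coord_in_poly_evs: "ev U (\<lambda>x. x $ i) \<in> poly_evs U"
  by (rule poly_evsI[OF pf_var])

lemma real_analytic_on_sum:
  "open U \<Longrightarrow> finite I \<Longrightarrow> (\<And>i. i \<in> I \<Longrightarrow> real_analytic_on (f i) U) \<Longrightarrow> real_analytic_on (\<lambda>x. \<Sum>i\<in>I. f i x) U"
  by (rotate_tac, induction I rule: finite_induct) (auto intro: real_analytic_on_const real_analytic_on_add)

lemma real_analytic_on_power:
  "open U \<Longrightarrow> real_analytic_on f U \<Longrightarrow> real_analytic_on (\<lambda>x. f x ^ n) U"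
  by (induction n) (auto intro: real_analytic_on_const real_analytic_on_mult)

context
  fixes U :: "(real^'n) set"
  assumes U: "open U" "connected U" "U \<noteq> {}"
begin

text \<open>The product of finitely many nonzero analytic functions is nonzero, and a point where it
  does not vanish avoids all their zeros. For infinite \<open>T\<close> any point of
  \<open>U\<close> serves.\<close>

lemma gen_pt_props:
  shows gen_pt_in: "gen_pt U T \<in> U"
    and gen_pt_nonzero: "finite T \<Longrightarrow> h \<in> T \<Longrightarrow> real_analytic_on h U \<Longrightarrow> y \<in> U \<Longrightarrow> h y \<noteq> 0 \<Longrightarrow> h (gen_pt U T) \<noteq> 0"
proof -
  have ex: "\<exists>x\<in>U. \<forall>h\<in>T. real_analytic_on h U \<longrightarrow> (\<exists>y\<in>U. h y \<noteq> 0) \<longrightarrow> h x \<noteq> 0" if "finite T" for T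
  proof -
    define T' where "T' = {h\<in>T. real_analytic_on h U \<and> (\<exists>y\<in>U. h y \<noteq> 0)}"
    have "finite T'" using that by (simp add: T'_def)
    moreover have "\<forall>h\<in>T'. real_analytic_on h U \<and> (\<exists>y\<in>U. h y \<noteq> 0)" by (auto simp: T'_def)
    ultimately have "\<exists>P. real_analytic_on P U \<and> (\<exists>x\<in>U. P x \<noteq> 0) \<and> (\<forall>x\<in>U. P x \<noteq> 0 \<longrightarrow> (\<forall>h\<in>T'. h x \<noteq> 0))"
    proof (induction T' rule: finite_induct)
      case empty
      obtain b where "b \<in> U" using U(3) by blast
      then have "\<exists>x\<in>U. (1::real) \<noteq> 0" by (intro bexI[of _ b]) simp_all
      then show ?case using real_analytic_on_const[OF U(1), of 1] by (intro exI[of _ "\<lambda>_. 1"]) simp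
    next
      case (insert h T')
      have h: "real_analytic_on h U" "\<exists>y\<in>U. h y \<noteq> 0"
        and "\<forall>h\<in>T'. real_analytic_on h U \<and> (\<exists>y\<in>U. h y \<noteq> 0)" using insert.prems by blast+
      from insert.IH[OF this(3)] obtain P x where P: "real_analytic_on P U" "x \<in> U" "P x \<noteq> 0"
        "\<And>x. x \<in> U \<Longrightarrow> P x \<noteq> 0 \<Longrightarrow> \<forall>h\<in>T'. h x \<noteq> 0" by blast
      have "\<exists>x\<in>U. P x * h x \<noteq> 0"
        using real_analytic_on_mult_eq_0[OF P(1) h(1) U(1,2) _ P(2,3)] h(2) by blast
      then show ?case using real_analytic_on_mult[OF P(1) h(1)] P(4)
        by (intro exI[of _ "\<lambda>x. P x * h x"]) simp
    qed
    then obtain P :: "real^'n \<Rightarrow> real" where P: "\<exists>x\<in>U. P x \<noteq> 0" "\<forall>x\<in>U. P x \<noteq> 0 \<longrightarrow> (\<forall>h\<in>T'. h x \<noteq> 0)" 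
      by blast
    then obtain x where "x \<in> U" "\<forall>h\<in>T'. h x \<noteq> 0" by (elim bexE) simp
    then show ?thesis by (intro bexI[of _ x]) (simp_all add: T'_def)
  qed
  have "\<exists>x. x \<in> U \<and> (finite T \<longrightarrow> (\<forall>h\<in>T. real_analytic_on h U \<longrightarrow> (\<exists>y\<in>U. h y \<noteq> 0) \<longrightarrow> h x \<noteq> 0))" for T
    using ex[of T] U(3) by (cases "finite T") blast+
  from someI_ex[OF this, of T] show "gen_pt U T \<in> U"
    "finite T \<Longrightarrow> h \<in> T \<Longrightarrow> real_analytic_on h U \<Longrightarrow> y \<in> U \<Longrightarrow> h y \<noteq> 0 \<Longrightarrow> h (gen_pt U T) \<noteq> 0"
    unfolding gen_pt_def[symmetric] by (simp, metis)
qed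

lemma ev_cong: "(\<And>x. x \<in> U \<Longrightarrow> f x = g x) \<Longrightarrow> ev U f = ev U g"
  unfolding ev_def using gen_pt_in by metis

lemma ev_restr: "ev U (restr U f) = ev U f"
  by (rule ev_cong) (simp add: restr_def)

text \<open>The function \<open>h\<close> is itself an index element: if it is nonzero somewhere on
  \<open>U\<close>, then for every finite \<open>T\<close> containing \<open>h\<close> the chosen
  point is not a zero of \<open>h\<close>.\<close>

lemma ev_eq_0_iff: "real_analytic_on h U \<Longrightarrow> ev U h = 0 \<longleftrightarrow> (\<forall>x\<in>U. h x = 0)"
proof
  assume h: "real_analytic_on h U" and "ev U h = 0"
  show "\<forall>x\<in>U. h x = 0"
  proof (rule ccontr)
    assume "\<not> (\<forall>x\<in>U. h x = 0)"
    then obtain y where "y \<in> U" "h y \<noteq> 0" by blast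
    then have "ev U h \<noteq> 0"
      unfolding ev_def using gen_pt_nonzero[OF _ _ h] by (intro of_fun_neq_0[of h]) blast
    then show False using \<open>ev U h = 0\<close> by simp
  qed
next
  assume "\<forall>x\<in>U. h x = 0"
  then have "ev U h = ev U (\<lambda>_. 0)" by (intro ev_cong) simp
  then show "ev U h = 0" by (simp add: ev_zero)
qed

end

section \<open>Nash functions and algebraicity\<close>

lemma poly_fun_sum: "finite I \<Longrightarrow> (\<And>i. i \<in> I \<Longrightarrow> poly_fun (f i)) \<Longrightarrow> poly_fun (\<lambda>x. \<Sum>i\<in>I. f i x)"
  by (induction I rule: finite_induct) (auto intro: pf_const pf_add)

lemma poly_fun_power: "poly_fun f \<Longrightarrow> poly_fun (\<lambda>x. f x ^ n)"
  by (induction n) (auto intro: pf_const pf_mult)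

lemma poly_fun_compose_Some: "poly_fun p \<Longrightarrow> poly_fun (\<lambda>z. p (\<lambda>i. z (Some i)))"
  by (induction rule: poly_fun.induct) (auto intro: poly_fun.intros)

text \<open>The polynomial is sorted by powers of the extra variable \<open>None\<close>. The degree
  of \<open>Q x\<close> may vary with \<open>x\<close>; the uniform bound \<open>N\<close> leaves
  finitely many coefficient functions.\<close>

lemma poly_fun_option_expand:
  fixes P :: "('v option \<Rightarrow> real) \<Rightarrow> real"
  assumes "poly_fun P"
  shows "\<exists>(Q :: ('v \<Rightarrow> real) \<Rightarrow> real poly) N. (\<forall>k. poly_fun (\<lambda>x. coeff (Q x) k)) \<and> (\<forall>x. degree (Q x) \<le> N)
    \<and> (\<forall>z. P z = poly (Q (\<lambda>i. z (Some i))) (z None))"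
  using assms
proof (induction rule: poly_fun.induct)
  case (pf_const c)
  show ?case
    by (intro exI[of _ "\<lambda>_. [:c:]"] exI[of _ 0]) (auto simp: poly_fun.pf_const)
next
  case (pf_var v)
  show ?case
  proof (cases v)
    case None
    then show ?thesis
      by (intro exI[of _ "\<lambda>_. [:0, 1:]"] exI[of _ 1]) (auto simp: poly_fun.pf_const)
  next
    case (Some i)
    have "poly_fun (\<lambda>x. coeff [:x i:] k)" for k
      by (cases k) (auto simp: poly_fun.pf_const poly_fun.pf_var)
    then show ?thesis using Some
      by (intro exI[of _ "\<lambda>x. [:x i:]"] exI[of _ 0]) auto
  qed
next
  case (pf_add p q)
  then obtain Q N R M where Q: "\<forall>k. poly_fun (\<lambda>x. coeff (Q x) k)" "\<forall>x. degree (Q x) \<le> N"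
      "\<forall>z. p z = poly (Q (\<lambda>i. z (Some i))) (z None)"
    and R: "\<forall>k. poly_fun (\<lambda>x. coeff (R x) k)" "\<forall>x. degree (R x) \<le> M"
      "\<forall>z. q z = poly (R (\<lambda>i. z (Some i))) (z None)" by blast
  have "degree (Q x + R x) \<le> N + M" for x
    using degree_add_le_max[of "Q x" "R x"] Q(2) R(2)
    by (meson add_increasing2 add_increasing le_add1 le_add2 max.bounded_iff order.trans)
  then show ?case using Q R
    by (intro exI[of _ "\<lambda>x. Q x + R x"] exI[of _ "N + M"]) (auto intro: poly_fun.pf_add)
next
  case (pf_mult p q)
  then obtain Q N R M where Q: "\<forall>k. poly_fun (\<lambda>x. coeff (Q x) k)" "\<forall>x. degree (Q x) \<le> N"
      "\<forall>z. p z = poly (Q (\<lambda>i. z (Some i))) (z None)"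
    and R: "\<forall>k. poly_fun (\<lambda>x. coeff (R x) k)" "\<forall>x. degree (R x) \<le> M"
      "\<forall>z. q z = poly (R (\<lambda>i. z (Some i))) (z None)" by blast
  have "degree (Q x * R x) \<le> N + M" for x
    using degree_mult_le[of "Q x" "R x"] Q(2) R(2) by (meson add_mono order.trans)
  moreover have "poly_fun (\<lambda>x. coeff (Q x * R x) k)" for k
    unfolding coeff_mult using Q(1) R(1) by (intro poly_fun_sum poly_fun.pf_mult) auto
  ultimately show ?case using Q R
    by (intro exI[of _ "\<lambda>x. Q x * R x"] exI[of _ "N + M"]) auto
qed

context
  fixes U :: "(real^'n) set"
  assumes U: "open U" "connected U" "U \<noteq> {}"
begin

text \<open>A polynomial function that is zero on a nonempty open set is zero everywhere, by the
  identity theorem on the whole space.\<close>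

lemma ev_poly_fun_eq_0:
  assumes p: "poly_fun p" and 0: "ev U (\<lambda>x. p (vec_nth x)) = 0"
  shows "p v = 0"
proof -
  have pU: "\<forall>x\<in>U. p (vec_nth x) = 0"
    using ev_eq_0_iff[OF U poly_fun_real_analytic[OF U(1) p]] 0 by simp
  obtain b where b: "b \<in> U" using U(3) by blast
  have "eventually (\<lambda>z. z \<in> U) (nhds b)" using U(1) b by (rule eventually_nhds_in_open)
  then have "eventually (\<lambda>z. p (vec_nth z) = 0) (nhds b)"
    by (rule eventually_mono) (use pU in blast)
  from real_analytic_on_identity[OF poly_fun_real_analytic[OF open_UNIV p] connected_UNIV UNIV_I this, of "\<chi> i. v i"]
  show ?thesis by (simp add: vec_lambda_inverse)
qed

text \<open>A polynomial relation between the coordinates and \<open>f\<close>, sorted by powers of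
  \<open>f\<close>, is a univariate relation over \<open>poly_evs U\<close>. Nontriviality is
  preserved both ways, because a polynomial function is zero exactly when its value at the generic
  point is.\<close>

lemma nash_on_iff_algebraic_over:
  assumes f: "real_analytic_on f U"
  shows "nash_on U f \<longleftrightarrow> algebraic_over (poly_evs U) (ev U f)"
proof
  assume "nash_on U f"
  then obtain P :: "('n option \<Rightarrow> real) \<Rightarrow> real" where P: "poly_fun P" "P \<noteq> (\<lambda>_. 0)"
    "\<And>x. x \<in> U \<Longrightarrow> P (ext_pt x (f x)) = 0" by (auto simp: nash_on_def)
  obtain Q :: "('n \<Rightarrow> real) \<Rightarrow> real poly" and N where Q: "\<And>k. poly_fun (\<lambda>x. coeff (Q x) k)"
    "\<And>x. degree (Q x) \<le> N" "\<And>z. P z = poly (Q (\<lambda>i. z (Some i))) (z None)"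
    using poly_fun_option_expand[OF P(1)] by blast
  define p where "p = (\<Sum>k\<le>N. monom (ev U (\<lambda>x. coeff (Q (vec_nth x)) k)) k)"
  have cp: "coeff p k = ev U (\<lambda>x. coeff (Q (vec_nth x)) k)" for k
  proof (cases "k \<le> N")
    case True
    then show ?thesis by (simp add: p_def coeff_sum if_distrib cong: if_cong)
  next
    case False
    then have "coeff (Q y) k = 0" for y using Q(2)[of y] by (intro coeff_eq_0) simp
    then show ?thesis using False by (simp add: p_def coeff_sum ev_zero)
  qed
  obtain z where z: "P z \<noteq> 0" using P(2) by blast
  then have "Q (\<lambda>i. z (Some i)) \<noteq> 0" using Q(3)[of z] by auto
  then obtain k where "coeff (Q (\<lambda>i. z (Some i))) k \<noteq> 0" by (metis leading_coeff_0_iff)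
  then have "coeff p k \<noteq> 0" unfolding cp using ev_poly_fun_eq_0[OF Q(1)[of k]] by blast
  moreover have "poly p (ev U f) = 0"
  proof -
    have "poly p (ev U f) = ev U (\<lambda>x. \<Sum>k\<le>N. coeff (Q (vec_nth x)) k * f x ^ k)"
      by (simp add: p_def poly_sum poly_monom ev_sum ev_mult ev_power)
    also have "\<dots> = ev U (\<lambda>_. 0)"
    proof (rule ev_cong[OF U])
      fix x assume "x \<in> U"
      have "(\<Sum>k\<le>N. coeff (Q (vec_nth x)) k * f x ^ k) = poly (Q (vec_nth x)) (f x)"
        by (subst (2) poly_as_sum_of_monoms'[OF Q(2), symmetric]) (simp add: poly_sum poly_monom)
      also have "\<dots> = P (ext_pt x (f x))" by (simp add: Q(3) ext_pt_def)
      finally show "(\<Sum>k\<le>N. coeff (Q (vec_nth x)) k * f x ^ k) = 0" using P(3) \<open>x \<in> U\<close> by simp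
    qed
    finally show ?thesis by (simp add: ev_zero)
  qed
  moreover have "coeff p k \<in> poly_evs U" for k unfolding cp by (rule poly_evsI) (rule Q(1))
  ultimately show "algebraic_over (poly_evs U) (ev U f)" unfolding algebraic_over_def by (metis coeff_0)
next
  assume "algebraic_over (poly_evs U) (ev U f)"
  then obtain p where p: "p \<noteq> 0" "\<And>n. coeff p n \<in> poly_evs U" "poly p (ev U f) = 0"
    unfolding algebraic_over_def by blast
  have "\<forall>k. \<exists>a. poly_fun a \<and> coeff p k = ev U (\<lambda>x. a (vec_nth x))"
    using p(2) by (simp add: poly_evs_def) metis
  then obtain a where a: "\<And>k. poly_fun (a k)" "\<And>k. coeff p k = ev U (\<lambda>x. a k (vec_nth x))"
    by metis
  define d where "d = degree p"
  define P :: "('n option \<Rightarrow> real) \<Rightarrow> real"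
    where "P z = (\<Sum>k\<le>d. a k (\<lambda>i. z (Some i)) * z None ^ k)" for z
  have "poly_fun P" unfolding P_def[abs_def]
    by (intro poly_fun_sum pf_mult poly_fun_power pf_var poly_fun_compose_Some a) auto
  moreover have "P \<noteq> (\<lambda>_. 0)"
  proof
    assume P0: "P = (\<lambda>_. 0)"
    \<comment> \<open>Freezing the coordinates at such a \<open>v\<close> leaves a univariate
      polynomial whose coefficient of degree \<open>d\<close> is nonzero, and it cannot vanish
      everywhere.\<close>
    have "\<exists>v. a d v \<noteq> 0"
    proof (rule ccontr)
      assume "\<nexists>v. a d v \<noteq> 0"
      then have "coeff p d = 0" using a(2)[of d] by (simp add: ev_zero)
      then show False using p(1) by (simp add: d_def)
    qed
    then obtain v where v: "a d v \<noteq> 0" by blast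
    define q where "q = (\<Sum>k\<le>d. monom (a k v) k)"
    have "poly q y = P (\<lambda>w. case w of None \<Rightarrow> y | Some i \<Rightarrow> v i)" for y
      by (simp add: q_def P_def poly_sum poly_monom)
    then have "q = 0" using P0 by (simp add: poly_all_0_iff_0[symmetric])
    moreover have "coeff q d = a d v" by (simp add: q_def coeff_sum if_distrib cong: if_cong)
    ultimately show False using v by simp
  qed
  \<comment> \<open>The left side is analytic in \<open>x\<close>, so vanishing at the generic point
    means vanishing on all of \<open>U\<close>.\<close>
  moreover have "P (ext_pt x (f x)) = 0" if x: "x \<in> U" for x
  proof -
    have Pe: "P (ext_pt x (f x)) = (\<Sum>k\<le>d. a k (vec_nth x) * f x ^ k)" for x
      by (simp add: P_def ext_pt_def)
    have "ev U (\<lambda>x. P (ext_pt x (f x))) = poly p (ev U f)"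
      unfolding Pe by (simp add: ev_sum ev_mult ev_power poly_altdef a(2) d_def)
    moreover have "real_analytic_on (\<lambda>x. P (ext_pt x (f x))) U" unfolding Pe
      by (intro real_analytic_on_sum real_analytic_on_mult real_analytic_on_power poly_fun_real_analytic U f a) auto
    ultimately show ?thesis using ev_eq_0_iff[OF U] p(3) x by auto
  qed
  ultimately show "nash_on U f" using f unfolding nash_on_def by blast
qed

text \<open>In this form closure under sums and products follows from the sum and product rules of
  derivations, with no annihilating polynomial to construct.\<close>

lemma nash_on_iff_derivation:
  "nash_on U f \<longleftrightarrow> real_analytic_on f U \<and> (\<forall>D. derivation_over (poly_evs U) D \<longrightarrow> D (ev U f) = 0)"
  using nash_on_iff_algebraic_over algebraic_over_iff_derivation[OF poly_evs_subring]
  by (metis nash_on_def)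

lemma nash_on_add: "nash_on U f \<Longrightarrow> nash_on U g \<Longrightarrow> nash_on U (\<lambda>x. f x + g x)"
  unfolding nash_on_iff_derivation
proof (intro conjI allI impI)
  assume f: "real_analytic_on f U \<and> (\<forall>D. derivation_over (poly_evs U) D \<longrightarrow> D (ev U f) = 0)"
    and g: "real_analytic_on g U \<and> (\<forall>D. derivation_over (poly_evs U) D \<longrightarrow> D (ev U g) = 0)"
  then show "real_analytic_on (\<lambda>x. f x + g x) U" by (simp add: real_analytic_on_add)
  fix D assume D: "derivation_over (poly_evs U) D"
  then have "D (ev U f) = 0" "D (ev U g) = 0" using f g by blast+
  then show "D (ev U (\<lambda>x. f x + g x)) = 0" by (simp add: ev_add derivation_over_add[OF D])
qed

lemma nash_on_mult: "nash_on U f \<Longrightarrow> nash_on U g \<Longrightarrow> nash_on U (\<lambda>x. f x * g x)"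
  unfolding nash_on_iff_derivation
proof (intro conjI allI impI)
  assume f: "real_analytic_on f U \<and> (\<forall>D. derivation_over (poly_evs U) D \<longrightarrow> D (ev U f) = 0)"
    and g: "real_analytic_on g U \<and> (\<forall>D. derivation_over (poly_evs U) D \<longrightarrow> D (ev U g) = 0)"
  then show "real_analytic_on (\<lambda>x. f x * g x) U" by (simp add: real_analytic_on_mult)
  fix D assume D: "derivation_over (poly_evs U) D"
  then have "D (ev U f) = 0" "D (ev U g) = 0" using f g by blast+
  then show "D (ev U (\<lambda>x. f x * g x)) = 0" by (simp add: ev_mult derivation_over_mult[OF D])
qed

lemma nash_on_poly_fun: "poly_fun p \<Longrightarrow> nash_on U (\<lambda>x. p (vec_nth x))"
  unfolding nash_on_iff_derivation using poly_evsI[of p U]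
  by (simp add: poly_fun_real_analytic U derivation_over_zero)

text \<open>For a polynomial \<open>p\<close> over the polynomial functions, \<open>h = p(f)\<close> and \<open>g = p'(f)\<close> are built simultaneously by
  Horner's scheme, so that any relation compatible with the Leibniz rule holds between them.\<close>

lemma nash_on_leibniz_induct:
  fixes R :: "(real^'n \<Rightarrow> real) \<Rightarrow> (real^'n \<Rightarrow> real) \<Rightarrow> bool"
  assumes f: "nash_on U f"
    and R_poly: "\<And>p. poly_fun p \<Longrightarrow> R (\<lambda>x. p (vec_nth x)) (\<lambda>_. 0)"
    and R_f: "R f (\<lambda>_. 1)"
    and R_add: "\<And>h w k v. R h w \<Longrightarrow> R k v \<Longrightarrow> R (\<lambda>x. h x + k x) (\<lambda>x. w x + v x)"
    and R_mult: "\<And>h w k v. R h w \<Longrightarrow> R k v \<Longrightarrow> R (\<lambda>x. h x * k x) (\<lambda>x. h x * v x + k x * w x)"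
  obtains h g where "R h g" "\<And>x. x \<in> U \<Longrightarrow> h x = 0" "nash_on U g" "\<exists>x\<in>U. g x \<noteq> 0"
proof -
  let ?\<phi> = "ev U f"
  have "algebraic_over (poly_evs U) ?\<phi>"
    using f nash_on_iff_algebraic_over nash_on_def by blast
  then obtain p where p: "\<forall>n. coeff p n \<in> poly_evs U" "poly p ?\<phi> = 0" "poly (pderiv p) ?\<phi> \<noteq> 0"
    using algebraic_over_separable[OF poly_evs_subring] by blast
  have "\<exists>h g. R h g \<and> nash_on U h \<and> nash_on U g \<and> ev U h = poly p ?\<phi> \<and> ev U g = poly (pderiv p) ?\<phi>"
    using p(1)
  proof (induction p)
    case 0
    show ?case
      using R_poly[OF pf_const[of 0]] nash_on_poly_fun[OF pf_const[of 0]]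
      by (intro exI[of _ "\<lambda>_. 0"]) (simp add: ev_zero)
  next
    case (pCons c p)
    have "c \<in> poly_evs U" "\<forall>n. coeff p n \<in> poly_evs U"
      using pCons.prems[rule_format, of 0] pCons.prems[rule_format, of "Suc _"] by simp_all
    then obtain q h g where q: "poly_fun q" "c = ev U (\<lambda>x. q (vec_nth x))"
      and h: "R h g" "nash_on U h" "nash_on U g" "ev U h = poly p ?\<phi>" "ev U g = poly (pderiv p) ?\<phi>"
      using pCons.IH unfolding poly_evs_def by blast
    have one: "nash_on U (\<lambda>_. 1)" and zero: "nash_on U (\<lambda>_. 0)"
      using nash_on_poly_fun[OF pf_const] by simp_all
    \<comment> \<open>Horner step \<open>q + f h\<close>, whose derivative with respect to
      \<open>f\<close> is \<open>f g + h\<close>; the shape \<open>0 + (f g + h 1)\<close> is what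
      the closure rules of \<open>R\<close> produce.\<close>
    have "R (\<lambda>x. q (vec_nth x) + f x * h x) (\<lambda>x. 0 + (f x * g x + h x * 1))"
      by (intro R_add R_mult R_poly R_f h q)
    moreover have "nash_on U (\<lambda>x. q (vec_nth x) + f x * h x)"
      by (intro nash_on_add nash_on_mult nash_on_poly_fun f h q)
    moreover have "nash_on U (\<lambda>x. 0 + (f x * g x + h x * 1))"
      by (intro nash_on_add nash_on_mult f h one zero)
    moreover have "ev U (\<lambda>x. q (vec_nth x) + f x * h x) = poly (pCons c p) ?\<phi>"
      by (simp add: ev_add ev_mult q h)
    moreover have "ev U (\<lambda>x. 0 + (f x * g x + h x * 1)) = poly (pderiv (pCons c p)) ?\<phi>"
      by (simp add: ev_add ev_mult h pderiv_pCons)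
    ultimately show ?case by blast
  qed
  then obtain h g where "R h g" "nash_on U h" "nash_on U g" "ev U h = 0" "ev U g \<noteq> 0"
    using p by auto
  then show ?thesis
    using that[of h g] ev_eq_0_iff[OF U] unfolding nash_on_def by blast
qed

end

section \<open>Calculus in modules of differentials\<close>

text \<open>The laws are confined to the carrier because the operations of \<open>loc_alg\<close>
  are unions over representatives, meaningful on classes only. By \<open>scl_eq_mul\<close>, scaling
  is multiplication by a multiple of \<open>one A\<close>.\<close>

locale real_algebra =
  fixes A :: "'a ralg"
  assumes zer_closed [simp]: "zer A \<in> carr A"
    and one_closed [simp]: "one A \<in> carr A"
    and add_closed [simp]: "a \<in> carr A \<Longrightarrow> b \<in> carr A \<Longrightarrow> add A a b \<in> carr A"
    and mul_closed [simp]: "a \<in> carr A \<Longrightarrow> b \<in> carr A \<Longrightarrow> mul A a b \<in> carr A"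
    and scl_closed [simp]: "a \<in> carr A \<Longrightarrow> scl A c a \<in> carr A"
    and add_assoc: "a \<in> carr A \<Longrightarrow> b \<in> carr A \<Longrightarrow> d \<in> carr A \<Longrightarrow> add A (add A a b) d = add A a (add A b d)"
    and add_comm: "a \<in> carr A \<Longrightarrow> b \<in> carr A \<Longrightarrow> add A a b = add A b a"
    and add_zer [simp]: "a \<in> carr A \<Longrightarrow> add A a (zer A) = a"
    and mul_assoc: "a \<in> carr A \<Longrightarrow> b \<in> carr A \<Longrightarrow> d \<in> carr A \<Longrightarrow> mul A (mul A a b) d = mul A a (mul A b d)"
    and mul_comm: "a \<in> carr A \<Longrightarrow> b \<in> carr A \<Longrightarrow> mul A a b = mul A b a"
    and mul_one [simp]: "a \<in> carr A \<Longrightarrow> mul A a (one A) = a"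
    and distrib: "a \<in> carr A \<Longrightarrow> b \<in> carr A \<Longrightarrow> d \<in> carr A \<Longrightarrow>
        mul A a (add A b d) = add A (mul A a b) (mul A a d)"
    and scl_eq_mul: "a \<in> carr A \<Longrightarrow> scl A c a = mul A (scl A c (one A)) a"
    and add_neg [simp]: "a \<in> carr A \<Longrightarrow> add A a (scl A (-1) a) = zer A"
begin

lemma zer_add [simp]: "a \<in> carr A \<Longrightarrow> add A (zer A) a = a"
  using add_comm[of "zer A" a] by simp

lemma one_mul [simp]: "a \<in> carr A \<Longrightarrow> mul A (one A) a = a"
  using mul_comm[of "one A" a] by simp

lemma add_left_comm:
  "a \<in> carr A \<Longrightarrow> b \<in> carr A \<Longrightarrow> d \<in> carr A \<Longrightarrow> add A a (add A b d) = add A b (add A a d)"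
  using add_assoc[of a b d] add_assoc[of b a d] add_comm[of a b] by simp

lemma distrib_right:
  "a \<in> carr A \<Longrightarrow> b \<in> carr A \<Longrightarrow> d \<in> carr A \<Longrightarrow> mul A (add A a b) d = add A (mul A a d) (mul A b d)"
  using distrib[of d a b] by (simp add: mul_comm[of d])

lemma add_left_cancel:
  assumes "a \<in> carr A" "b \<in> carr A" "d \<in> carr A" "add A a b = add A a d"
  shows "b = d"
proof -
  have "add A (add A (scl A (-1) a) a) b = add A (add A (scl A (-1) a) a) d"
    using assms by (simp add: add_assoc)
  then show ?thesis using assms add_comm[of "scl A (-1) a" a] by simp
qed

lemma mul_zer [simp]: "a \<in> carr A \<Longrightarrow> mul A a (zer A) = zer A"
  using add_left_cancel[of "mul A a (zer A)" "mul A a (zer A)" "zer A"] distrib[of a "zer A" "zer A"] by simp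

lemma zer_mul [simp]: "a \<in> carr A \<Longrightarrow> mul A (zer A) a = zer A"
  using mul_comm[of "zer A" a] by simp

text \<open>These are the elements of the free module. As \<open>kahler_eq\<close> is defined on all
  functions, its laws are stated for forms.\<close>

definition form :: "('a \<Rightarrow> 'a) \<Rightarrow> bool" where
  "form F \<longleftrightarrow> (\<forall>h. F h \<in> carr A) \<and> finite {h. F h \<noteq> zer A}"

lemma form_carr [simp]: "form F \<Longrightarrow> F h \<in> carr A"
  by (simp add: form_def)

lemma form_fz [simp]: "form (fz A)"
  by (simp add: form_def fz_def)

lemma form_fplus [simp]:
  assumes "form F" "form G" shows "form (fplus A F G)"
proof -
  have "{h. fplus A F G h \<noteq> zer A} \<subseteq> {h. F h \<noteq> zer A} \<union> {h. G h \<noteq> zer A}"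
    by (auto simp: fplus_def)
  then show ?thesis using assms unfolding form_def
    by (auto simp: fplus_def intro: finite_subset)
qed

lemma form_fmul [simp]:
  assumes "form F" "a \<in> carr A" shows "form (fmul A a F)"
proof -
  have "{h. fmul A a F h \<noteq> zer A} \<subseteq> {h. F h \<noteq> zer A}"
    using assms by (auto simp: fmul_def)
  then show ?thesis using assms unfolding form_def
    by (auto simp: fmul_def intro: finite_subset)
qed

lemma fscl_eq_fmul: "form F \<Longrightarrow> fscl A c F = fmul A (scl A c (one A)) F"
  unfolding fscl_def fmul_def by (intro ext scl_eq_mul) simp

lemma form_fscl [simp]: "form F \<Longrightarrow> form (fscl A c F)"
  by (simp add: fscl_eq_fmul)

lemma form_dsym [simp]: "form (dsym A h)"
proof -
  have "{k. dsym A h k \<noteq> zer A} \<subseteq> {h}" by (auto simp: dsym_def)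
  then show ?thesis by (auto simp: form_def dsym_def intro: finite_subset)
qed

lemma fplus_assoc: "form F \<Longrightarrow> form G \<Longrightarrow> form H \<Longrightarrow> fplus A (fplus A F G) H = fplus A F (fplus A G H)"
  and fplus_comm: "form F \<Longrightarrow> form G \<Longrightarrow> fplus A F G = fplus A G F"
  and fplus_left_comm: "form F \<Longrightarrow> form G \<Longrightarrow> form H \<Longrightarrow> fplus A F (fplus A G H) = fplus A G (fplus A F H)"
  and fplus_fz [simp]: "form F \<Longrightarrow> fplus A F (fz A) = F"
  and fz_fplus [simp]: "form F \<Longrightarrow> fplus A (fz A) F = F"
  and fplus_neg [simp]: "form F \<Longrightarrow> fplus A F (fscl A (-1) F) = fz A"
  by (simp_all add: fplus_def fz_def fscl_def add_assoc add_comm add_left_comm)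

lemma fmul_fplus: "form F \<Longrightarrow> form G \<Longrightarrow> a \<in> carr A \<Longrightarrow> fmul A a (fplus A F G) = fplus A (fmul A a F) (fmul A a G)"
  and fmul_fmul: "form F \<Longrightarrow> a \<in> carr A \<Longrightarrow> b \<in> carr A \<Longrightarrow> fmul A a (fmul A b F) = fmul A (mul A a b) F"
  and fmul_add: "form F \<Longrightarrow> a \<in> carr A \<Longrightarrow> b \<in> carr A \<Longrightarrow> fmul A (add A a b) F = fplus A (fmul A a F) (fmul A b F)"
  and fmul_one [simp]: "form F \<Longrightarrow> fmul A (one A) F = F"
  and fmul_zer [simp]: "form F \<Longrightarrow> fmul A (zer A) F = fz A"
  and fmul_fz [simp]: "a \<in> carr A \<Longrightarrow> fmul A a (fz A) = fz A"
  by (simp_all add: fplus_def fz_def fmul_def distrib distrib_right mul_assoc)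

section \<open>The submodule of relations and congruence modulo it\<close>

lemma kahler_gens_form: "r \<in> kahler_gens A \<Longrightarrow> form r"
  unfolding kahler_gens_def by auto

lemma kahler_rel_form: "F \<in> kahler_rel A \<Longrightarrow> form F"
  by (induction rule: kahler_rel.induct) (auto simp: kahler_gens_form)

lemma kahler_gens_rel: "r \<in> kahler_gens A \<Longrightarrow> r \<in> kahler_rel A"
  using kr_step[of r A "one A" "fz A"] kr_zero[of A] by (simp add: kahler_gens_form)

lemma kahler_rel_fplus: "F \<in> kahler_rel A \<Longrightarrow> G \<in> kahler_rel A \<Longrightarrow> fplus A F G \<in> kahler_rel A"
  by (induction rule: kahler_rel.induct)
    (auto simp: kahler_gens_form kahler_rel_form fplus_assoc intro: kr_step)

lemma kahler_rel_fmul: "F \<in> kahler_rel A \<Longrightarrow> b \<in> carr A \<Longrightarrow> fmul A b F \<in> kahler_rel A"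
  by (induction rule: kahler_rel.induct)
    (auto simp: kahler_gens_form kahler_rel_form fmul_fplus fmul_fmul intro: kr_step kr_zero)

lemma kahler_rel_fscl: "F \<in> kahler_rel A \<Longrightarrow> fscl A c F \<in> kahler_rel A"
  by (simp add: fscl_eq_fmul kahler_rel_form kahler_rel_fmul)

lemma kahler_eq_iff:
  assumes F: "form F" and G: "form G"
  shows "kahler_eq A F G \<longleftrightarrow> (\<exists>r\<in>kahler_rel A. F = fplus A G r)"
proof
  assume "kahler_eq A F G"
  moreover have "F = fplus A G (fplus A F (fscl A (-1) G))"
    using F G by (simp add: fplus_left_comm[of G])
  ultimately show "\<exists>r\<in>kahler_rel A. F = fplus A G r" unfolding kahler_eq_def by blast
next
  assume "\<exists>r\<in>kahler_rel A. F = fplus A G r"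
  then obtain r where r: "r \<in> kahler_rel A" "F = fplus A G r" by blast
  then have rf: "form r" by (simp add: kahler_rel_form)
  have "fplus A (fplus A G r) N = fplus A (fplus A G N) r" if "form N" for N
    using G rf that by (simp add: fplus_assoc fplus_comm[of r])
  then have "fplus A F (fscl A (-1) G) = fplus A (fplus A G (fscl A (-1) G)) r"
    using G r(2) by simp
  also have "\<dots> = r" using rf G by simp
  finally show "kahler_eq A F G" using r(1) by (simp add: kahler_eq_def)
qed

lemma kahler_eq_fplus_rel: "form G \<Longrightarrow> r \<in> kahler_rel A \<Longrightarrow> kahler_eq A (fplus A G r) G"
  using kahler_eq_iff[of "fplus A G r" G] kahler_rel_form[of r] by auto

lemma kahler_eq_refl: "form F \<Longrightarrow> kahler_eq A F F"
  by (simp add: kahler_eq_def kr_zero)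

lemma kahler_eq_trans:
  assumes "form F" "form G" "form H" "kahler_eq A F G" "kahler_eq A G H"
  shows "kahler_eq A F H"
proof -
  obtain r s where "r \<in> kahler_rel A" "F = fplus A G r" "s \<in> kahler_rel A" "G = fplus A H s"
    using assms kahler_eq_iff by metis
  then have "F = fplus A H (fplus A s r)" "fplus A s r \<in> kahler_rel A"
    using assms(3) by (auto simp: fplus_assoc kahler_rel_form kahler_rel_fplus)
  then show ?thesis using assms kahler_eq_iff by metis
qed

lemma kahler_eq_fplus:
  assumes "form F" "form G" "form F'" "form G'" "kahler_eq A F G" "kahler_eq A F' G'"
  shows "kahler_eq A (fplus A F F') (fplus A G G')"
proof -
  obtain r s where rs: "r \<in> kahler_rel A" "F = fplus A G r" "s \<in> kahler_rel A" "F' = fplus A G' s"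
    using assms kahler_eq_iff by metis
  then have "form r" "form s" by (simp_all add: kahler_rel_form)
  then have "fplus A F F' = fplus A (fplus A G G') (fplus A r s)"
    using assms(2,4) by (simp add: rs fplus_assoc fplus_left_comm[of r])
  moreover have "fplus A r s \<in> kahler_rel A" using rs by (simp add: kahler_rel_fplus)
  ultimately show ?thesis using assms(1-4) kahler_eq_fplus_rel[of "fplus A G G'" "fplus A r s"] by simp
qed

lemma kahler_eq_fmul:
  assumes "form F" "form G" "a \<in> carr A" "kahler_eq A F G"
  shows "kahler_eq A (fmul A a F) (fmul A a G)"
proof -
  obtain r where r: "r \<in> kahler_rel A" "F = fplus A G r"
    using assms kahler_eq_iff by metis
  then have "fmul A a F = fplus A (fmul A a G) (fmul A a r)"
    using assms by (simp add: fmul_fplus kahler_rel_form)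
  moreover have "fmul A a r \<in> kahler_rel A" using r assms by (simp add: kahler_rel_fmul)
  ultimately show ?thesis using assms kahler_eq_fplus_rel[of "fmul A a G" "fmul A a r"] by simp
qed

lemma kahler_eq_dsym_add:
  "h \<in> carr A \<Longrightarrow> k \<in> carr A \<Longrightarrow> kahler_eq A (dsym A (add A h k)) (fplus A (dsym A h) (dsym A k))"
  unfolding kahler_eq_def by (rule kahler_gens_rel) (unfold kahler_gens_def, blast)

lemma kahler_eq_dsym_scl: "l \<in> carr A \<Longrightarrow> kahler_eq A (dsym A (scl A c l)) (fscl A c (dsym A l))"
  unfolding kahler_eq_def by (rule kahler_gens_rel) (unfold kahler_gens_def, blast)

lemma kahler_eq_dsym_mul:
  "p \<in> carr A \<Longrightarrow> q \<in> carr A \<Longrightarrow>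
    kahler_eq A (dsym A (mul A p q)) (fplus A (fmul A p (dsym A q)) (fmul A q (dsym A p)))"
  unfolding kahler_eq_def by (rule kahler_gens_rel) (unfold kahler_gens_def, blast)

lemma kahler_eq_fz_iff: "form F \<Longrightarrow> kahler_eq A F (fz A) \<longleftrightarrow> F \<in> kahler_rel A"
  by (auto simp: kahler_eq_iff kahler_rel_form)

text \<open>Cancellation of \<open>G\<close>. With both forms equal to \<open>d1\<close> it derives
  \<open>d1 = 0\<close> from the Leibniz rule for \<open>1 * 1\<close>.\<close>

lemma kahler_eq_self_plus:
  assumes F: "form F" and G: "form G" and "kahler_eq A G (fplus A G F)"
  shows "F \<in> kahler_rel A"
proof -
  obtain r where r: "r \<in> kahler_rel A" "G = fplus A (fplus A G F) r"
    using assms kahler_eq_iff[of G "fplus A G F"] by auto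
  note rf = kahler_rel_form[OF r(1)]
  have "fz A = fplus A (fscl A (-1) G) G"
    using G fplus_comm[of G "fscl A (-1) G"] by simp
  also have "\<dots> = fplus A (fscl A (-1) G) (fplus A (fplus A G F) r)" using r(2) by simp
  also have "\<dots> = fplus A (fplus A G (fscl A (-1) G)) (fplus A F r)"
    using F G rf by (simp only: fplus_assoc fplus_left_comm[of "fscl A (-1) G"] form_fplus form_fscl)
  also have "\<dots> = fplus A F r" using F G rf by simp
  finally have "F = fscl A (-1) r"
    by (metis F rf fplus_assoc fplus_fz fplus_neg form_fscl fz_fplus)
  then show ?thesis using r(1) by (simp add: kahler_rel_fscl)
qed

lemma dsym_one_rel: "dsym A (one A) \<in> kahler_rel A"
  using kahler_eq_dsym_mul[of "one A" "one A"] by (intro kahler_eq_self_plus[of _ "dsym A (one A)"]) simp_all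

lemma dsym_scl_one_rel: "dsym A (scl A c (one A)) \<in> kahler_rel A"
proof -
  have "kahler_eq A (dsym A (scl A c (one A))) (fscl A c (dsym A (one A)))"
    by (rule kahler_eq_dsym_scl) simp
  then have "kahler_eq A (dsym A (scl A c (one A))) (fz A)"
    by (rule kahler_eq_trans[rotated -2]) (simp_all add: kahler_eq_fz_iff kahler_rel_fscl dsym_one_rel)
  then show ?thesis by (simp add: kahler_eq_fz_iff)
qed

subsection \<open>Linear combinations\<close>

text \<open>An arbitrary list in place of the fixed enumeration behind \<open>lin_comb\<close> makes
  induction possible.\<close>

definition lc :: "('i \<Rightarrow> 'a) \<Rightarrow> ('i \<Rightarrow> 'a) \<Rightarrow> 'i list \<Rightarrow> 'a \<Rightarrow> 'a" where
  "lc c xs is = fsum_list A (map (\<lambda>i. fmul A (c i) (dsym A (xs i))) is)"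

lemma lin_comb_eq_lc: "lin_comb A c xs = lc c xs idx_list"
  by (simp add: lin_comb_def lc_def)

lemma lc_simps [simp]: "lc c xs [] = fz A"
  "lc c xs (i # is) = fplus A (fmul A (c i) (dsym A (xs i))) (lc c xs is)"
  by (simp_all add: lc_def)

lemma form_lc [simp]: "(\<And>i. c i \<in> carr A) \<Longrightarrow> form (lc c xs is)"
  by (induction "is") auto

lemma lc_add:
  "(\<And>i. c i \<in> carr A) \<Longrightarrow> (\<And>i. d i \<in> carr A) \<Longrightarrow>
    lc (\<lambda>i. add A (c i) (d i)) xs is = fplus A (lc c xs is) (lc d xs is)"
  by (induction "is") (simp_all add: fmul_add fplus_assoc fplus_left_comm)

lemma lc_mul:
  "(\<And>i. c i \<in> carr A) \<Longrightarrow> a \<in> carr A \<Longrightarrow> lc (\<lambda>i. mul A a (c i)) xs is = fmul A a (lc c xs is)"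
  by (induction "is") (simp_all add: fmul_fplus fmul_fmul)

lemma lc_zer: "lc (\<lambda>_. zer A) xs is = fz A"
  by (induction "is") simp_all

lemma lc_delta:
  "distinct is \<Longrightarrow> lc (\<lambda>i. if i = j then one A else zer A) xs is = (if j \<in> set is then dsym A (xs j) else fz A)"
  by (induction "is") auto

lemma lin_comb_delta:
  "lin_comb A (\<lambda>i. if i = j then one A else zer A) xs = dsym A (xs j)"
proof -
  have "\<exists>ys. distinct ys \<and> set ys = (UNIV :: 'b set)"
    using finite_distinct_list[OF finite[of "UNIV :: 'b set"]] by blast
  then have "distinct (idx_list :: 'b list) \<and> set (idx_list :: 'b list) = UNIV"
    unfolding idx_list_def by (rule someI_ex)
  then show ?thesis by (simp add: lin_comb_eq_lc lc_delta)
qed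

subsection \<open>Derivations kill the relations\<close>

context
  fixes e :: "'a \<Rightarrow> 'k::field" and \<kappa> :: "real \<Rightarrow> 'k" and D :: "'k \<Rightarrow> 'k" and L :: "'k set"
  assumes e_add: "\<And>a b. a \<in> carr A \<Longrightarrow> b \<in> carr A \<Longrightarrow> e (add A a b) = e a + e b"
    and e_mul: "\<And>a b. a \<in> carr A \<Longrightarrow> b \<in> carr A \<Longrightarrow> e (mul A a b) = e a * e b"
    and e_scl: "\<And>a c. a \<in> carr A \<Longrightarrow> e (scl A c a) = \<kappa> c * e a"
    and e_zer: "e (zer A) = 0" and e_one: "e (one A) = 1"
    and D: "derivation_over L D" and \<kappa>: "\<And>c. \<kappa> c \<in> L"
begin

text \<open>Through \<open>e\<close> the field becomes a module over the algebra, and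
  \<open>D\<close> after \<open>e\<close> is a derivation into it. This is the induced linear map,
  sending \<open>a dh\<close> to \<open>e(a) D(e(h))\<close>.\<close>

definition deriv_functional :: "('a \<Rightarrow> 'a) \<Rightarrow> 'k" where
  "deriv_functional F = (\<Sum>h | F h \<noteq> zer A. e (F h) * D (e h))"

lemma deriv_functional_eq:
  "finite S \<Longrightarrow> {h. F h \<noteq> zer A} \<subseteq> S \<Longrightarrow> deriv_functional F = (\<Sum>h\<in>S. e (F h) * D (e h))"
  unfolding deriv_functional_def by (rule sum.mono_neutral_left) (auto simp: e_zer)

lemma deriv_functional_fplus:
  assumes F: "form F" and G: "form G"
  shows "deriv_functional (fplus A F G) = deriv_functional F + deriv_functional G"
proof -
  let ?S = "{h. F h \<noteq> zer A} \<union> {h. G h \<noteq> zer A}"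
  have S: "finite ?S" using F G by (simp add: form_def)
  have "deriv_functional (fplus A F G) = (\<Sum>h\<in>?S. e (fplus A F G h) * D (e h))"
    by (rule deriv_functional_eq[OF S]) (auto simp: fplus_def)
  also have "\<dots> = (\<Sum>h\<in>?S. e (F h) * D (e h)) + (\<Sum>h\<in>?S. e (G h) * D (e h))"
    using F G by (simp add: fplus_def e_add ring_distribs sum.distrib)
  also have "\<dots> = deriv_functional F + deriv_functional G"
    by (simp only: deriv_functional_eq[OF S Un_upper1] deriv_functional_eq[OF S Un_upper2])
  finally show ?thesis .
qed

lemma deriv_functional_fmul:
  assumes F: "form F" and a: "a \<in> carr A"
  shows "deriv_functional (fmul A a F) = e a * deriv_functional F"
proof -
  have "finite {h. F h \<noteq> zer A}" using F by (simp add: form_def)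
  then have "deriv_functional (fmul A a F) = (\<Sum>h | F h \<noteq> zer A. e (fmul A a F h) * D (e h))"
    by (rule deriv_functional_eq) (use a in \<open>auto simp: fmul_def\<close>)
  then show ?thesis
    using F a by (simp add: deriv_functional_def fmul_def e_mul sum_distrib_left mult.assoc)
qed

lemma deriv_functional_fscl: "form F \<Longrightarrow> deriv_functional (fscl A c F) = \<kappa> c * deriv_functional F"
  by (simp add: fscl_eq_fmul deriv_functional_fmul e_scl e_one)

lemma deriv_functional_dsym: "deriv_functional (dsym A h) = D (e h)"
  by (subst deriv_functional_eq[of "{h}"]) (auto simp: dsym_def e_one)

lemma deriv_functional_fz: "deriv_functional (fz A) = 0"
  by (simp add: deriv_functional_def fz_def)

text \<open>Only a scaling rule is known about \<open>\<kappa>\<close>; its value at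
  \<open>-1\<close> is recovered from \<open>1 + (-1) 1 = 0\<close> in the algebra.\<close>

lemma scalar_minus_one: "\<kappa> (- 1) = - 1"
proof -
  have "e (add A (one A) (scl A (- 1) (one A))) = 1 + \<kappa> (- 1)"
    by (simp only: e_add e_scl e_one one_closed scl_closed mult_1_right)
  then have "1 + \<kappa> (- 1) = 0" by (simp add: e_zer)
  then show ?thesis by (simp add: add_eq_0_iff)
qed

lemmas deriv_functional_simps = deriv_functional_fplus deriv_functional_fmul deriv_functional_fscl
  deriv_functional_dsym deriv_functional_fz

lemma deriv_functional_gens: "r \<in> kahler_gens A \<Longrightarrow> deriv_functional r = 0"
  unfolding kahler_gens_def
  by (auto simp: deriv_functional_simps e_add e_mul e_scl scalar_minus_one
      derivation_over_add[OF D] derivation_over_mult[OF D] derivation_over_zero[OF D \<kappa>])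

lemma deriv_functional_rel: "F \<in> kahler_rel A \<Longrightarrow> deriv_functional F = 0"
  by (induction rule: kahler_rel.induct)
    (simp_all add: deriv_functional_simps kahler_gens_form kahler_rel_form deriv_functional_gens)

text \<open>The functional turns the relation into \<open>e g * D (e f) = 0\<close>, as every
  \<open>d(xs i)\<close> goes to \<open>0\<close> whatever its coefficient. Arbitrary multiplier and
  coefficients let one argument serve conditions (2) and (4).\<close>

lemma derivation_eq_0_of_kahler_rel:
  assumes rel: "fmul A g (fplus A (dsym A f) (fscl A (-1) (lin_comb A c xs))) \<in> kahler_rel A"
    and g: "g \<in> carr A" "e g \<noteq> 0" and c: "\<And>i. c i \<in> carr A" and xs: "\<And>i. D (e (xs i)) = 0"
  shows "D (e f) = 0"
proof -
  have "deriv_functional (lc c xs is) = 0" for "is"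
    by (induction "is") (simp_all add: deriv_functional_simps c xs)
  then have "e g * D (e f) = 0"
    using deriv_functional_rel[OF rel] g c by (simp add: deriv_functional_simps lin_comb_eq_lc)
  then show ?thesis using g by simp
qed

end

end

section \<open>Differentials of Nash functions\<close>

text \<open>Two instances are intended: the smooth functions with the identity and the localization
  with \<open>loc_emb\<close>. The Leibniz computation is thereby done once for both modules of
  differentials.\<close>

locale smooth_embedding = real_algebra A for A :: "'a ralg" +
  fixes U :: "(real^'n) set" and j :: "(real^'n \<Rightarrow> real) \<Rightarrow> 'a"
  assumes U: "open U"
    and j_closed: "h \<in> carr (E_alg U) \<Longrightarrow> j h \<in> carr A"
    and j_add: "h \<in> carr (E_alg U) \<Longrightarrow> k \<in> carr (E_alg U) \<Longrightarrow> j (\<lambda>x. h x + k x) = add A (j h) (j k)"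
    and j_mul: "h \<in> carr (E_alg U) \<Longrightarrow> k \<in> carr (E_alg U) \<Longrightarrow> j (\<lambda>x. h x * k x) = mul A (j h) (j k)"
    and j_scl: "h \<in> carr (E_alg U) \<Longrightarrow> j (\<lambda>x. c * h x) = scl A c (j h)"
    and j_one: "j (restr U (\<lambda>x. 1)) = one A"
begin

abbreviation J :: "(real^'n \<Rightarrow> real) \<Rightarrow> 'a" where
  "J h \<equiv> j (restr U h)"

lemma smooth_const [simp]: "smooth_on U (\<lambda>_. c)"
  by (intro real_analytic_on_imp_smooth_on real_analytic_on_const U)

lemma smooth_coord [simp]: "smooth_on U (\<lambda>x. x $ i)"
  by (intro real_analytic_on_imp_smooth_on real_analytic_on_coord U)

lemma J_closed [simp]: "smooth_on U h \<Longrightarrow> J h \<in> carr A"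
  by (intro j_closed restr_carr U)

lemma J_cong: "(\<And>x. x \<in> U \<Longrightarrow> h x = k x) \<Longrightarrow> J h = J k"
  by (rule arg_cong[of _ _ j]) (auto simp: restr_def)

lemma J_add:
  assumes "smooth_on U h" "smooth_on U k"
  shows "J (\<lambda>x. h x + k x) = add A (J h) (J k)"
proof -
  have "restr U (\<lambda>x. h x + k x) = (\<lambda>x. restr U h x + restr U k x)" by (auto simp: restr_def)
  then show ?thesis using assms by (simp add: j_add restr_carr U)
qed

lemma J_mul:
  assumes "smooth_on U h" "smooth_on U k"
  shows "J (\<lambda>x. h x * k x) = mul A (J h) (J k)"
proof -
  have "restr U (\<lambda>x. h x * k x) = (\<lambda>x. restr U h x * restr U k x)" by (auto simp: restr_def)
  then show ?thesis using assms by (simp add: j_mul restr_carr U)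
qed

lemma J_const: "J (\<lambda>_. c) = scl A c (one A)"
proof -
  have "restr U (\<lambda>_. c) = (\<lambda>x. c * restr U (\<lambda>_. 1) x)" by (auto simp: restr_def)
  then show ?thesis by (simp add: j_scl restr_carr U j_one)
qed

lemma J_zero: "J (\<lambda>_. 0) = zer A"
  using J_add[of "\<lambda>_. 0" "\<lambda>_. 0"] add_left_cancel[of "J (\<lambda>_. 0)" "J (\<lambda>_. 0)" "zer A"] by simp

definition DL :: "(real^'n \<Rightarrow> real) \<Rightarrow> 'a \<Rightarrow> 'a" where
  "DL h = lin_comb A (\<lambda>i. J (partial i h)) (\<lambda>i. J (\<lambda>x. x $ i))"

definition omega :: "(real^'n \<Rightarrow> real) \<Rightarrow> 'a \<Rightarrow> 'a" where
  "omega f = fplus A (dsym A (J f)) (fscl A (-1) (DL f))"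

lemma form_DL [simp]: "smooth_on U h \<Longrightarrow> form (DL h)"
  unfolding DL_def lin_comb_eq_lc by (intro form_lc J_closed smooth_on_partial)

lemma form_omega [simp]: "smooth_on U f \<Longrightarrow> form (omega f)"
  by (simp add: omega_def)

text \<open>Partial derivatives need to be known on \<open>U\<close> alone, because \<open>J\<close>
  cuts off all values outside.\<close>

lemma DL_eq_lc:
  assumes "\<And>i x. x \<in> U \<Longrightarrow> partial i h x = c i x"
  shows "DL h = lc (\<lambda>i. J (c i)) (\<lambda>i. J (\<lambda>x. x $ i)) idx_list"
  unfolding DL_def lin_comb_eq_lc using assms by (metis J_cong)

lemma DL_add:
  assumes h: "smooth_on U h" and k: "smooth_on U k"
  shows "DL (\<lambda>x. h x + k x) = fplus A (DL h) (DL k)"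
proof -
  have "DL (\<lambda>x. h x + k x)
      = lc (\<lambda>i. J (\<lambda>x. partial i h x + partial i k x)) (\<lambda>i. J (\<lambda>x. x $ i)) idx_list"
    by (rule DL_eq_lc) (intro partial_add smooth_on_differentiable[OF h] smooth_on_differentiable[OF k])
  then show ?thesis using h k
    by (simp add: J_add smooth_on_partial lc_add DL_def lin_comb_eq_lc)
qed

lemma DL_mult:
  assumes h: "smooth_on U h" and k: "smooth_on U k"
  shows "DL (\<lambda>x. h x * k x) = fplus A (fmul A (J h) (DL k)) (fmul A (J k) (DL h))"
proof -
  have "DL (\<lambda>x. h x * k x)
      = lc (\<lambda>i. J (\<lambda>x. h x * partial i k x + k x * partial i h x)) (\<lambda>i. J (\<lambda>x. x $ i)) idx_list"
    by (rule DL_eq_lc) (intro partial_mult smooth_on_differentiable[OF h] smooth_on_differentiable[OF k])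
  then show ?thesis using h k
    by (simp add: J_add J_mul smooth_on_partial smooth_on_mult[OF U] lc_add lc_mul DL_def lin_comb_eq_lc)
qed

lemma DL_const_on:
  assumes "\<And>x. x \<in> U \<Longrightarrow> h x = c"
  shows "DL h = fz A"
proof -
  have "DL h = lc (\<lambda>i. J (\<lambda>_. 0)) (\<lambda>i. J (\<lambda>x. x $ i)) idx_list"
    by (rule DL_eq_lc) (simp add: partial_cong[OF U _ assms] partial_const)
  then show ?thesis by (simp add: J_zero lc_zer)
qed

lemma DL_coord: "DL (\<lambda>x. x $ i) = dsym A (J (\<lambda>x. x $ i))"
proof -
  have "DL (\<lambda>x. x $ i) = lc (\<lambda>k. J (\<lambda>_. if k = i then 1 else 0)) (\<lambda>i. J (\<lambda>x. x $ i)) idx_list"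
    by (rule DL_eq_lc) (rule partial_coord)
  also have "(\<lambda>k. J (\<lambda>_. if k = i then 1 else 0)) = (\<lambda>k. if k = i then one A else zer A)"
    by (auto simp: j_one J_zero)
  finally show ?thesis using lin_comb_delta[of i "\<lambda>i. J (\<lambda>x. x $ i)"] by (simp add: lin_comb_eq_lc)
qed

text \<open>For an expression \<open>h\<close> in the coordinates and \<open>f\<close>,
  \<open>w\<close> acts as its derivative with respect to \<open>f\<close>: the defect
  \<open>dh - DL h\<close> is \<open>w\<close> times the defect \<open>omega f\<close>.\<close>

definition leibniz_rel :: "(real^'n \<Rightarrow> real) \<Rightarrow> (real^'n \<Rightarrow> real) \<Rightarrow> (real^'n \<Rightarrow> real) \<Rightarrow> bool" where
  "leibniz_rel f h w \<longleftrightarrow> smooth_on U h \<and> smooth_on U w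
     \<and> kahler_eq A (dsym A (J h)) (fplus A (DL h) (fmul A (J w) (omega f)))"

context
  fixes f :: "real^'n \<Rightarrow> real"
  assumes f: "smooth_on U f"
begin

lemma leibniz_rel_self: "leibniz_rel f f (\<lambda>_. 1)"
proof -
  have "fplus A (DL f) (fmul A (J (\<lambda>_. 1)) (omega f)) = dsym A (J f)"
    using f by (simp add: j_one omega_def fplus_left_comm[of "DL f"])
  then show ?thesis using f by (simp add: leibniz_rel_def kahler_eq_refl)
qed

lemma leibniz_rel_add:
  assumes "leibniz_rel f h w" "leibniz_rel f k v"
  shows "leibniz_rel f (\<lambda>x. h x + k x) (\<lambda>x. w x + v x)"
proof -
  have s: "smooth_on U h" "smooth_on U w" "smooth_on U k" "smooth_on U v"
    and e: "kahler_eq A (dsym A (J h)) (fplus A (DL h) (fmul A (J w) (omega f)))"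
      "kahler_eq A (dsym A (J k)) (fplus A (DL k) (fmul A (J v) (omega f)))"
    using assms by (auto simp: leibniz_rel_def)
  have "kahler_eq A (dsym A (add A (J h) (J k)))
     (fplus A (fplus A (DL h) (fmul A (J w) (omega f))) (fplus A (DL k) (fmul A (J v) (omega f))))"
    by (rule kahler_eq_trans[OF _ _ _ kahler_eq_dsym_add kahler_eq_fplus[OF _ _ _ _ e]]) (simp_all add: s f)
  also have "fplus A (fplus A (DL h) (fmul A (J w) (omega f))) (fplus A (DL k) (fmul A (J v) (omega f)))
     = fplus A (fplus A (DL h) (DL k)) (fmul A (add A (J w) (J v)) (omega f))"
    by (simp add: s f fmul_add fplus_assoc fplus_left_comm[of "fmul A (J w) (omega f)"])
  finally show ?thesis
    by (simp add: leibniz_rel_def s smooth_on_add[OF U] J_add DL_add)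
qed

lemma leibniz_rel_mult:
  assumes "leibniz_rel f h w" "leibniz_rel f k v"
  shows "leibniz_rel f (\<lambda>x. h x * k x) (\<lambda>x. h x * v x + k x * w x)"
proof -
  have s: "smooth_on U h" "smooth_on U w" "smooth_on U k" "smooth_on U v"
    and e: "kahler_eq A (dsym A (J h)) (fplus A (DL h) (fmul A (J w) (omega f)))"
      "kahler_eq A (dsym A (J k)) (fplus A (DL k) (fmul A (J v) (omega f)))"
    using assms by (auto simp: leibniz_rel_def)
  have "kahler_eq A (dsym A (mul A (J h) (J k)))
     (fplus A (fmul A (J h) (fplus A (DL k) (fmul A (J v) (omega f))))
       (fmul A (J k) (fplus A (DL h) (fmul A (J w) (omega f)))))"
    by (rule kahler_eq_trans[OF _ _ _ kahler_eq_dsym_mul kahler_eq_fplus[OF _ _ _ _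
            kahler_eq_fmul[OF _ _ _ e(2)] kahler_eq_fmul[OF _ _ _ e(1)]]])
      (simp_all add: s f)
  also have "fplus A (fmul A (J h) (fplus A (DL k) (fmul A (J v) (omega f))))
       (fmul A (J k) (fplus A (DL h) (fmul A (J w) (omega f))))
     = fplus A (fplus A (fmul A (J h) (DL k)) (fmul A (J k) (DL h)))
        (fmul A (add A (mul A (J h) (J v)) (mul A (J k) (J w))) (omega f))"
    by (simp add: s f fmul_add fmul_fplus fmul_fmul fplus_assoc
        fplus_left_comm[of "fmul A (mul A (J h) (J v)) (omega f)"])
  finally show ?thesis
    by (simp add: leibniz_rel_def s smooth_on_add[OF U] smooth_on_mult[OF U] J_add J_mul DL_mult)
qed

lemma leibniz_rel_poly: "poly_fun p \<Longrightarrow> leibniz_rel f (\<lambda>x. p (vec_nth x)) (\<lambda>_. 0)"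
proof (induction rule: poly_fun.induct)
  case (pf_const c)
  have "kahler_eq A (dsym A (J (\<lambda>_. c))) (fz A)"
    by (simp add: J_const kahler_eq_fz_iff dsym_scl_one_rel)
  then show ?case by (simp add: leibniz_rel_def J_zero f DL_const_on[of "\<lambda>_. c" c])
next
  case (pf_var v)
  show ?case by (simp add: leibniz_rel_def J_zero f DL_coord kahler_eq_refl)
next
  case (pf_add p q)
  then show ?case using leibniz_rel_add[OF pf_add.IH] by simp
next
  case (pf_mult p q)
  then show ?case using leibniz_rel_mult[OF pf_mult.IH] by simp
qed

text \<open>When \<open>h\<close> vanishes on \<open>U\<close>, both \<open>DL h\<close> and
  \<open>dh\<close> are zero modulo relations, and only \<open>w\<close> times the defect of
  \<open>f\<close> is left.\<close>

lemma leibniz_rel_zero: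
  assumes hw: "leibniz_rel f h w" and h: "\<And>x. x \<in> U \<Longrightarrow> h x = 0"
  shows "fmul A (J w) (omega f) \<in> kahler_rel A"
proof -
  have w: "smooth_on U w" using hw by (simp add: leibniz_rel_def)
  have "J h = J (\<lambda>_. 0)" using h by (rule J_cong)
  then have "kahler_eq A (dsym A (J (\<lambda>_. 0))) (fmul A (J w) (omega f))"
    using hw w f by (simp add: leibniz_rel_def DL_const_on[of h 0] h)
  then obtain r where r: "r \<in> kahler_rel A" "dsym A (J (\<lambda>_. 0)) = fplus A (fmul A (J w) (omega f)) r"
    using kahler_eq_iff w f by auto
  then have "fmul A (J w) (omega f) = fplus A (dsym A (J (\<lambda>_. 0))) (fscl A (-1) r)"
    using w f by (simp add: kahler_rel_form fplus_assoc)
  moreover have "dsym A (J (\<lambda>_. 0)) \<in> kahler_rel A"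
    unfolding J_const by (rule dsym_scl_one_rel)
  ultimately show ?thesis
    using r(1) by (simp add: kahler_rel_fplus kahler_rel_fscl)
qed

end

theorem nash_on_imp_kahler_rel:
  assumes conn: "connected U" "U \<noteq> {}" and f: "nash_on U f"
  shows "\<exists>g\<in>nash_S U. fmul A (j g) (omega f) \<in> kahler_rel A"
proof -
  have sf: "smooth_on U f"
    using f by (auto simp: nash_on_def intro: real_analytic_on_imp_smooth_on)
  \<comment> \<open>\<open>leibniz_rel f\<close> has the closure properties required of
    \<open>R\<close> in the Horner induction; \<open>h\<close> plays \<open>p(f)\<close> and
    \<open>g\<close> plays \<open>p'(f)\<close>.\<close>
  obtain h g where hg: "leibniz_rel f h g" "\<And>x. x \<in> U \<Longrightarrow> h x = 0" "nash_on U g" "\<exists>x\<in>U. g x \<noteq> 0"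
    by (rule nash_on_leibniz_induct[OF U conn f, of "leibniz_rel f"])
      (use leibniz_rel_poly[OF sf] leibniz_rel_self[OF sf] leibniz_rel_add[OF sf] leibniz_rel_mult[OF sf] in blast)+
  have "restr U g \<in> nash_S U"
    unfolding nash_S_iff[OF U] using hg(3,4) nash_on_cong[of U "restr U g" g] by (auto simp: restr_def)
  then show ?thesis using leibniz_rel_zero[OF sf hg(1,2)] by blast
qed

end

section \<open>The localized algebra\<close>

context
  fixes U :: "(real^'n) set"
  assumes U: "open U" "connected U" "U \<noteq> {}"
begin

lemma E_alg_closed:
  shows E_zero: "(\<lambda>x. 0) \<in> carr (E_alg U)"
    and E_one: "restr U (\<lambda>x. 1) \<in> carr (E_alg U)"
    and E_add: "f \<in> carr (E_alg U) \<Longrightarrow> g \<in> carr (E_alg U) \<Longrightarrow> (\<lambda>x. f x + g x) \<in> carr (E_alg U)"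
    and E_mul: "f \<in> carr (E_alg U) \<Longrightarrow> g \<in> carr (E_alg U) \<Longrightarrow> (\<lambda>x. f x * g x) \<in> carr (E_alg U)"
    and E_scl: "f \<in> carr (E_alg U) \<Longrightarrow> (\<lambda>x. c * f x) \<in> carr (E_alg U)"
proof -
  have c: "smooth_on U (\<lambda>_. c)" for c
    by (intro real_analytic_on_imp_smooth_on real_analytic_on_const U)
  show "(\<lambda>x. 0) \<in> carr (E_alg U)" "restr U (\<lambda>x. 1) \<in> carr (E_alg U)"
    using c restr_carr[OF U(1) c] by (simp_all add: E_alg_carr_iff)
  show "f \<in> carr (E_alg U) \<Longrightarrow> g \<in> carr (E_alg U) \<Longrightarrow> (\<lambda>x. f x + g x) \<in> carr (E_alg U)"
    "f \<in> carr (E_alg U) \<Longrightarrow> g \<in> carr (E_alg U) \<Longrightarrow> (\<lambda>x. f x * g x) \<in> carr (E_alg U)"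
    "f \<in> carr (E_alg U) \<Longrightarrow> (\<lambda>x. c * f x) \<in> carr (E_alg U)"
    using c by (simp_all add: E_alg_carr_iff smooth_on_add smooth_on_mult U)
qed

lemma E_outside: "f \<in> carr (E_alg U) \<Longrightarrow> x \<notin> U \<Longrightarrow> f x = 0"
  by (simp add: E_alg_carr_iff)

lemma E_one_mult: "f \<in> carr (E_alg U) \<Longrightarrow> restr U (\<lambda>x. 1) x * f x = f x"
  and E_mult_one: "f \<in> carr (E_alg U) \<Longrightarrow> f x * restr U (\<lambda>x. 1) x = f x"
  by (cases "x \<in> U"; simp add: restr_def E_outside)+

lemma real_algebra_E_alg: "real_algebra (E_alg U)"
proof
  fix a assume a: "a \<in> carr (E_alg U)"
  show "mul (E_alg U) a (one (E_alg U)) = a" by (simp only: E_alg_simps E_mult_one[OF a])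
  fix c show "scl (E_alg U) c a = mul (E_alg U) (scl (E_alg U) c (one (E_alg U))) a"
    by (simp only: E_alg_simps mult.assoc E_one_mult[OF a])
qed (simp_all add: E_alg_closed algebra_simps)

lemma nash_S_carr: "s \<in> nash_S U \<Longrightarrow> s \<in> carr (E_alg U)"
  by (simp add: nash_S_def)

text \<open>The product is not identically zero because both factors have nonzero values in the
  ultrapower, which is a field.\<close>

lemma nash_S_mult:
  assumes "s \<in> nash_S U" "t \<in> nash_S U"
  shows "(\<lambda>x. s x * t x) \<in> nash_S U"
proof -
  have s: "nash_on U s" "\<forall>x. x \<notin> U \<longrightarrow> s x = 0" "\<exists>x\<in>U. s x \<noteq> 0"
    and t: "nash_on U t" "\<exists>x\<in>U. t x \<noteq> 0"
    using assms unfolding nash_S_iff[OF U(1)] by blast+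
  have "ev U s \<noteq> 0" "ev U t \<noteq> 0"
    using s t ev_eq_0_iff[OF U] unfolding nash_on_def by blast+
  then have "ev U (\<lambda>x. s x * t x) \<noteq> 0" by (simp add: ev_mult)
  moreover have n: "nash_on U (\<lambda>x. s x * t x)" by (rule nash_on_mult[OF U s(1) t(1)])
  ultimately have "\<exists>x\<in>U. s x * t x \<noteq> 0"
    using ev_eq_0_iff[OF U, of "\<lambda>x. s x * t x"] unfolding nash_on_def by blast
  then show ?thesis using n s unfolding nash_S_iff[OF U(1)] by auto
qed

lemma nash_S_one: "restr U (\<lambda>x. 1) \<in> nash_S U"
proof -
  have "nash_on U (\<lambda>x. 1)" by (rule nash_on_poly_fun[OF U pf_const])
  then have "nash_on U (restr U (\<lambda>x. 1))"
    using nash_on_cong[of U "restr U (\<lambda>x. 1)" "\<lambda>x. 1"] by (simp add: restr_in)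
  then show ?thesis using U(3) unfolding nash_S_iff[OF U(1)] by (auto simp: restr_def)
qed

section \<open>Fractions, their equivalence and the operations on classes\<close>

definition is_frac :: "(real^'n \<Rightarrow> real) \<times> (real^'n \<Rightarrow> real) \<Rightarrow> bool" where
  "is_frac p \<longleftrightarrow> fst p \<in> carr (E_alg U) \<and> snd p \<in> nash_S U"

lemma loc_cls_eq_Collect: "loc_cls U p = {q. is_frac q \<and> loc_rel U p q}"
  by (auto simp: loc_cls_def is_frac_def)

lemma loc_relI: "(\<And>x. fst p x * snd q x = fst q x * snd p x) \<Longrightarrow> loc_rel U p q"
  unfolding loc_rel_def using nash_S_one by (intro bexI[of _ "restr U (\<lambda>x. 1)"]) simp_all

lemma loc_rel_sym: "loc_rel U p q \<Longrightarrow> loc_rel U q p"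
proof -
  assume "loc_rel U p q"
  then obtain u where u: "u \<in> nash_S U" "\<And>x. u x * (fst p x * snd q x - fst q x * snd p x) = 0"
    unfolding loc_rel_def by blast
  have "u x * (fst q x * snd p x - fst p x * snd q x) = 0" for x
    using u(2)[of x] by auto
  then show "loc_rel U q p" unfolding loc_rel_def using u(1) by blast
qed

lemma loc_rel_trans:
  assumes "loc_rel U p q" "loc_rel U q r" and q: "is_frac q"
  shows "loc_rel U p r"
proof -
  obtain u where u: "u \<in> nash_S U" "\<And>x. u x * (fst p x * snd q x - fst q x * snd p x) = 0"
    using assms(1) unfolding loc_rel_def by blast
  obtain v where v: "v \<in> nash_S U" "\<And>x. v x * (fst q x * snd r x - fst r x * snd q x) = 0"
    using assms(2) unfolding loc_rel_def by blast
  \<comment> \<open>The denominator of the middle fraction cannot be divided out, so it joins the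
    multiplier; as \<open>q\<close> is a fraction, it lies in \<open>nash_S U\<close>.\<close>
  let ?w = "\<lambda>x. (u x * v x) * snd q x"
  have "?w x * (fst p x * snd r x - fst r x * snd p x) = 0" for x
  proof -
    have "?w x * (fst p x * snd r x - fst r x * snd p x)
      = (v x * snd r x) * (u x * (fst p x * snd q x - fst q x * snd p x))
        + (u x * snd p x) * (v x * (fst q x * snd r x - fst r x * snd q x))"
      by (simp add: algebra_simps)
    then show ?thesis by (simp only: u v mult_zero_right add_0)
  qed
  moreover have "?w \<in> nash_S U"
    using u v q by (intro nash_S_mult) (auto simp: is_frac_def)
  ultimately show ?thesis unfolding loc_rel_def by (intro bexI[of _ ?w]) blast+
qed

lemma loc_cls_self: "is_frac p \<Longrightarrow> p \<in> loc_cls U p"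
  by (simp add: loc_cls_eq_Collect loc_relI)

lemma loc_cls_eqI: "is_frac p \<Longrightarrow> is_frac q \<Longrightarrow> loc_rel U p q \<Longrightarrow> loc_cls U p = loc_cls U q"
  unfolding loc_cls_eq_Collect using loc_rel_trans loc_rel_sym by blast

text \<open>The operations of \<open>loc_alg\<close> are unions over all choices of representatives;
  compatibility with \<open>loc_rel\<close> makes the united classes coincide.\<close>

lemma loc_cls_Union:
  assumes p: "is_frac p" and q: "is_frac q"
    and closed: "\<And>p q. is_frac p \<Longrightarrow> is_frac q \<Longrightarrow> is_frac (\<phi> p q)"
    and cong: "\<And>p q p' q'. is_frac p \<Longrightarrow> is_frac q \<Longrightarrow> is_frac p' \<Longrightarrow> is_frac q' \<Longrightarrow>
      loc_rel U p p' \<Longrightarrow> loc_rel U q q' \<Longrightarrow> loc_rel U (\<phi> p q) (\<phi> p' q')"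
  shows "\<Union>{loc_cls U (\<phi> p' q') | p' q'. p' \<in> loc_cls U p \<and> q' \<in> loc_cls U q} = loc_cls U (\<phi> p q)"
proof -
  have "loc_cls U (\<phi> p' q') = loc_cls U (\<phi> p q)" if "p' \<in> loc_cls U p" "q' \<in> loc_cls U q" for p' q'
    using that p q by (intro loc_cls_eqI closed cong) (auto simp: loc_cls_eq_Collect loc_rel_sym)
  then have "{loc_cls U (\<phi> p' q') | p' q'. p' \<in> loc_cls U p \<and> q' \<in> loc_cls U q} = {loc_cls U (\<phi> p q)}"
    using loc_cls_self[OF p] loc_cls_self[OF q] by blast
  then show ?thesis by simp
qed

abbreviation fadd where "fadd p q \<equiv> (\<lambda>x. fst p x * snd q x + fst q x * snd p x, \<lambda>x. snd p x * snd q x)"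
abbreviation fmult where "fmult p q \<equiv> (\<lambda>x. fst p x * fst q x, \<lambda>x. snd p x * snd q x)"

lemma is_frac_fadd: "is_frac p \<Longrightarrow> is_frac q \<Longrightarrow> is_frac (fadd p q)"
  and is_frac_fmult: "is_frac p \<Longrightarrow> is_frac q \<Longrightarrow> is_frac (fmult p q)"
  and is_frac_scale: "is_frac p \<Longrightarrow> is_frac (\<lambda>x. c * fst p x, snd p)"
  by (simp_all add: is_frac_def E_add E_mul E_scl nash_S_mult nash_S_carr)

lemma is_frac_zero: "is_frac (\<lambda>x. 0, restr U (\<lambda>x. 1))"
  and is_frac_one: "is_frac (restr U (\<lambda>x. 1), restr U (\<lambda>x. 1))"
  and is_frac_emb: "h \<in> carr (E_alg U) \<Longrightarrow> is_frac (h, restr U (\<lambda>x. 1))"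
  by (simp_all add: is_frac_def E_alg_closed nash_S_one)

lemma loc_alg_carr: "carr (loc_alg U) = {loc_cls U p | p. is_frac p}"
  by (auto simp: loc_alg_def is_frac_def)

lemma loc_rel_fadd:
  assumes "loc_rel U p p'" "loc_rel U q q'"
  shows "loc_rel U (fadd p q) (fadd p' q')"
proof -
  obtain u where u: "u \<in> nash_S U" "\<And>x. u x * (fst p x * snd p' x - fst p' x * snd p x) = 0"
    using assms(1) unfolding loc_rel_def by blast
  obtain v where v: "v \<in> nash_S U" "\<And>x. v x * (fst q x * snd q' x - fst q' x * snd q x) = 0"
    using assms(2) unfolding loc_rel_def by blast
  have "(u x * v x) * (fst (fadd p q) x * snd (fadd p' q') x - fst (fadd p' q') x * snd (fadd p q) x) = 0" for x
  proof -
    have "(u x * v x) * (fst (fadd p q) x * snd (fadd p' q') x - fst (fadd p' q') x * snd (fadd p q) x)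
      = (v x * snd q x * snd q' x) * (u x * (fst p x * snd p' x - fst p' x * snd p x))
        + (u x * snd p x * snd p' x) * (v x * (fst q x * snd q' x - fst q' x * snd q x))"
      by (simp add: algebra_simps)
    then show ?thesis by (simp only: u v mult_zero_right add_0)
  qed
  then show ?thesis unfolding loc_rel_def using nash_S_mult[OF u(1) v(1)]
    by (intro bexI[of _ "\<lambda>x. u x * v x"]) blast+
qed

lemma loc_rel_fmult:
  assumes "loc_rel U p p'" "loc_rel U q q'"
  shows "loc_rel U (fmult p q) (fmult p' q')"
proof -
  obtain u where u: "u \<in> nash_S U" "\<And>x. u x * (fst p x * snd p' x - fst p' x * snd p x) = 0"
    using assms(1) unfolding loc_rel_def by blast
  obtain v where v: "v \<in> nash_S U" "\<And>x. v x * (fst q x * snd q' x - fst q' x * snd q x) = 0"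
    using assms(2) unfolding loc_rel_def by blast
  have "(u x * v x) * (fst (fmult p q) x * snd (fmult p' q') x - fst (fmult p' q') x * snd (fmult p q) x) = 0" for x
  proof -
    have "(u x * v x) * (fst (fmult p q) x * snd (fmult p' q') x - fst (fmult p' q') x * snd (fmult p q) x)
      = (v x * fst q x * snd q' x) * (u x * (fst p x * snd p' x - fst p' x * snd p x))
        + (u x * fst p' x * snd p x) * (v x * (fst q x * snd q' x - fst q' x * snd q x))"
      by (simp add: algebra_simps)
    then show ?thesis by (simp only: u v mult_zero_right add_0)
  qed
  then show ?thesis unfolding loc_rel_def using nash_S_mult[OF u(1) v(1)]
    by (intro bexI[of _ "\<lambda>x. u x * v x"]) blast+
qed

lemma loc_rel_scale:
  assumes "loc_rel U p p'"
  shows "loc_rel U (\<lambda>x. c * fst p x, snd p) (\<lambda>x. c * fst p' x, snd p')"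
proof -
  obtain u where u: "u \<in> nash_S U" "\<And>x. u x * (fst p x * snd p' x - fst p' x * snd p x) = 0"
    using assms(1) unfolding loc_rel_def by blast
  have "u x * ((c * fst p x) * snd p' x - (c * fst p' x) * snd p x) = 0" for x
  proof -
    have "u x * ((c * fst p x) * snd p' x - (c * fst p' x) * snd p x)
        = c * (u x * (fst p x * snd p' x - fst p' x * snd p x))" by (simp add: algebra_simps)
    then show ?thesis by (simp only: u mult_zero_right)
  qed
  then show ?thesis unfolding loc_rel_def using u(1) by (intro bexI[of _ u]) simp_all
qed

lemma loc_alg_add:
  assumes "is_frac p" "is_frac q"
  shows "add (loc_alg U) (loc_cls U p) (loc_cls U q) = loc_cls U (fadd p q)"
proof -
  have "add (loc_alg U) (loc_cls U p) (loc_cls U q)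
      = \<Union>{loc_cls U (fadd p' q') | p' q'. p' \<in> loc_cls U p \<and> q' \<in> loc_cls U q}"
    unfolding loc_alg_def by simp
  also have "\<dots> = loc_cls U (fadd p q)"
    by (rule loc_cls_Union[OF assms is_frac_fadd loc_rel_fadd])
  finally show ?thesis .
qed

lemma loc_alg_mul:
  assumes "is_frac p" "is_frac q"
  shows "mul (loc_alg U) (loc_cls U p) (loc_cls U q) = loc_cls U (fmult p q)"
proof -
  have "mul (loc_alg U) (loc_cls U p) (loc_cls U q)
      = \<Union>{loc_cls U (fmult p' q') | p' q'. p' \<in> loc_cls U p \<and> q' \<in> loc_cls U q}"
    unfolding loc_alg_def by simp
  also have "\<dots> = loc_cls U (fmult p q)"
    by (rule loc_cls_Union[OF assms is_frac_fmult loc_rel_fmult])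
  finally show ?thesis .
qed

lemma loc_alg_scl:
  assumes "is_frac p"
  shows "scl (loc_alg U) c (loc_cls U p) = loc_cls U (\<lambda>x. c * fst p x, snd p)"
proof -
  \<comment> \<open>Scaling is written as a binary operation that ignores its second argument, to
    fit the lemma on unions.\<close>
  have "scl (loc_alg U) c (loc_cls U p)
      = \<Union>{loc_cls U (\<lambda>x. c * fst p' x, snd p') | p' q'. p' \<in> loc_cls U p \<and> q' \<in> loc_cls U p}"
    unfolding loc_alg_def using loc_cls_self[OF assms] by fastforce
  also have "\<dots> = loc_cls U (\<lambda>x. c * fst p x, snd p)"
    by (rule loc_cls_Union[OF assms assms is_frac_scale loc_rel_scale])
  finally show ?thesis .
qed

lemma loc_alg_zer: "zer (loc_alg U) = loc_cls U (\<lambda>x. 0, restr U (\<lambda>x. 1))"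
  and loc_alg_one: "one (loc_alg U) = loc_cls U (restr U (\<lambda>x. 1), restr U (\<lambda>x. 1))"
  by (simp_all add: loc_alg_def)

lemma is_frac_one_mult: "is_frac p \<Longrightarrow> restr U (\<lambda>x. 1) x * fst p x = fst p x"
  "is_frac p \<Longrightarrow> restr U (\<lambda>x. 1) x * snd p x = snd p x"
  "is_frac p \<Longrightarrow> fst p x * restr U (\<lambda>x. 1) x = fst p x"
  "is_frac p \<Longrightarrow> snd p x * restr U (\<lambda>x. 1) x = snd p x"
  by (simp_all add: is_frac_def E_one_mult E_mult_one nash_S_carr)

lemmas is_frac_closed = is_frac_fadd is_frac_fmult is_frac_scale is_frac_zero is_frac_one

lemma real_algebra_loc_alg: "real_algebra (loc_alg U)"
proof
  show "zer (loc_alg U) \<in> carr (loc_alg U)" "one (loc_alg U) \<in> carr (loc_alg U)"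
    using is_frac_zero is_frac_one by (auto simp: loc_alg_carr loc_alg_zer loc_alg_one)
next
  fix X assume "X \<in> carr (loc_alg U)"
  then obtain p where p: "is_frac p" and X: "X = loc_cls U p" by (auto simp: loc_alg_carr)
  show "scl (loc_alg U) c X \<in> carr (loc_alg U)" for c
    using is_frac_scale[OF p] by (auto simp: X loc_alg_scl p loc_alg_carr)
  show "add (loc_alg U) X (zer (loc_alg U)) = X"
    unfolding X loc_alg_zer loc_alg_add[OF p is_frac_zero]
    by (intro loc_cls_eqI is_frac_closed p loc_relI) (simp add: is_frac_one_mult[OF p])
  show "mul (loc_alg U) X (one (loc_alg U)) = X"
    unfolding X loc_alg_one loc_alg_mul[OF p is_frac_one]
    by (intro loc_cls_eqI is_frac_closed p loc_relI) (simp add: is_frac_one_mult[OF p])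
  show "scl (loc_alg U) c X = mul (loc_alg U) (scl (loc_alg U) c (one (loc_alg U))) X" for c
    unfolding X loc_alg_one loc_alg_scl[OF p] loc_alg_scl[OF is_frac_one] loc_alg_mul[OF is_frac_scale[OF is_frac_one] p]
    by (intro loc_cls_eqI is_frac_closed p loc_relI) (simp add: is_frac_one_mult[OF p] mult.assoc)
  show "add (loc_alg U) X (scl (loc_alg U) (-1) X) = zer (loc_alg U)"
    unfolding X loc_alg_zer loc_alg_scl[OF p] loc_alg_add[OF p is_frac_scale[OF p]]
    by (intro loc_cls_eqI is_frac_closed p loc_relI) simp
next
  fix X Y assume "X \<in> carr (loc_alg U)" "Y \<in> carr (loc_alg U)"
  then obtain p q where pq: "is_frac p" "is_frac q" and X: "X = loc_cls U p" "Y = loc_cls U q"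
    by (auto simp: loc_alg_carr)
  show "add (loc_alg U) X Y \<in> carr (loc_alg U)" "mul (loc_alg U) X Y \<in> carr (loc_alg U)"
    using is_frac_fadd[OF pq] is_frac_fmult[OF pq] by (auto simp: X loc_alg_add loc_alg_mul pq loc_alg_carr)
  show "add (loc_alg U) X Y = add (loc_alg U) Y X"
    unfolding X loc_alg_add[OF pq] loc_alg_add[OF pq(2,1)]
    by (intro loc_cls_eqI is_frac_closed pq loc_relI) (simp add: algebra_simps)
  show "mul (loc_alg U) X Y = mul (loc_alg U) Y X"
    unfolding X loc_alg_mul[OF pq] loc_alg_mul[OF pq(2,1)]
    by (intro loc_cls_eqI is_frac_closed pq loc_relI) (simp add: algebra_simps)
next
  fix X Y Z assume "X \<in> carr (loc_alg U)" "Y \<in> carr (loc_alg U)" "Z \<in> carr (loc_alg U)"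
  then obtain p q r where pq: "is_frac p" "is_frac q" "is_frac r"
    and X: "X = loc_cls U p" "Y = loc_cls U q" "Z = loc_cls U r"
    by (auto simp: loc_alg_carr)
  note ops = loc_alg_add[OF pq(1,2)] loc_alg_add[OF pq(2,3)] loc_alg_mul[OF pq(1,2)] loc_alg_mul[OF pq(2,3)]
    loc_alg_mul[OF pq(1,3)]
    loc_alg_add[OF is_frac_fadd[OF pq(1,2)] pq(3)] loc_alg_add[OF pq(1) is_frac_fadd[OF pq(2,3)]]
    loc_alg_mul[OF is_frac_fmult[OF pq(1,2)] pq(3)] loc_alg_mul[OF pq(1) is_frac_fmult[OF pq(2,3)]]
    loc_alg_mul[OF pq(1) is_frac_fadd[OF pq(2,3)]] loc_alg_add[OF is_frac_fmult[OF pq(1,2)] is_frac_fmult[OF pq(1,3)]]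
  show "add (loc_alg U) (add (loc_alg U) X Y) Z = add (loc_alg U) X (add (loc_alg U) Y Z)"
    unfolding X ops by (intro loc_cls_eqI is_frac_closed pq loc_relI) (simp add: algebra_simps)
  show "mul (loc_alg U) (mul (loc_alg U) X Y) Z = mul (loc_alg U) X (mul (loc_alg U) Y Z)"
    unfolding X ops by (intro loc_cls_eqI is_frac_closed pq loc_relI) (simp add: algebra_simps)
  show "mul (loc_alg U) X (add (loc_alg U) Y Z) = add (loc_alg U) (mul (loc_alg U) X Y) (mul (loc_alg U) X Z)"
    unfolding X ops by (intro loc_cls_eqI is_frac_closed pq loc_relI) (simp add: algebra_simps)
qed

lemma loc_emb_eq: "loc_emb U h = loc_cls U (h, restr U (\<lambda>x. 1))"
  by (simp add: loc_emb_def)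

lemma loc_emb_carr: "h \<in> carr (E_alg U) \<Longrightarrow> loc_emb U h \<in> carr (loc_alg U)"
  using is_frac_emb by (auto simp: loc_emb_eq loc_alg_carr)

lemma smooth_embedding_E_alg: "smooth_embedding (E_alg U) U (\<lambda>h. h)"
  by (intro smooth_embedding.intro real_algebra_E_alg smooth_embedding_axioms.intro) (simp_all add: U)

lemma smooth_embedding_loc_alg: "smooth_embedding (loc_alg U) U (loc_emb U)"
proof (intro smooth_embedding.intro real_algebra_loc_alg smooth_embedding_axioms.intro)
  fix h k assume h: "h \<in> carr (E_alg U)" and k: "k \<in> carr (E_alg U)"
  note [simp] = E_mult_one[OF h] E_mult_one[OF k] E_one_mult[OF h] E_one_mult[OF k]
  show "loc_emb U (\<lambda>x. h x + k x) = add (loc_alg U) (loc_emb U h) (loc_emb U k)"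
    unfolding loc_emb_eq loc_alg_add[OF is_frac_emb[OF h] is_frac_emb[OF k]]
    by (intro loc_cls_eqI is_frac_closed is_frac_emb E_add h k loc_relI) (simp add: algebra_simps flip: mult.assoc)
  show "loc_emb U (\<lambda>x. h x * k x) = mul (loc_alg U) (loc_emb U h) (loc_emb U k)"
    unfolding loc_emb_eq loc_alg_mul[OF is_frac_emb[OF h] is_frac_emb[OF k]]
    by (intro loc_cls_eqI is_frac_closed is_frac_emb E_mul h k loc_relI) (simp add: algebra_simps flip: mult.assoc)
next
  fix h c assume h: "h \<in> carr (E_alg U)"
  show "loc_emb U h \<in> carr (loc_alg U)" by (rule loc_emb_carr[OF h])
  show "loc_emb U (\<lambda>x. c * h x) = scl (loc_alg U) c (loc_emb U h)"
    unfolding loc_emb_eq loc_alg_scl[OF is_frac_emb[OF h]] by simp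
qed (simp_all add: U loc_emb_eq loc_alg_one)

section \<open>Evaluation of fractions and the return from differentials to Nash functions\<close>

definition loc_ev :: "((real^'n \<Rightarrow> real) \<times> (real^'n \<Rightarrow> real)) set \<Rightarrow> (real^'n \<Rightarrow> real) ultrapower" where
  "loc_ev X = (let p = SOME p. p \<in> X in ev U (fst p) / ev U (snd p))"

lemma ev_nash_S: "s \<in> nash_S U \<Longrightarrow> ev U s \<noteq> 0"
  using ev_eq_0_iff[OF U, of s] unfolding nash_S_def nash_on_def by blast

text \<open>The multiplier \<open>u\<close> in the equivalence of two fractions has a nonzero value
  at the generic point, so it can be cancelled in the field and the quotients agree.\<close>

lemma loc_ev_cls:
  assumes p: "is_frac p"
  shows "loc_ev (loc_cls U p) = ev U (fst p) / ev U (snd p)"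
proof -
  define q where "q = (SOME q. q \<in> loc_cls U p)"
  have "q \<in> loc_cls U p" unfolding q_def using loc_cls_self[OF p] by (rule someI)
  then have q: "is_frac q" "loc_rel U p q" by (simp_all add: loc_cls_eq_Collect)
  then obtain u where u: "u \<in> nash_S U" "\<And>x. u x * (fst p x * snd q x - fst q x * snd p x) = 0"
    unfolding loc_rel_def by blast
  have "ev U u * (ev U (fst p) * ev U (snd q) - ev U (fst q) * ev U (snd p))
      = ev U (\<lambda>x. u x * (fst p x * snd q x - fst q x * snd p x))"
    by (simp add: ev_mult ev_diff)
  also have "\<dots> = 0" by (simp only: u ev_zero)
  finally have "ev U (fst p) * ev U (snd q) = ev U (fst q) * ev U (snd p)"
    using ev_nash_S[OF u(1)] by simp
  moreover have "ev U (snd p) \<noteq> 0" "ev U (snd q) \<noteq> 0"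
    using p q ev_nash_S by (auto simp: is_frac_def)
  ultimately have "ev U (fst q) / ev U (snd q) = ev U (fst p) / ev U (snd p)"
    by (simp add: frac_eq_eq)
  then show ?thesis by (simp add: loc_ev_def Let_def q_def)
qed

lemma ev_restr_one: "ev U (restr U (\<lambda>x. 1)) = 1"
  by (simp add: ev_restr[OF U] ev_one)

lemma loc_ev_emb: "h \<in> carr (E_alg U) \<Longrightarrow> loc_ev (loc_emb U h) = ev U h"
  by (simp add: loc_emb_eq loc_ev_cls is_frac_emb ev_restr_one)

lemma ev_snd_neq_0: "is_frac p \<Longrightarrow> ev U (snd p) \<noteq> 0"
  using ev_nash_S by (simp add: is_frac_def)

lemma nash_on_of_kahler_rel_E:
  assumes f: "real_analytic_on f U" and g: "g \<in> nash_S U"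
    and c: "\<And>i. c i \<in> carr (E_alg U)"
    and rel: "fmul (E_alg U) g (fplus (E_alg U) (dsym (E_alg U) (restr U f))
       (fscl (E_alg U) (-1) (lin_comb (E_alg U) c (coordE U)))) \<in> kahler_rel (E_alg U)"
  shows "nash_on U f"
  unfolding nash_on_iff_derivation[OF U]
proof (intro conjI allI impI f)
  fix D assume D: "derivation_over (poly_evs U) D"
  interpret real_algebra "E_alg U" by (rule real_algebra_E_alg)
  have "D (ev U (restr U f)) = 0"
  \<comment> \<open>Scalars act through the values of constant functions, which are values of
    polynomials and hence killed by \<open>D\<close>.\<close>
  proof (rule derivation_eq_0_of_kahler_rel[where e = "ev U" and \<kappa> = "\<lambda>c. ev U (\<lambda>_. c)", OF _ _ _ _ _ D _ rel])
    show "D (ev U (coordE U i)) = 0" for i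
      using derivation_over_zero[OF D ev_coord_in_poly_evs] by (simp add: coordE_def ev_restr[OF U])
  qed (use g c ev_nash_S ev_const_in_poly_evs in \<open>simp_all add: ev_add ev_mult ev_zero ev_restr_one nash_S_carr\<close>)
  then show "D (ev U f) = 0" by (simp add: ev_restr[OF U])
qed

lemma nash_on_of_kahler_eq_loc:
  assumes f: "real_analytic_on f U" and c: "\<And>i. c i \<in> carr (loc_alg U)"
    and rel: "kahler_eq (loc_alg U) (dsym (loc_alg U) (loc_emb U (restr U f)))
       (lin_comb (loc_alg U) c (\<lambda>i. loc_emb U (coordE U i)))"
  shows "nash_on U f"
  unfolding nash_on_iff_derivation[OF U]
proof (intro conjI allI impI f)
  fix D assume D: "derivation_over (poly_evs U) D"
  interpret real_algebra "loc_alg U" by (rule real_algebra_loc_alg)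
  \<comment> \<open>The trivial multiplier \<open>1\<close> gives the equation the shape of a
    relation with a multiplier.\<close>
  have rel': "fmul (loc_alg U) (one (loc_alg U)) (fplus (loc_alg U) (dsym (loc_alg U) (loc_emb U (restr U f)))
       (fscl (loc_alg U) (-1) (lin_comb (loc_alg U) c (\<lambda>i. loc_emb U (coordE U i))))) \<in> kahler_rel (loc_alg U)"
    using rel unfolding kahler_eq_def by (rule kahler_rel_fmul) simp
  have fE: "restr U f \<in> carr (E_alg U)" and xE: "coordE U i \<in> carr (E_alg U)" for i
    unfolding coordE_def by (intro restr_analytic_carr U f real_analytic_on_coord)+
  have "D (loc_ev (loc_emb U (restr U f))) = 0"
  proof (rule derivation_eq_0_of_kahler_rel[where e = loc_ev and \<kappa> = "\<lambda>c. ev U (\<lambda>_. c)", OF _ _ _ _ _ D _ rel'])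
    show "D (loc_ev (loc_emb U (coordE U i))) = 0" for i
      using derivation_over_zero[OF D ev_coord_in_poly_evs]
      by (simp add: loc_ev_emb[OF xE]) (simp add: coordE_def ev_restr[OF U])
    show "loc_ev (add (loc_alg U) X Y) = loc_ev X + loc_ev Y"
      if XY: "X \<in> carr (loc_alg U)" "Y \<in> carr (loc_alg U)" for X Y
    proof -
      obtain p q where pq: "is_frac p" "is_frac q" and X: "X = loc_cls U p" "Y = loc_cls U q"
        using XY unfolding loc_alg_carr by blast
      show ?thesis unfolding X loc_alg_add[OF pq] loc_ev_cls[OF pq(1)] loc_ev_cls[OF pq(2)]
          loc_ev_cls[OF is_frac_fadd[OF pq]]
        using ev_snd_neq_0[OF pq(1)] ev_snd_neq_0[OF pq(2)] by (simp add: ev_add ev_mult field_simps)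
    qed
    show "loc_ev (mul (loc_alg U) X Y) = loc_ev X * loc_ev Y"
      if XY: "X \<in> carr (loc_alg U)" "Y \<in> carr (loc_alg U)" for X Y
    proof -
      obtain p q where pq: "is_frac p" "is_frac q" and X: "X = loc_cls U p" "Y = loc_cls U q"
        using XY unfolding loc_alg_carr by blast
      show ?thesis unfolding X loc_alg_mul[OF pq] loc_ev_cls[OF pq(1)] loc_ev_cls[OF pq(2)]
          loc_ev_cls[OF is_frac_fmult[OF pq]]
        by (simp add: ev_mult)
    qed
    show "loc_ev (scl (loc_alg U) c X) = ev U (\<lambda>_. c) * loc_ev X" if XY: "X \<in> carr (loc_alg U)" for X c
    proof -
      obtain p where p: "is_frac p" and X: "X = loc_cls U p" using XY unfolding loc_alg_carr by blast
      show ?thesis unfolding X loc_alg_scl[OF p] loc_ev_cls[OF p] loc_ev_cls[OF is_frac_scale[OF p]]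
        by (simp add: ev_mult)
    qed
    show "loc_ev (zer (loc_alg U)) = 0" "loc_ev (one (loc_alg U)) = 1" "loc_ev (one (loc_alg U)) \<noteq> 0"
      by (simp_all add: loc_alg_zer loc_alg_one loc_ev_cls is_frac_zero is_frac_one ev_zero ev_restr_one)
  qed (use c ev_const_in_poly_evs in simp_all)
  then show "D (ev U f) = 0" by (simp add: loc_ev_emb[OF fE] ev_restr[OF U])
qed

text \<open>The element \<open>g\<close> of \<open>nash_S U\<close> becomes a unit in the
  localization; its inverse is the class of the fraction \<open>(1, g)\<close>.\<close>

lemma kahler_rel_loc_cancel:
  assumes g: "g \<in> nash_S U" and rel: "fmul (loc_alg U) (loc_emb U g) G \<in> kahler_rel (loc_alg U)"
    and G: "real_algebra.form (loc_alg U) G"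
  shows "G \<in> kahler_rel (loc_alg U)"
proof -
  interpret real_algebra "loc_alg U" by (rule real_algebra_loc_alg)
  let ?inv = "loc_cls U (restr U (\<lambda>x. 1), g)"
  have gE: "g \<in> carr (E_alg U)" using g by (rule nash_S_carr)
  have inv: "is_frac (restr U (\<lambda>x. 1), g)" using g by (simp add: is_frac_def E_one)
  then have invc: "?inv \<in> carr (loc_alg U)" by (auto simp: loc_alg_carr)
  have "mul (loc_alg U) ?inv (loc_emb U g) = one (loc_alg U)"
    unfolding loc_emb_eq loc_alg_one loc_alg_mul[OF inv is_frac_emb[OF gE]]
    by (intro loc_cls_eqI is_frac_closed inv is_frac_emb gE loc_relI) (simp add: E_one_mult[OF gE] E_mult_one[OF gE])
  then have "fmul (loc_alg U) ?inv (fmul (loc_alg U) (loc_emb U g) G) = G"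
    using invc loc_emb_carr[OF gE] G by (simp add: fmul_fmul)
  then show ?thesis using kahler_rel_fmul[OF rel invc] by simp
qed

end

theorem theorem2p1:
  fixes U :: "(real^'n) set" and f :: "real^'n \<Rightarrow> real"
  assumes "semialg U" and "open U" and "connected U" and "U \<noteq> {}"
    and "real_analytic_on f U"
  shows "(nash_on U f \<longleftrightarrow>
           (\<exists>g\<in>nash_S U. fmul (E_alg U) g
              (fplus (E_alg U) (dsym (E_alg U) (restr U f))
                 (fscl (E_alg U) (-1)
                    (lin_comb (E_alg U) (\<lambda>i. restr U (partial i f)) (coordE U))))
              \<in> kahler_rel (E_alg U)))
       \<and> ((\<exists>g\<in>nash_S U. fmul (E_alg U) g
              (fplus (E_alg U) (dsym (E_alg U) (restr U f))
                 (fscl (E_alg U) (-1)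
                    (lin_comb (E_alg U) (\<lambda>i. restr U (partial i f)) (coordE U))))
              \<in> kahler_rel (E_alg U))
          \<longleftrightarrow> kahler_eq (loc_alg U) (dsym (loc_alg U) (loc_emb U (restr U f)))
                (lin_comb (loc_alg U) (\<lambda>i. loc_emb U (restr U (partial i f)))
                   (\<lambda>i. loc_emb U (coordE U i))))
       \<and> (kahler_eq (loc_alg U) (dsym (loc_alg U) (loc_emb U (restr U f)))
                (lin_comb (loc_alg U) (\<lambda>i. loc_emb U (restr U (partial i f)))
                   (\<lambda>i. loc_emb U (coordE U i)))
          \<longleftrightarrow> (\<exists>F. (\<forall>i. F i \<in> carr (loc_alg U)) \<and>
                 kahler_eq (loc_alg U) (dsym (loc_alg U) (loc_emb U (restr U f)))
                   (lin_comb (loc_alg U) F (\<lambda>i. loc_emb U (coordE U i)))))"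
proof -
  note U = assms(2-4) and f = assms(5)
  have coordE: "coordE U = (\<lambda>i. restr U (\<lambda>x. x $ i))"
    by (simp add: coordE_def fun_eq_iff)
  have pf: "restr U (partial i f) \<in> carr (E_alg U)" for i
    by (intro restr_analytic_carr U real_analytic_on_partial f)
  interpret E: smooth_embedding "E_alg U" U "\<lambda>h. h" by (rule smooth_embedding_E_alg[OF U])
  interpret L: smooth_embedding "loc_alg U" U "loc_emb U" by (rule smooth_embedding_loc_alg[OF U])
  have 12: "nash_on U f \<longleftrightarrow>
      (\<exists>g\<in>nash_S U. fmul (E_alg U) g
          (fplus (E_alg U) (dsym (E_alg U) (restr U f))
             (fscl (E_alg U) (-1)
                (lin_comb (E_alg U) (\<lambda>i. restr U (partial i f)) (coordE U))))
          \<in> kahler_rel (E_alg U))" (is "_ \<longleftrightarrow> ?c2")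
  proof
    show "nash_on U f \<Longrightarrow> ?c2"
      using E.nash_on_imp_kahler_rel[OF U(2,3), of f] unfolding E.omega_def E.DL_def coordE .
    show "?c2 \<Longrightarrow> nash_on U f"
      by (elim bexE) (rule nash_on_of_kahler_rel_E[OF U f _ pf])
  qed
  have 13: "kahler_eq (loc_alg U) (dsym (loc_alg U) (loc_emb U (restr U f)))
      (lin_comb (loc_alg U) (\<lambda>i. loc_emb U (restr U (partial i f))) (\<lambda>i. loc_emb U (coordE U i)))" (is ?c3)
    if nash: "nash_on U f"
  proof -
    obtain g where g: "g \<in> nash_S U" "fmul (loc_alg U) (loc_emb U g) (L.omega f) \<in> kahler_rel (loc_alg U)"
      using L.nash_on_imp_kahler_rel[OF U(2,3) nash] by blast
    have "L.omega f \<in> kahler_rel (loc_alg U)"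
      by (rule kahler_rel_loc_cancel[OF U g L.form_omega[OF real_analytic_on_imp_smooth_on[OF f]]])
    then show ?thesis unfolding kahler_eq_def L.omega_def L.DL_def coordE .
  qed
  have 34: "\<exists>F. (\<forall>i. F i \<in> carr (loc_alg U)) \<and>
      kahler_eq (loc_alg U) (dsym (loc_alg U) (loc_emb U (restr U f)))
        (lin_comb (loc_alg U) F (\<lambda>i. loc_emb U (coordE U i)))" (is ?c4) if ?c3
    using that loc_emb_carr[OF U pf] by (intro exI[of _ "\<lambda>i. loc_emb U (restr U (partial i f))"]) blast
  have 41: "nash_on U f" if ?c4
    using that nash_on_of_kahler_eq_loc[OF U f] by blast
  \<comment> \<open>(1) and (2) are equivalent outright; the cycle from (1) through (3) and (4) back
    to (1) gives the rest.\<close>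
  show ?thesis using 12 13 34 41 by blast
qed

end
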